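(* There exists a constant $C<\infty$ such that for all $n\ge1$ and $x\in\mathbb{T}_n$, $$\Big|\mathrm{E}_n^+h(x)-m_{n'}\big(1-2^{-|x|}\mathbf{1}_{\{|x|<l_n\}}\big)\Big|\le C.$$
   Context: $\mathbb{T}$ is the infinite binary tree rooted at $0$ (every vertex has exactly two children), $|x|$ is the depth of $x$ and $x\wedge y$ is the deepest common ancestor of $x,y$. The field $h=(h(x):x\in\mathbb{T})$ is a centered Gaussian process with $\mathrm{E}[h(x)h(y)]=|x\wedge y|$ (equivalently, a branching random walk with deterministic binary branching and i.i.d. standard Gaussian steps, $h(0)=0$). $\mathbb{T}_n$ (resp. $\mathbb{L}_n$) is the set of vertices at depth at most (resp. exactly) $n$; $\mathrm{P}_n$ is the law of $h$ restricted to $\mathbb{T}_n$. $\Omega_n^+=\{h(x)\ge0:\ x\in\mathbb{L}_n\}$, $\mathrm{P}_n^+=\mathrm{P}_n(\cdot\mid\Omega_n^+)$, and $\mathrm{E}_n^+$ is expectation under $\mathrm{P}_n^+$. For $n\ge1$: $c_0=\sqrt{2\log2}$, $m_n=c_0n-\tfrac32c_0^{-1}\log n$, $l_n=\lfloor\log_2 n\rfloor$, $n'=n-l_n$. *)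

theory Defs
  imports "HOL-Probability.Probability" "HOL-Library.Sublist"
begin

text \<open>A vertex of the rooted binary tree is the word of left/right choices leading to it from the
  root \<^term>\<open>[]\<close>: its depth is the length of the word, and the deepest common ancestor of two
  vertices is their longest common prefix.\<close>

type_synonym vertex = "bool list"

definition tree :: "nat \<Rightarrow> vertex set" where
  "tree n = {x. length x \<le> n}"

definition leaves :: "nat \<Rightarrow> vertex set" where
  "leaves n = {x. length x = n}"

text \<open>Normal distributions with variance zero (point masses) have to be allowed: the field vanishes
  at the root, and linear combinations of its values may cancel.\<close>

definition gaussian_rv :: "'a measure \<Rightarrow> ('a \<Rightarrow> real) \<Rightarrow> bool" where
  "gaussian_rv M X \<longleftrightarrow> X \<in> borel_measurable M \<and>
     ((\<exists>\<mu> \<sigma>. \<sigma> > 0 \<and> distributed M lborel X (normal_density \<mu> \<sigma>)) \<or>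
      (\<exists>\<mu>. AE \<omega> in M. X \<omega> = \<mu>))"

definition gaussian_process :: "'a measure \<Rightarrow> ('i \<Rightarrow> 'a \<Rightarrow> real) \<Rightarrow> bool" where
  "gaussian_process M h \<longleftrightarrow> prob_space M \<and>
     (\<forall>F c. finite F \<longrightarrow> gaussian_rv M (\<lambda>\<omega>. \<Sum>i\<in>F. c i * h i \<omega>))"

definition tree_field :: "'a measure \<Rightarrow> (vertex \<Rightarrow> 'a \<Rightarrow> real) \<Rightarrow> bool" where
  "tree_field M h \<longleftrightarrow> gaussian_process M h \<and>
     (\<forall>x. (\<integral>\<omega>. h x \<omega> \<partial>M) = 0) \<and>
     (\<forall>x y. (\<integral>\<omega>. h x \<omega> * h y \<omega> \<partial>M) = real (length (longest_common_prefix x y)))"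

definition field_law :: "'a measure \<Rightarrow> (vertex \<Rightarrow> 'a \<Rightarrow> real) \<Rightarrow> nat \<Rightarrow> (vertex \<Rightarrow> real) measure" where
  "field_law M h n =
     distr M (\<Pi>\<^sub>M x\<in>tree n. borel) (\<lambda>\<omega>. \<lambda>x\<in>tree n. h x \<omega>)"

definition Omega_plus :: "nat \<Rightarrow> (vertex \<Rightarrow> real) set" where
  "Omega_plus n = {\<phi> \<in> space (\<Pi>\<^sub>M x\<in>tree n. (borel :: real measure)). \<forall>x\<in>leaves n. 0 \<le> \<phi> x}"

text \<open>The library's \<^const>\<open>uniform_measure\<close> of a measure and an event is the measure conditioned
  on that event.\<close>

definition field_law_plus :: "'a measure \<Rightarrow> (vertex \<Rightarrow> 'a \<Rightarrow> real) \<Rightarrow> nat \<Rightarrow> (vertex \<Rightarrow> real) measure" where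
  "field_law_plus M h n = uniform_measure (field_law M h n) (Omega_plus n)"

definition c0 :: real where
  "c0 = sqrt (2 * ln 2)"

definition m_seq :: "nat \<Rightarrow> real" where
  "m_seq n = c0 * real n - 3 / 2 * inverse c0 * ln (real n)"

definition l_seq :: "nat \<Rightarrow> nat" where
  "l_seq n = nat \<lfloor>log 2 (real n)\<rfloor>"

end

theory Submission
  imports Defs "HOL-Real_Asymp.Real_Asymp"
begin

text \<open>Let \<open>p n u\<close> be the probability that \<open>u + h \<ge> 0\<close> on the leaves of depth \<open>n\<close>, so that
  \<open>p (n + 1) u = (E (p n (u + Z)))\<^sup>2\<close> with \<open>Z\<close> standard normal. Splitting at the root and Gaussian
  integration by parts show that the conditioned mean at a vertex of depth \<open>k\<close> is \<open>(1 - 2^(-k)) A\<close>, where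
  \<open>A\<close> is the derivative of \<open>ln \<circ> p n\<close> at 0; so \<open>A = m + O(1)\<close> has to be shown for
  \<open>m = m_seq (n - l_seq n)\<close>, and the discarded \<open>2^(-k)\<close> for \<open>k \<ge> l_seq n\<close> costs \<open>O(m / n)\<close>.
  The function \<open>ln \<circ> p n\<close> has second derivative at least \<open>-1/(1 - 2^(-n))\<close>. Combined with the lower bound
  \<open>ln (p n 0) \<ge> - m\<^sup>2/2 - O(n)\<close> and the upper bounds \<open>ln (p n (-n)) \<le> - (m + n)\<^sup>2/2 + O(n)\<close>
  and \<open>ln (p n m) \<le> 0\<close>, this bounds \<open>A - m\<close> from both sides. The two bounds come from iterating the
  recursion over the first \<open>l_seq n\<close> generations, starting from the tightness of the maximum around \<open>m_seq\<close>,
  with an exponential left tail. Tightness is proved by comparing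
  \<open>exp (c0 y) (1 - p n (y + c0 n))\<close>, which up to a quadratic killing term solves the heat equation, with
  random walks killed at a barrier.\<close>

section \<open>Gaussian convolution\<close>

text \<open>The depth \<open>l_seq n\<close> balances two errors. The mean of the field over the 2^l
  vertices of generation l has variance 1 - 2^(-l), so raising it by m costs m^2/2 up to O(m^2
  2^(-l)); then each of the 2^l subtrees below must be nonnegative at constant cost, O(2^l) in all.
  With 2^l and m of order n both errors are O(n). Such an error in \<open>ln\<close> of
  \<open>wall\<close> is harmless, because A is tested with shifts of order n and dividing by the
  shift leaves O(1). Semiconcavity thus replaces sharp asymptotics of the probability.

  The price is that m must be correct up to O(1), so the maximum has to be located including its
  logarithmic correction. The factor n^(-3/2) behind it is the order of the probability that a walk
  stays positive for n steps and ends near 0. The comparison with killed walks needs the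
  nonlinearity to be summable in time, but a first application of the barrier loses powers of the
  logarithm. Hence a bootstrap: a rough bound with exponent -5/4, still summable, then the exponent
  -3/2.\<close>

lemma real_distribution_gauss [simp]: "real_distribution std_normal_distribution"
  by (rule real_dist_normal_dist)

interpretation gauss: real_distribution std_normal_distribution
  by (rule real_dist_normal_dist)

section \<open>Exponential tilting and moments of the standard normal law\<close>

lemma std_normal_density_tilt:
  "std_normal_density z * exp (t * z - t\<^sup>2 / 2) = std_normal_density (z - t)"
  by (simp add: std_normal_density_def exp_add [symmetric] power2_eq_square algebra_simps
      add_divide_distrib diff_divide_distrib)

text \<open>Cameron-Martin in one dimension. It lets differentiation in the base point act on the
  exponential weight, so functions that are merely measurable, such as the step
  \<open>wall 0\<close>, can be differentiated after convolution.\<close>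

lemma
  fixes f :: "real \<Rightarrow> real"
  assumes [measurable]: "f \<in> borel_measurable borel"
  shows gauss_tilt_integrable_iff:
      "integrable std_normal_distribution (\<lambda>z. exp (t * z - t\<^sup>2 / 2) * f z)
        \<longleftrightarrow> integrable std_normal_distribution (\<lambda>z. f (z + t))"
    and gauss_tilt:
      "(\<integral>z. exp (t * z - t\<^sup>2 / 2) * f z \<partial>std_normal_distribution)
        = (\<integral>z. f (z + t) \<partial>std_normal_distribution)"
proof -
  have 1: "integrable std_normal_distribution (\<lambda>z. exp (t * z - t\<^sup>2 / 2) * f z)
        \<longleftrightarrow> integrable lborel (\<lambda>z. std_normal_density (z - t) * f z)"
    by (subst integrable_density)
       (auto simp: std_normal_density_tilt [symmetric] mult.assoc normal_density_nonneg)
  have 2: "integrable std_normal_distribution (\<lambda>z. f (z + t))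
        \<longleftrightarrow> integrable lborel (\<lambda>z. std_normal_density z * f (z + t))"
    by (subst integrable_density) (auto simp: normal_density_nonneg)
  have 3: "(\<integral>z. exp (t * z - t\<^sup>2 / 2) * f z \<partial>std_normal_distribution)
        = (\<integral>z. std_normal_density (z - t) * f z \<partial>lborel)"
    by (subst integral_density)
       (auto simp: std_normal_density_tilt [symmetric] mult.assoc normal_density_nonneg)
  have 4: "(\<integral>z. f (z + t) \<partial>std_normal_distribution)
        = (\<integral>z. std_normal_density z * f (z + t) \<partial>lborel)"
    by (subst integral_density) (auto simp: normal_density_nonneg)
  show "integrable std_normal_distribution (\<lambda>z. exp (t * z - t\<^sup>2 / 2) * f z)
        \<longleftrightarrow> integrable std_normal_distribution (\<lambda>z. f (z + t))"
    unfolding 1 2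
    using lborel_integrable_real_affine_iff[of 1 "\<lambda>z. std_normal_density (z - t) * f z" t]
    by (simp add: add.commute)
  show "(\<integral>z. exp (t * z - t\<^sup>2 / 2) * f z \<partial>std_normal_distribution)
        = (\<integral>z. f (z + t) \<partial>std_normal_distribution)"
    unfolding 3 4
    using lborel_integral_real_affine[of 1 "\<lambda>z. std_normal_density (z - t) * f z" t]
    by (simp add: add.commute)
qed

lemma gauss_integrable_exp [simp]: "integrable std_normal_distribution (\<lambda>z. exp (t * z))"
proof -
  have "integrable std_normal_distribution (\<lambda>z. exp (t\<^sup>2 / 2) * (exp (t * z - t\<^sup>2 / 2) * 1))"
    by (rule integrable_mult_right) (subst gauss_tilt_integrable_iff, auto)
  also have "(\<lambda>z. exp (t\<^sup>2 / 2) * (exp (t * z - t\<^sup>2 / 2) * 1)) = (\<lambda>z. exp (t * z))"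
    by (simp add: mult_exp_exp)
  finally show ?thesis .
qed

lemma gauss_integral_exp: "(\<integral>z. exp (t * z) \<partial>std_normal_distribution) = exp (t\<^sup>2 / 2)"
proof -
  have "(\<integral>z. exp (t * z) \<partial>std_normal_distribution)
      = (\<integral>z. exp (t\<^sup>2 / 2) * (exp (t * z - t\<^sup>2 / 2) * 1) \<partial>std_normal_distribution)"
    by (rule Bochner_Integration.integral_cong) (auto simp: mult_exp_exp)
  also have "\<dots> = exp (t\<^sup>2 / 2)"
    using gauss.prob_space by (subst integral_mult_right_zero, subst gauss_tilt) auto
  finally show ?thesis .
qed

lemma gauss_integrable_exp_abs: "integrable std_normal_distribution (\<lambda>z. exp (t * \<bar>z\<bar>))"
proof (rule Bochner_Integration.integrable_bound)
  show "integrable std_normal_distribution (\<lambda>z. exp (t * z) + exp (- t * z))"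
    by (intro Bochner_Integration.integrable_add gauss_integrable_exp)
  show "AE z in std_normal_distribution. norm (exp (t * \<bar>z\<bar>)) \<le> norm (exp (t * z) + exp (- t * z))"
  proof (rule AE_I2)
    fix z :: real
    have "exp (t * \<bar>z\<bar>) \<le> exp (t * z) + exp (- t * z)" by (cases "0 \<le> z") auto
    then show "norm (exp (t * \<bar>z\<bar>)) \<le> norm (exp (t * z) + exp (- t * z))" by simp
  qed
qed auto

lemma gauss_integrable_id [simp]: "integrable std_normal_distribution (\<lambda>z. z)"
  using integrable_std_normal_distribution_moment[of 1] by simp

lemma gauss_integral_abs_le: "(\<integral>z. \<bar>z\<bar> \<partial>std_normal_distribution) \<le> 1"
proof -
  have "(\<integral>z. \<bar>z\<bar> \<partial>std_normal_distribution) = sqrt (2 / pi)"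
    using std_normal_distribution_odd_moments_abs(1)[of 0] by simp
  also have "\<dots> \<le> 1" using pi_gt3 by (subst real_sqrt_le_1_iff) simp
  finally show ?thesis .
qed

lemma gauss_integral_id: "(\<integral>z. z \<partial>std_normal_distribution) = 0"
  using integral_std_normal_distribution_moment_odd[of 1] by simp

lemma gauss_integral_square: "(\<integral>z. z\<^sup>2 \<partial>std_normal_distribution) = 1"
  using std_normal_distribution_even_moments(1)[of 1] by (simp add: fact_numeral)

lemma gauss_integrable_square [simp]: "integrable std_normal_distribution (\<lambda>z. z\<^sup>2)"
  using integrable_std_normal_distribution_moment[of 2] by simp

section \<open>Convolution with the standard normal law and its derivative\<close>

definition gconv :: "(real \<Rightarrow> real) \<Rightarrow> real \<Rightarrow> real" where
  "gconv f x = (\<integral>z. f (x + z) \<partial>std_normal_distribution)"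

lemma gauss_integrable_bounded:
  fixes f :: "real \<Rightarrow> real"
  assumes [measurable]: "f \<in> borel_measurable borel" and "\<And>z. \<bar>f z\<bar> \<le> B"
  shows "integrable std_normal_distribution (\<lambda>z. f (x + z))"
  by (rule gauss.integrable_const_bound[where B=B]) (use assms in auto)

lemma gconv_measurable [measurable (raw)]:
  assumes [measurable]: "f \<in> borel_measurable borel"
  shows "gconv f \<in> borel_measurable borel"
  unfolding gconv_def by measurable

lemma gconv_tilt:
  fixes f :: "real \<Rightarrow> real"
  assumes [measurable]: "f \<in> borel_measurable borel"
  shows "gconv f (x + t) = (\<integral>z. exp (t * z - t\<^sup>2 / 2) * f (x + z) \<partial>std_normal_distribution)"
  unfolding gconv_def by (subst gauss_tilt) (auto simp: ac_simps)

lemma gconv_mono: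
  assumes "\<And>z. f z \<le> g z" "integrable std_normal_distribution (\<lambda>z. f (x + z))"
    "integrable std_normal_distribution (\<lambda>z. g (x + z))"
  shows "gconv f x \<le> gconv g x"
  unfolding gconv_def by (intro integral_mono assms)

lemma gconv_nonneg: "(\<And>z. 0 \<le> f z) \<Longrightarrow> 0 \<le> gconv f x"
  unfolding gconv_def by (intro integral_nonneg_AE) auto

lemma gconv_le:
  assumes "f \<in> borel_measurable borel" "\<And>z. 0 \<le> f z" "\<And>z. f z \<le> B"
  shows "gconv f x \<le> B"
proof -
  have "\<bar>f z\<bar> \<le> B" for z using assms(2,3)[of z] by simp
  moreover have "0 \<le> B" using assms(2,3) order_trans by blast
  ultimately have "gconv f x \<le> (\<integral>z. B \<partial>std_normal_distribution)"
    unfolding gconv_def by (intro integral_mono gauss_integrable_bounded[where B=B] assms) (auto simp: assms)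
  then show ?thesis using gauss.prob_space by simp
qed

lemma exp_remainder_bound:
  fixes x :: real
  shows "\<bar>exp x - 1 - x\<bar> \<le> x\<^sup>2 * exp \<bar>x\<bar>"
proof -
  obtain t where t: "\<bar>t\<bar> \<le> \<bar>x\<bar>" and
    "exp x = (\<Sum>m<2. (x ^ m) / fact m) + (exp t / fact 2) * x ^ 2"
    using Maclaurin_exp_le[of x 2] by auto
  then have "exp x - 1 - x = exp t / 2 * x\<^sup>2" by (simp add: numeral_2_eq_2)
  then have "\<bar>exp x - 1 - x\<bar> = exp t / 2 * x\<^sup>2" by (simp only: abs_mult) simp
  also have "\<dots> \<le> exp \<bar>x\<bar> * x\<^sup>2"
  proof (rule mult_right_mono)
    have "exp t \<le> exp \<bar>x\<bar>" using t by simp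
    then show "exp t / 2 \<le> exp \<bar>x\<bar>" using exp_ge_zero[of t] by linarith
  qed simp
  finally show ?thesis by (simp add: mult.commute)
qed

text \<open>The bound is quadratic in \<open>t\<close> with a factor in \<open>z\<close> that is
  Gaussian-integrable, so against a bounded \<open>f\<close> it controls the second-order remainder
  of \<open>gconv f\<close> uniformly in the base point. The restriction on \<open>t\<close> keeps
  the exponent below \<open>\<bar>z\<bar> + 1\<close>.\<close>

lemma tilt_remainder_bound:
  fixes t z :: real
  assumes "\<bar>t\<bar> \<le> 1"
  shows "\<bar>exp (t * z - t\<^sup>2 / 2) - 1 - t * z\<bar> \<le> t\<^sup>2 * exp (3 * (\<bar>z\<bar> + 1)) * 2"
proof -
  let ?x = "t * z - t\<^sup>2 / 2"
  have tt: "t\<^sup>2 \<le> \<bar>t\<bar>" using mult_left_mono[OF assms, of "\<bar>t\<bar>"] by (simp add: power2_eq_square)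
  have x: "\<bar>?x\<bar> \<le> \<bar>t\<bar> * (\<bar>z\<bar> + 1)"
    using abs_triangle_ineq4[of "t * z" "t\<^sup>2 / 2"] tt by (simp add: abs_mult algebra_simps)
  then have x1: "\<bar>?x\<bar> \<le> \<bar>z\<bar> + 1"
    using assms mult_right_mono[of "\<bar>t\<bar>" 1 "\<bar>z\<bar> + 1"] by simp
  have "?x\<^sup>2 \<le> (\<bar>t\<bar> * (\<bar>z\<bar> + 1))\<^sup>2" using power_mono[OF x abs_ge_zero, of 2] by (simp only: power2_abs)
  then have x2: "?x\<^sup>2 \<le> t\<^sup>2 * (\<bar>z\<bar> + 1)\<^sup>2" by (simp add: power_mult_distrib)
  have e1: "\<bar>z\<bar> + 1 \<le> exp (\<bar>z\<bar> + 1)" using exp_ge_add_one_self[of "\<bar>z\<bar> + 1"] by linarith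
  have e2: "(\<bar>z\<bar> + 1)\<^sup>2 \<le> exp (2 * (\<bar>z\<bar> + 1))"
    unfolding exp_double by (rule power_mono[OF e1]) simp
  have "\<bar>exp ?x - 1 - t * z\<bar> \<le> \<bar>exp ?x - 1 - ?x\<bar> + t\<^sup>2 / 2"
    using zero_le_power2[of t] by linarith
  also have "\<dots> \<le> ?x\<^sup>2 * exp \<bar>?x\<bar> + t\<^sup>2 / 2" using exp_remainder_bound[of ?x] by simp
  also have "\<dots> \<le> (t\<^sup>2 * exp (2 * (\<bar>z\<bar> + 1))) * exp (\<bar>z\<bar> + 1) + t\<^sup>2 * exp (3 * (\<bar>z\<bar> + 1))"
  proof (intro add_mono mult_mono)
    show "?x\<^sup>2 \<le> t\<^sup>2 * exp (2 * (\<bar>z\<bar> + 1))"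
      by (rule order_trans[OF x2 mult_left_mono[OF e2]]) simp
    show "t\<^sup>2 / 2 \<le> t\<^sup>2 * exp (3 * (\<bar>z\<bar> + 1))"
    proof -
      have "1 / 2 \<le> exp (3 * (\<bar>z\<bar> + 1))" by (rule order_trans[of _ 1]) simp_all
      then show ?thesis using mult_left_mono[of "1/2" "exp (3 * (\<bar>z\<bar> + 1))" "t\<^sup>2"] by simp
    qed
  qed (use x1 in auto)
  also have "\<dots> = t\<^sup>2 * exp (3 * (\<bar>z\<bar> + 1)) * 2"
    by (simp add: mult_exp_exp algebra_simps)
  finally show ?thesis .
qed

lemma gauss_integrable_id_mult:
  fixes f :: "real \<Rightarrow> real"
  assumes [measurable]: "f \<in> borel_measurable borel" and "\<And>z. \<bar>f z\<bar> \<le> B"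
  shows "integrable std_normal_distribution (\<lambda>z. z * f (x + z))"
proof (rule Bochner_Integration.integrable_bound)
  show "integrable std_normal_distribution (\<lambda>z. B * \<bar>z\<bar>)" by simp
  show "AE z in std_normal_distribution. norm (z * f (x + z)) \<le> norm (B * \<bar>z\<bar>)"
  proof (rule AE_I2)
    fix z
    have "\<bar>z\<bar> * \<bar>f (x + z)\<bar> \<le> \<bar>z\<bar> * \<bar>B\<bar>"
      using assms(2)[of "x + z"] by (intro mult_left_mono) auto
    then show "norm (z * f (x + z)) \<le> norm (B * \<bar>z\<bar>)" by (simp add: abs_mult mult.commute)
  qed
qed auto

text \<open>The derivative of \<open>gconv f\<close> after integration by parts: the factor
  \<open>z\<close> comes from differentiating the exponential weight, so no derivative of
  \<open>f\<close> appears.\<close>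

definition gconv1 :: "(real \<Rightarrow> real) \<Rightarrow> real \<Rightarrow> real" where
  "gconv1 f x = (\<integral>z. z * f (x + z) \<partial>std_normal_distribution)"

lemma gconv1_measurable [measurable (raw)]:
  assumes [measurable]: "f \<in> borel_measurable borel"
  shows "gconv1 f \<in> borel_measurable borel"
  unfolding gconv1_def by measurable

lemma gconv1_bound:
  assumes [measurable]: "f \<in> borel_measurable borel" and B: "\<And>z. \<bar>f z\<bar> \<le> B"
  shows "\<bar>gconv1 f x\<bar> \<le> B"
proof -
  have B0: "0 \<le> B" using B[of 0] by simp
  have i: "integrable std_normal_distribution (\<lambda>z. \<bar>z * f (x + z)\<bar>)"
    by (rule integrable_abs) (rule gauss_integrable_id_mult[OF assms])
  have "\<bar>gconv1 f x\<bar> \<le> (\<integral>z. \<bar>z * f (x + z)\<bar> \<partial>std_normal_distribution)"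
    unfolding gconv1_def by (rule integral_abs_bound)
  also have "\<dots> \<le> (\<integral>z. B * \<bar>z\<bar> \<partial>std_normal_distribution)"
    by (rule integral_mono[OF i]) (use B in \<open>auto simp: abs_mult mult.commute[of B] intro!: mult_left_mono\<close>)
  also have "\<dots> \<le> B" using mult_left_mono[OF gauss_integral_abs_le B0] by simp
  finally show ?thesis .
qed

definition tilt_const :: real where
  "tilt_const = (\<integral>z. exp (3 * (\<bar>z\<bar> + 1)) * 2 \<partial>std_normal_distribution)"

lemma gconv_remainder:
  assumes [measurable]: "f \<in> borel_measurable borel" and B: "\<And>z. \<bar>f z\<bar> \<le> B"
    and t: "\<bar>t\<bar> \<le> 1"
  shows "\<bar>gconv f (x + t) - gconv f x - t * gconv1 f x\<bar> \<le> B * tilt_const * t\<^sup>2"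
proof -
  have i0: "integrable std_normal_distribution (\<lambda>z. f (x + z))"
    by (rule gauss_integrable_bounded[OF assms(1,2)])
  have i1: "integrable std_normal_distribution (\<lambda>z. z * f (x + z))"
    by (rule gauss_integrable_id_mult[OF assms(1,2)])
  have i2: "integrable std_normal_distribution (\<lambda>z. exp (t * z - t\<^sup>2 / 2) * f (x + z))"
    by (subst gauss_tilt_integrable_iff)
       (use gauss_integrable_bounded[OF assms(1,2), of "x + t"] in \<open>auto simp: ac_simps\<close>)
  have e: "integrable std_normal_distribution (\<lambda>z. exp (3 * (\<bar>z\<bar> + 1)) * 2)"
    using integrable_mult_left[OF gauss_integrable_exp_abs[of 3], of "exp 3 * 2"]
    by (simp add: exp_add algebra_simps)
  have eq: "(exp (t * z - t\<^sup>2 / 2) - 1 - t * z) * f (x + z)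
      = exp (t * z - t\<^sup>2 / 2) * f (x + z) - f (x + z) - t * (z * f (x + z))" for z
    by (simp add: left_diff_distrib)
  have i3: "integrable std_normal_distribution (\<lambda>z. (exp (t * z - t\<^sup>2 / 2) - 1 - t * z) * f (x + z))"
    unfolding eq by (intro Bochner_Integration.integrable_diff integrable_mult_right i0 i1 i2)
  have "gconv f (x + t) - gconv f x - t * gconv1 f x
     = (\<integral>z. (exp (t * z - t\<^sup>2 / 2) - 1 - t * z) * f (x + z) \<partial>std_normal_distribution)"
    unfolding gconv_tilt[OF assms(1)] eq unfolding gconv_def gconv1_def
    by (simp only: Bochner_Integration.integral_diff Bochner_Integration.integrable_diff
        integrable_mult_right i0 i1 i2 integral_mult_right_zero)
  then have "\<bar>gconv f (x + t) - gconv f x - t * gconv1 f x\<bar>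
      \<le> (\<integral>z. \<bar>(exp (t * z - t\<^sup>2 / 2) - 1 - t * z) * f (x + z)\<bar> \<partial>std_normal_distribution)"
    using integral_abs_bound by simp
  also have "\<dots> \<le> (\<integral>z. (B * t\<^sup>2) * (exp (3 * (\<bar>z\<bar> + 1)) * 2) \<partial>std_normal_distribution)"
  proof (rule integral_mono)
    show "integrable std_normal_distribution (\<lambda>z. \<bar>(exp (t * z - t\<^sup>2 / 2) - 1 - t * z) * f (x + z)\<bar>)"
      by (rule integrable_abs[OF i3])
    fix z
    have "\<bar>exp (t * z - t\<^sup>2 / 2) - 1 - t * z\<bar> * \<bar>f (x + z)\<bar>
        \<le> (t\<^sup>2 * exp (3 * (\<bar>z\<bar> + 1)) * 2) * B"
      using tilt_remainder_bound[OF t, of z] B by (intro mult_mono) auto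
    then show "\<bar>(exp (t * z - t\<^sup>2 / 2) - 1 - t * z) * f (x + z)\<bar>
        \<le> (B * t\<^sup>2) * (exp (3 * (\<bar>z\<bar> + 1)) * 2)"
      by (simp add: abs_mult ac_simps)
  qed (use e in simp)
  also have "\<dots> = B * tilt_const * t\<^sup>2" by (simp add: tilt_const_def)
  finally show ?thesis .
qed

text \<open>Two second-order expansions of \<open>gconv f\<close> at \<open>x\<close> must have the same linear term.\<close>
lemma gconv_stein:
  assumes [measurable]: "f \<in> borel_measurable borel" "g \<in> borel_measurable borel"
    and B: "\<And>z. \<bar>f z\<bar> \<le> B" "\<And>z. \<bar>g z\<bar> \<le> B"
    and rem: "\<And>z t. \<bar>t\<bar> \<le> 1 \<Longrightarrow> \<bar>f (z + t) - f z - t * g z\<bar> \<le> D * t\<^sup>2"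
  shows "gconv g x = gconv1 f x"
proof (rule ccontr)
  assume ne: "gconv g x \<noteq> gconv1 f x"
  let ?d = "gconv g x - gconv1 f x" and ?C = "\<bar>D\<bar> + \<bar>B * tilt_const\<bar> + 1"
  have *: "\<bar>t\<bar> * \<bar>?d\<bar> \<le> (D + B * tilt_const) * t\<^sup>2" if t: "\<bar>t\<bar> \<le> 1" for t
  proof -
    have i: "integrable std_normal_distribution (\<lambda>z. f (x + t + z))"
      "integrable std_normal_distribution (\<lambda>z. f (x + z))"
      "integrable std_normal_distribution (\<lambda>z. g (x + z))"
      by (rule gauss_integrable_bounded; use B in auto)+
    have "gconv f (x + t) - gconv f x - t * gconv g x
      = (\<integral>z. f (x + t + z) - f (x + z) - t * g (x + z) \<partial>std_normal_distribution)"
      unfolding gconv_def using i by simp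
    then have "\<bar>gconv f (x + t) - gconv f x - t * gconv g x\<bar>
        \<le> (\<integral>z. \<bar>f (x + t + z) - f (x + z) - t * g (x + z)\<bar> \<partial>std_normal_distribution)"
      using integral_abs_bound by simp
    also have "\<dots> \<le> (\<integral>z. D * t\<^sup>2 \<partial>std_normal_distribution)"
    proof (rule integral_mono)
      fix z
      have "x + t + z = x + z + t" by simp
      then show "\<bar>f (x + t + z) - f (x + z) - t * g (x + z)\<bar> \<le> D * t\<^sup>2"
        using rem[OF t, of "x + z"] by (simp only:)
    qed (use i in auto)
    finally have "\<bar>gconv f (x + t) - gconv f x - t * gconv g x\<bar> \<le> D * t\<^sup>2"
      using gauss.prob_space by simp
    moreover have "\<bar>gconv f (x + t) - gconv f x - t * gconv1 f x\<bar> \<le> B * tilt_const * t\<^sup>2"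
      by (rule gconv_remainder) (use B t in auto)
    ultimately have "\<bar>t * gconv g x - t * gconv1 f x\<bar> \<le> D * t\<^sup>2 + B * tilt_const * t\<^sup>2"
      by linarith
    moreover have "\<bar>t\<bar> * \<bar>?d\<bar> = \<bar>t * gconv g x - t * gconv1 f x\<bar>"
      by (simp only: abs_mult[symmetric] right_diff_distrib)
    ultimately show ?thesis by (simp only: distrib_right)
  qed
  \<comment> \<open>This \<open>t\<close> makes the quadratic bound at most half of the linear term;
    the cap at 1 keeps both expansions valid.\<close>
  define t where "t = min 1 (\<bar>?d\<bar> / (2 * ?C))"
  have C: "0 < ?C" by linarith
  have t: "0 < t" "t \<le> 1" using ne C by (auto simp: t_def)
  have "t * \<bar>?d\<bar> \<le> (D + B * tilt_const) * t\<^sup>2" using *[of t] t by simp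
  also have "\<dots> \<le> ?C * t\<^sup>2" by (rule mult_right_mono) auto
  finally have "\<bar>?d\<bar> \<le> ?C * t" using t by (simp add: power2_eq_square)
  also have "\<dots> \<le> ?C * (\<bar>?d\<bar> / (2 * ?C))" by (rule mult_left_mono) (auto simp: t_def)
  also have "\<dots> = \<bar>?d\<bar> / 2"
  proof -
    have "c * (d / (2 * c)) = d / 2" if "0 < c" for c d :: real using that by simp
    from this[OF C] show ?thesis .
  qed
  finally show False using ne by simp
qed

section \<open>Nonnegativity on the leaves\<close>

lemma gauss_AE_lborel:
  assumes "AE z in std_normal_distribution. P z" "Measurable.pred borel P"
  shows "AE z in lborel. P z"
  using assms by (subst (asm) AE_density) (auto simp: normal_density_pos)

lemma gconv_pos:
  fixes f :: "real \<Rightarrow> real"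
  assumes [measurable]: "f \<in> borel_measurable borel"
    and f: "\<And>z. 0 \<le> f z" "\<And>z. f z \<le> B" and ab: "a < b" "\<And>z. a < z \<Longrightarrow> z < b \<Longrightarrow> 0 < f z"
  shows "0 < gconv f x"
proof (rule ccontr)
  assume "\<not> 0 < gconv f x"
  then have 0: "gconv f x = 0" using gconv_nonneg[of f x] f by force
  have "\<bar>f z\<bar> \<le> B" for z using f[of z] by simp
  then have "integrable std_normal_distribution (\<lambda>z. f (x + z))"
    by (intro gauss_integrable_bounded[where B=B]) auto
  then have "AE z in std_normal_distribution. f (x + z) = 0"
    using 0 f unfolding gconv_def by (subst (asm) integral_nonneg_eq_0_iff_AE) auto
  then have "AE z in lborel. f (x + z) = 0"
    by (rule gauss_AE_lborel) measurable
  then have "AE z in lborel. z \<notin> {a - x<..<b - x}"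
  proof eventually_elim
    case (elim z)
    then show ?case using ab(2)[of "x + z"] by force
  qed
  then have "emeasure lborel {a - x<..<b - x} = 0"
    by (subst (asm) AE_iff_measurable[of "{a - x<..<b - x}"]) auto
  then show False using ab by simp
qed

text \<open>Integrate the tangent line of \<open>exp\<close> at the weighted mean of
  \<open>X\<close>. The weight stays unnormalized because in its use below it is the survival
  probability of a subtree.\<close>

lemma gauss_weighted_jensen:
  fixes w X :: "real \<Rightarrow> real"
  assumes w: "\<And>z. 0 \<le> w z" "integrable M w" and X: "integrable M (\<lambda>z. w z * X z)"
    and e: "integrable M (\<lambda>z. w z * exp (X z))" and W: "0 < (\<integral>z. w z \<partial>M)"
  shows "(\<integral>z. w z \<partial>M) * exp ((\<integral>z. w z * X z \<partial>M) / (\<integral>z. w z \<partial>M)) \<le> (\<integral>z. w z * exp (X z) \<partial>M)"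
proof -
  let ?W = "\<integral>z. w z \<partial>M"
  let ?c = "(\<integral>z. w z * X z \<partial>M) / ?W"
  have "(\<integral>z. exp ?c * ((1 - ?c) * w z + w z * X z) \<partial>M)
      = exp ?c * ((1 - ?c) * ?W + (\<integral>z. w z * X z \<partial>M))"
    using w X by simp
  also have "\<dots> = ?W * exp ?c" using W by (simp add: algebra_simps)
  finally have "?W * exp ?c = (\<integral>z. exp ?c * ((1 - ?c) * w z + w z * X z) \<partial>M)" ..
  also have "\<dots> \<le> (\<integral>z. w z * exp (X z) \<partial>M)"
  proof (rule integral_mono)
    show "integrable M (\<lambda>z. exp ?c * ((1 - ?c) * w z + w z * X z))" using w X by simp
    fix z
    have "exp ?c * (1 + (X z - ?c)) \<le> exp ?c * exp (X z - ?c)"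
      by (intro mult_left_mono exp_ge_add_one_self) simp
    also have "\<dots> = exp (X z)" by (simp add: exp_diff)
    finally have "w z * (exp ?c * (1 + (X z - ?c))) \<le> w z * exp (X z)"
      by (intro mult_left_mono w)
    then show "exp ?c * ((1 - ?c) * w z + w z * X z) \<le> w z * exp (X z)"
      by (simp add: algebra_simps)
  qed (rule e)
  finally show ?thesis .
qed

text \<open>\<open>wall n u\<close> is the probability that the field started at height \<open>u\<close> is nonnegative on the
  leaves of depth \<open>n\<close>; \<open>wall' n\<close> is its derivative in \<open>u\<close> (junk for \<open>n = 0\<close>).\<close>

fun wall :: "nat \<Rightarrow> real \<Rightarrow> real" where
  "wall 0 u = of_bool (0 \<le> u)"
| "wall (Suc n) u = (gconv (wall n) u)\<^sup>2"

fun wall' :: "nat \<Rightarrow> real \<Rightarrow> real" where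
  "wall' 0 u = 0"
| "wall' (Suc n) u = 2 * gconv (wall n) u * gconv1 (wall n) u"

lemma wall_measurable [measurable]: "wall n \<in> borel_measurable borel"
proof (induction n)
  case 0
  have "wall 0 = (\<lambda>u. of_bool (0 \<le> u))" by auto
  then show ?case by simp
next
  case (Suc n)
  note [measurable] = Suc.IH
  have "wall (Suc n) = (\<lambda>u. (gconv (wall n) u)\<^sup>2)" by auto
  then show ?case by simp
qed

lemma wall'_measurable [measurable]: "wall' n \<in> borel_measurable borel"
proof (cases n)
  case 0
  then have "wall' n = (\<lambda>u. 0)" by auto
  then show ?thesis by simp
next
  case (Suc m)
  then have "wall' n = (\<lambda>u. 2 * gconv (wall m) u * gconv1 (wall m) u)" by auto
  then show ?thesis by simp
qed

lemma wall_nonneg [simp]: "0 \<le> wall n u"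
  by (cases n) auto

lemma wall_le_1 [simp]: "wall n u \<le> 1"
proof (induction n arbitrary: u)
  case (Suc n)
  have "gconv (wall n) u \<le> 1" "0 \<le> gconv (wall n) u"
    using Suc by (auto intro!: gconv_le gconv_nonneg)
  then show ?case by (simp add: power_le_one)
qed auto

lemma gconv_wall_nonneg [simp]: "0 \<le> gconv (wall n) u"
  by (auto intro: gconv_nonneg)

lemma gconv_wall_le_1 [simp]: "gconv (wall n) u \<le> 1"
  by (auto intro: gconv_le)

lemma wall_integrable [simp]: "integrable std_normal_distribution (\<lambda>z. wall n (u + z))"
  by (rule gauss_integrable_bounded[where B=1]) auto

lemma wall_integrable_id_mult [simp]: "integrable std_normal_distribution (\<lambda>z. z * wall n (u + z))"
  by (rule gauss_integrable_id_mult[where B=1]) auto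

lemma gconv1_wall_bound: "\<bar>gconv1 (wall n) u\<bar> \<le> 1"
  by (rule gconv1_bound) auto

lemma wall'_bound: "\<bar>wall' n u\<bar> \<le> 2"
proof (cases n)
  case (Suc m)
  then show ?thesis
    using mult_mono[of "gconv (wall m) u" 1 "\<bar>gconv1 (wall m) u\<bar>" 1] gconv1_wall_bound[of m u]
    by (simp add: abs_mult)
qed auto

lemma wall'_integrable [simp]: "integrable std_normal_distribution (\<lambda>z. wall' n (u + z))"
  by (rule gauss_integrable_bounded[where B=2]) (auto intro: wall'_bound)

lemma wall_mono: "u \<le> v \<Longrightarrow> wall n u \<le> wall n v"
proof (induction n arbitrary: u v)
  case (Suc n)
  have "gconv (wall n) u \<le> gconv (wall n) v"
    unfolding gconv_def by (intro integral_mono) (auto intro!: Suc)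
  then show ?case by (auto intro!: power_mono)
qed auto

text \<open>Stated for the convolution because \<open>wall 0\<close> vanishes on the negative
  half-line; a Gaussian step makes it positive everywhere, and squaring keeps it so.\<close>

lemma gconv_wall_pos: "0 < gconv (wall n) u"
proof (induction n arbitrary: u)
  case 0
  show ?case by (rule gconv_pos[where a=0 and b=1 and B=1]) auto
next
  case (Suc n)
  then have "0 < wall (Suc n) z" for z
    using zero_less_power[OF Suc[of z], of 2] by simp
  then show ?case by (intro gconv_pos[where a=0 and b=1 and B=1]) (auto simp del: wall.simps)
qed

lemma wall_pos: "n \<noteq> 0 \<Longrightarrow> 0 < wall n u"
  by (cases n) (auto simp: gconv_wall_pos[THEN less_imp_neq, THEN not_sym])

lemma gconv_one_minus_wall: "gconv (\<lambda>z. 1 - wall n z) u = 1 - gconv (wall n) u"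
  unfolding gconv_def using gauss.prob_space by simp

lemma gconv_wall_less_1: "gconv (wall n) u < 1"
proof (induction n arbitrary: u)
  case 0
  have "0 < gconv (\<lambda>z. 1 - wall 0 z) u"
    by (rule gconv_pos[where a="-1" and b=0 and B=1]) auto
  then show ?case unfolding gconv_one_minus_wall by (simp only: diff_gt_0_iff_gt)
next
  case (Suc n)
  have "wall (Suc n) v < 1" for v
    using Suc.IH[of v] by (simp add: power_less_one_iff)
  then have "0 < gconv (\<lambda>z. 1 - wall (Suc n) z) u"
    by (intro gconv_pos[where a="-1" and b=0 and B=1]) (auto simp del: wall.simps)
  then show ?case unfolding gconv_one_minus_wall by (simp only: diff_gt_0_iff_gt)
qed

lemma wall_less_1: "n \<noteq> 0 \<Longrightarrow> wall n u < 1"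
  by (cases n) (auto simp: gconv_wall_less_1 power_less_one_iff)

text \<open>The remainder of a square needs a Lipschitz bound for \<open>gconv (wall n)\<close>,
  which is read off from the same expansion. The result identifies \<open>wall'\<close> as the
  derivative and is the input of \<open>gconv_stein\<close>.\<close>

lemma wall_Suc_remainder:
  "\<exists>D. \<forall>z t. \<bar>t\<bar> \<le> 1 \<longrightarrow> \<bar>wall (Suc n) (z + t) - wall (Suc n) z - t * wall' (Suc n) z\<bar> \<le> D * t\<^sup>2"
proof (intro exI allI impI)
  fix z t :: real assume t: "\<bar>t\<bar> \<le> 1"
  let ?q = "gconv (wall n)" and ?q1 = "gconv1 (wall n)"
  let ?r = "?q (z + t) - ?q z - t * ?q1 z" and ?C = "\<bar>tilt_const\<bar>"
  have "\<bar>?r\<bar> \<le> 1 * tilt_const * t\<^sup>2"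
    by (rule gconv_remainder) (use t in auto)
  also have "\<dots> \<le> ?C * t\<^sup>2" by (auto intro: mult_right_mono)
  finally have r: "\<bar>?r\<bar> \<le> ?C * t\<^sup>2" .
  have "t\<^sup>2 \<le> \<bar>t\<bar>" using mult_left_mono[OF t, of "\<bar>t\<bar>"] by (simp add: power2_eq_square)
  then have "\<bar>?r\<bar> \<le> ?C * \<bar>t\<bar>" using r by (meson abs_ge_zero mult_left_mono order_trans)
  moreover have "\<bar>t * ?q1 z\<bar> \<le> \<bar>t\<bar> * 1"
    unfolding abs_mult by (rule mult_left_mono) (auto intro: gconv1_wall_bound)
  moreover have "?q (z + t) - ?q z = ?r + t * ?q1 z" by simp
  ultimately have "\<bar>?q (z + t) - ?q z\<bar> \<le> (1 + ?C) * \<bar>t\<bar>"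
    using abs_triangle_ineq[of ?r "t * ?q1 z"] by (simp add: algebra_simps)
  then have "(?q (z + t) - ?q z)\<^sup>2 \<le> ((1 + ?C) * \<bar>t\<bar>)\<^sup>2"
    using power_mono[OF _ abs_ge_zero, of "?q (z + t) - ?q z" _ 2] by (simp only: power2_abs)
  then have 1: "(?q (z + t) - ?q z)\<^sup>2 \<le> (1 + ?C)\<^sup>2 * t\<^sup>2" by (simp add: power_mult_distrib)
  have "\<bar>?q z * ?r\<bar> \<le> 1 * (?C * t\<^sup>2)"
    unfolding abs_mult by (rule mult_mono) (use r in auto)
  then have 2: "\<bar>2 * (?q z * ?r)\<bar> \<le> 2 * ?C * t\<^sup>2" by simp
  have "wall (Suc n) (z + t) - wall (Suc n) z - t * wall' (Suc n) z
      = (?q (z + t) - ?q z)\<^sup>2 + 2 * (?q z * ?r)"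
    by (simp add: power2_eq_square algebra_simps)
  then have "\<bar>wall (Suc n) (z + t) - wall (Suc n) z - t * wall' (Suc n) z\<bar>
      \<le> (?q (z + t) - ?q z)\<^sup>2 + \<bar>2 * (?q z * ?r)\<bar>"
    using abs_triangle_ineq[of "(?q (z + t) - ?q z)\<^sup>2" "2 * (?q z * ?r)"] by simp
  then show "\<bar>wall (Suc n) (z + t) - wall (Suc n) z - t * wall' (Suc n) z\<bar>
      \<le> ((1 + ?C)\<^sup>2 + 2 * ?C) * t\<^sup>2"
    using 1 2 by (simp only: distrib_right)
qed

text \<open>Gaussian integration by parts. At \<open>n = 0\<close> it fails, since
  \<open>wall'\<close> is 0 there while the jump of \<open>wall 0\<close> contributes to the
  right-hand side; later uses at \<open>n = 0\<close> carry a vanishing coefficient.\<close>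

lemma gconv_wall':
  assumes "n \<noteq> 0"
  shows "gconv (wall' n) u = gconv1 (wall n) u"
proof -
  obtain m where n: "n = Suc m" using assms by (cases n) auto
  obtain D where "\<And>z t. \<bar>t\<bar> \<le> 1 \<Longrightarrow> \<bar>wall n (z + t) - wall n z - t * wall' n z\<bar> \<le> D * t\<^sup>2"
    using wall_Suc_remainder[of m] unfolding n by blast
  then show ?thesis
    by (intro gconv_stein[where B=2 and D=D]) (auto intro: wall'_bound order_trans[OF wall_le_1])
qed

text \<open>The modulus is optimal: \<open>1 - 2^(-n)\<close> is the variance of the mean of the field over the leaves of
  depth \<open>n\<close>. In the induction the shift \<open>s\<close> is split between the first edge and the subtree.\<close>
lemma wall_semiconcave:
  assumes "n \<noteq> 0"
  shows "wall n u * exp (wall' n u / wall n u * s - s\<^sup>2 / (2 * (1 - (1/2) ^ n))) \<le> wall n (u + s)"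
proof -
  \<comment> \<open>Generation 0 admits only the shift 0, as its variance is 0; starting there
    treats the first generation like all others.\<close>
  have "(n = 0 \<longrightarrow> s = 0) \<Longrightarrow>
    wall n u * exp (wall' n u / wall n u * s - s\<^sup>2 / (2 * (1 - (1/2) ^ n))) \<le> wall n (u + s)" for u s
  proof (induction n arbitrary: u s)
    case (Suc n)
    define \<sigma> :: real where "\<sigma> = 1 - (1/2) ^ n"
    have \<sigma>: "0 \<le> \<sigma>" by (simp add: \<sigma>_def power_le_one)
    \<comment> \<open>The edge has variance 1 and the subtree has variance \<sigma>, so the cheapest
      split of \<open>s\<close> is proportional to the variances, with total cost
      \<open>s\<^sup>2 / (2 * (1 + \<sigma>))\<close>. For \<sigma> = 0 the whole shift goes to the
      edge.\<close>
    define \<theta> where "\<theta> = \<sigma> / (1 + \<sigma>)"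
    define r where "r = \<theta> * s"
    define \<tau> where "\<tau> = (1 - \<theta>) * s"
    define K where "K = \<tau>\<^sup>2 / 2 + r\<^sup>2 / (2 * \<sigma>)"
    have rn: "n = 0 \<longrightarrow> r = 0" by (simp add: r_def \<theta>_def \<sigma>_def)
    have \<tau>r: "\<tau> + r = s" by (simp add: \<tau>_def r_def algebra_simps)
    have K: "K = s\<^sup>2 / (2 * (1 + \<sigma>))"
    proof (cases "\<sigma> = 0")
      case True
      then show ?thesis by (simp add: K_def \<tau>_def r_def \<theta>_def)
    next
      case False
      then have "0 < \<sigma>" using \<sigma> by simp
      then have "1 - \<theta> = 1 / (1 + \<sigma>)" by (simp add: \<theta>_def field_simps)
      then have 1: "\<tau>\<^sup>2 = s\<^sup>2 / (1 + \<sigma>)\<^sup>2" by (simp add: \<tau>_def power_mult_distrib power_divide)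
      have "r\<^sup>2 = \<sigma> * (s\<^sup>2 * \<sigma> / (1 + \<sigma>)\<^sup>2)"
        by (simp add: r_def \<theta>_def power_mult_distrib power_divide) (simp add: power2_eq_square)
      then have "r\<^sup>2 / (2 * \<sigma>) = s\<^sup>2 * \<sigma> / (1 + \<sigma>)\<^sup>2 / 2" using \<open>0 < \<sigma>\<close> by simp
      then have "K = (s\<^sup>2 / (1 + \<sigma>)\<^sup>2 + s\<^sup>2 * \<sigma> / (1 + \<sigma>)\<^sup>2) / 2"
        unfolding K_def 1 by (simp only: add_divide_distrib)
      also have "s\<^sup>2 / (1 + \<sigma>)\<^sup>2 + s\<^sup>2 * \<sigma> / (1 + \<sigma>)\<^sup>2 = s\<^sup>2 * (1 + \<sigma>) / (1 + \<sigma>)\<^sup>2"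
        by (simp add: add_divide_distrib distrib_left)
      also have "\<dots> = s\<^sup>2 / (1 + \<sigma>)" using \<open>0 < \<sigma>\<close> by (simp add: power2_eq_square)
      finally show ?thesis by (simp add: mult.commute)
    qed
    let ?q = "gconv (wall n)" and ?q1 = "gconv1 (wall n)"
    define w where "w z = wall n (u + z)" for z
    \<comment> \<open>The first term moves the edge by Cameron-Martin and the second is the
      induction hypothesis for the subtree. By integration by parts both have the same weighted mean
      per unit of shift, so the mean of \<open>X\<close> is \<open>s\<close> times the logarithmic
      derivative of \<open>gconv (wall n)\<close> minus \<open>K\<close>.\<close>
    define X where "X z = \<tau> * z + wall' n (u + z) / wall n (u + z) * r - K" for z
    have [measurable]: "w \<in> borel_measurable borel" "X \<in> borel_measurable borel"
      unfolding w_def X_def by measurable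
    have wd: "w z * (wall' n (u + z) / wall n (u + z)) = wall' n (u + z)" for z
    proof (cases "n = 0")
      case False
      then have "wall n (u + z) \<noteq> 0" using wall_pos[of n "u + z"] by linarith
      then show ?thesis unfolding w_def by simp
    qed simp
    have wX: "w z * X z = \<tau> * (z * wall n (u + z)) + r * wall' n (u + z) - K * wall n (u + z)" for z
    proof -
      have "w z * X z = \<tau> * (z * w z) + r * (w z * (wall' n (u + z) / wall n (u + z))) - K * w z"
        unfolding X_def by (simp add: algebra_simps)
      then show ?thesis unfolding wd unfolding w_def .
    qed
    have iX: "integrable std_normal_distribution (\<lambda>z. w z * X z)"
      unfolding wX by (intro Bochner_Integration.integrable_diff Bochner_Integration.integrable_add
          integrable_mult_right) auto
    have W: "(\<integral>z. w z \<partial>std_normal_distribution) = ?q u" by (simp add: gconv_def w_def)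
    have "(\<integral>z. w z * X z \<partial>std_normal_distribution) = \<tau> * ?q1 u + r * gconv (wall' n) u - K * ?q u"
      unfolding wX gconv_def gconv1_def by simp
    also have "r * gconv (wall' n) u = r * ?q1 u"
      using rn gconv_wall'[of n u] by (cases "n = 0") auto
    finally have WX: "(\<integral>z. w z * X z \<partial>std_normal_distribution) / ?q u = s * (?q1 u / ?q u) - K"
      using gconv_wall_pos[of n u] by (simp add: \<tau>r[symmetric] field_simps)
    have le: "w z * exp (X z) \<le> exp (\<tau> * z - \<tau>\<^sup>2 / 2) * wall n (u + r + z)" for z
    proof -
      have "X z = (\<tau> * z - \<tau>\<^sup>2 / 2) + (wall' n (u + z) / wall n (u + z) * r - r\<^sup>2 / (2 * \<sigma>))"
        by (simp add: X_def K_def)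
      then have "w z * exp (X z) = exp (\<tau> * z - \<tau>\<^sup>2 / 2) *
          (wall n (u + z) * exp (wall' n (u + z) / wall n (u + z) * r - r\<^sup>2 / (2 * \<sigma>)))"
        by (simp add: w_def exp_add)
      also have "\<dots> \<le> exp (\<tau> * z - \<tau>\<^sup>2 / 2) * wall n (u + z + r)"
        unfolding \<sigma>_def by (intro mult_left_mono Suc.IH rn) simp
      finally show ?thesis by (simp add: ac_simps)
    qed
    have iu: "integrable std_normal_distribution (\<lambda>z. exp (\<tau> * z - \<tau>\<^sup>2 / 2) * wall n (u + r + z))"
      by (subst gauss_tilt_integrable_iff) (use wall_integrable[of n "u + r + \<tau>"] in \<open>auto simp: ac_simps\<close>)
    have ie: "integrable std_normal_distribution (\<lambda>z. w z * exp (X z))"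
      by (rule Bochner_Integration.integrable_bound[OF iu])
         (use le in \<open>auto simp: abs_mult w_def\<close>)
    have "?q u * exp (s * (?q1 u / ?q u) - K) \<le> (\<integral>z. w z * exp (X z) \<partial>std_normal_distribution)"
    proof -
      have "integrable std_normal_distribution w" unfolding w_def by simp
      from gauss_weighted_jensen[of w std_normal_distribution X, OF _ this iX ie] show ?thesis
        using gconv_wall_pos[of n u] unfolding W WX by (simp add: w_def)
    qed
    also have "\<dots> \<le> (\<integral>z. exp (\<tau> * z - \<tau>\<^sup>2 / 2) * wall n (u + r + z) \<partial>std_normal_distribution)"
      by (intro integral_mono ie iu le)
    also have "\<dots> = ?q (u + r + \<tau>)" by (subst gconv_tilt) auto
    also have "u + r + \<tau> = u + s" using \<tau>r by simp
    finally have "?q u * exp (s * (?q1 u / ?q u) - K) \<le> ?q (u + s)" .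
    then have "(?q u * exp (s * (?q1 u / ?q u) - K))\<^sup>2 \<le> (?q (u + s))\<^sup>2"
      by (intro power_mono) auto
    then have "(?q u)\<^sup>2 * exp (2 * (s * (?q1 u / ?q u) - K)) \<le> wall (Suc n) (u + s)"
      by (simp only: power_mult_distrib exp_double wall.simps)
    moreover have "wall' (Suc n) u / wall (Suc n) u = 2 * (?q1 u / ?q u)"
      using gconv_wall_pos[of n u] by (simp add: power2_eq_square)
    \<comment> \<open>The two children double the exponent, which halves the variance
      \<open>1 + \<sigma>\<close> to \<open>1 - (1/2) ^ Suc n\<close>.\<close>
    moreover have "2 * K = s\<^sup>2 / (2 * (1 - (1/2) ^ Suc n))"
    proof -
      have e: "2 * (1 - (1/2) ^ Suc n) = 1 + \<sigma>" by (simp add: \<sigma>_def)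
      have "2 * (a / (2 * b)) = a / b" for a b :: real by simp
      then show ?thesis unfolding K e .
    qed
    ultimately show ?case by (simp add: algebra_simps)
  qed auto
  then show ?thesis using assms by blast
qed

section \<open>Heat flow\<close>

lemma real_normal_density_conv:
  assumes "0 < \<sigma>" "0 < \<tau>"
  shows "(\<integral>y. normal_density 0 \<sigma> (x - y) * normal_density 0 \<tau> y \<partial>lborel)
    = normal_density 0 (sqrt (\<sigma>\<^sup>2 + \<tau>\<^sup>2)) x"
proof -
  have "(\<integral>y. normal_density 0 \<sigma> (x - y) * normal_density 0 \<tau> y \<partial>lborel)
      = enn2real (\<integral>\<^sup>+y. ennreal (normal_density 0 \<sigma> (x - y) * normal_density 0 \<tau> y) \<partial>lborel)"
    by (rule integral_eq_nn_integral) (auto simp: normal_density_nonneg)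
  also have "\<dots> = enn2real (normal_density 0 (sqrt (\<sigma>\<^sup>2 + \<tau>\<^sup>2)) x)"
    using fun_cong[OF conv_normal_density_zero_mean[OF assms], of x] by simp
  finally show ?thesis by (simp add: normal_density_nonneg)
qed

abbreviation heat_kernel :: "real \<Rightarrow> real \<Rightarrow> real" where
  "heat_kernel t \<equiv> normal_density 0 (sqrt t)"

lemma heat_kernel_eq: "0 < t \<Longrightarrow> heat_kernel t v = 1 / sqrt (2 * pi * t) * exp (- v\<^sup>2 / (2 * t))"
  by (simp add: normal_density_def)

lemma heat_kernel_uminus: "heat_kernel t (- v) = heat_kernel t v"
  by (simp add: normal_density_def)

lemma heat_kernel_le: "0 < t \<Longrightarrow> heat_kernel t v \<le> 1 / sqrt (2 * pi * t)"
  by (simp add: heat_kernel_eq divide_right_mono)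

definition heat :: "real \<Rightarrow> (real \<Rightarrow> real) \<Rightarrow> real \<Rightarrow> real" where
  "heat t f x = (\<integral>y. heat_kernel t (y - x) * f y \<partial>lborel)"

lemma heat_measurable [measurable (raw)]:
  assumes [measurable]: "f \<in> borel_measurable borel"
  shows "heat t f \<in> borel_measurable borel"
  unfolding heat_def by measurable

lemma heat_kernel_integrable:
  assumes t: "0 < t" and [measurable]: "f \<in> borel_measurable borel" and f: "\<And>y. \<bar>f y\<bar> \<le> B"
  shows "integrable lborel (\<lambda>y. heat_kernel t (y - x) * f y)"
proof (rule Bochner_Integration.integrable_bound)
  have "integrable lborel (\<lambda>y. heat_kernel t (- x + 1 * y))"
    using t by (intro lborel_integrable_real_affine integrable_normal_density) auto
  then show "integrable lborel (\<lambda>y. B * heat_kernel t (y - x))" by simp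
  have "\<bar>heat_kernel t (y - x) * f y\<bar> \<le> \<bar>B * heat_kernel t (y - x)\<bar>" for y
    using mult_left_mono[OF f, of "heat_kernel t (y - x)" y] f[of y]
    by (simp add: abs_mult normal_density_nonneg mult.commute)
  then show "AE y in lborel. norm (heat_kernel t (y - x) * f y) \<le> norm (B * heat_kernel t (y - x))"
    by simp
qed simp

lemma heat_kernel_integral:
  assumes t: "0 < t" shows "(\<integral>y. heat_kernel t (y - x) \<partial>lborel) = 1"
  using lborel_integral_real_affine[of 1 "heat_kernel t" "- x"] integral_normal_density[of "sqrt t" 0] t
  by simp

lemma heat_bound:
  assumes t: "0 < t" and [measurable]: "f \<in> borel_measurable borel" and f: "\<And>y. \<bar>f y\<bar> \<le> B"
  shows "\<bar>heat t f x\<bar> \<le> B"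
proof -
  have "\<bar>heat t f x\<bar> \<le> (\<integral>y. \<bar>heat_kernel t (y - x) * f y\<bar> \<partial>lborel)"
    unfolding heat_def by (rule integral_abs_bound)
  also have "\<dots> \<le> (\<integral>y. heat_kernel t (y - x) * B \<partial>lborel)"
  proof (rule integral_mono)
    show "integrable lborel (\<lambda>y. \<bar>heat_kernel t (y - x) * f y\<bar>)"
      by (rule integrable_abs[OF heat_kernel_integrable[OF t assms(2) f]])
    show "integrable lborel (\<lambda>y. heat_kernel t (y - x) * B)"
      by (rule heat_kernel_integrable[OF t, where B="\<bar>B\<bar>"]) auto
    fix y
    show "\<bar>heat_kernel t (y - x) * f y\<bar> \<le> heat_kernel t (y - x) * B"
      unfolding abs_mult by (simp add: normal_density_nonneg mult_left_mono f)
  qed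
  also have "\<dots> = B" using heat_kernel_integral[OF t] by simp
  finally show ?thesis .
qed

lemma gconv_lborel:
  assumes [measurable]: "f \<in> borel_measurable borel"
  shows "gconv f x = (\<integral>y. std_normal_density (y - x) * f y \<partial>lborel)"
proof -
  have "gconv f x = (\<integral>z. std_normal_density z * f (x + z) \<partial>lborel)"
    unfolding gconv_def by (subst integral_density) (auto simp: normal_density_nonneg)
  also have "\<dots> = (\<integral>y. std_normal_density (y - x) * f y \<partial>lborel)"
    using lborel_integral_real_affine[of 1 "\<lambda>y. std_normal_density (y - x) * f y" x] by simp
  finally show ?thesis .
qed

lemma heat_1: "f \<in> borel_measurable borel \<Longrightarrow> heat 1 f = gconv f"
  by (auto simp: heat_def gconv_lborel fun_eq_iff)

lemma gconv_heat:
  assumes t: "0 < t" and [measurable]: "f \<in> borel_measurable borel" and f: "\<And>y. \<bar>f y\<bar> \<le> B"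
  shows "gconv (heat t f) x = heat (t + 1) f x"
proof -
  let ?g = "\<lambda>(w, y). std_normal_density (w - x) * (heat_kernel t (y - w) * f y)"
  have i: "integrable (lborel \<Otimes>\<^sub>M lborel) ?g"
  proof (rule lborel_pair.Fubini_integrable)
    show "AE w in lborel. integrable lborel (\<lambda>y. ?g (w, y))"
      using heat_kernel_integrable[OF t assms(2) f] by simp
    show "integrable lborel (\<lambda>w. \<integral>y. norm (?g (w, y)) \<partial>lborel)"
    proof (rule Bochner_Integration.integrable_bound)
      show "integrable lborel (\<lambda>w. heat_kernel 1 (w - x) * B)"
        by (rule heat_kernel_integrable[where B="\<bar>B\<bar>"]) auto
      have e: "(\<integral>y. norm (?g (w, y)) \<partial>lborel) = std_normal_density (w - x) * heat t (\<lambda>y. \<bar>f y\<bar>) w" for w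
        by (simp add: heat_def abs_mult normal_density_nonneg)
      have "\<bar>heat t (\<lambda>y. \<bar>f y\<bar>) w\<bar> \<le> \<bar>B\<bar>" for w
        using heat_bound[OF t, of "\<lambda>y. \<bar>f y\<bar>" B w] f by simp
      then show "AE w in lborel. norm (\<integral>y. norm (?g (w, y)) \<partial>lborel) \<le> norm (heat_kernel 1 (w - x) * B)"
        unfolding e by (auto simp: abs_mult normal_density_nonneg intro!: mult_left_mono)
    qed measurable
  qed measurable
  have "gconv (heat t f) x = (\<integral>w. (\<integral>y. ?g (w, y) \<partial>lborel) \<partial>lborel)"
    by (subst gconv_lborel) (auto simp: heat_def)
  also have "\<dots> = (\<integral>y. (\<integral>w. ?g (w, y) \<partial>lborel) \<partial>lborel)"
    using lborel_pair.Fubini_integral[of "\<lambda>w y. ?g (w, y)"] i by simp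
  also have "\<dots> = (\<integral>y. heat_kernel (t + 1) (y - x) * f y \<partial>lborel)"
  proof (rule Bochner_Integration.integral_cong[OF refl])
    fix y
    have "(\<integral>w. ?g (w, y) \<partial>lborel) = (\<integral>w. std_normal_density (w - x) * heat_kernel t (y - w) \<partial>lborel) * f y"
      by (simp add: mult.assoc[symmetric])
    also have "(\<integral>w. std_normal_density (w - x) * heat_kernel t (y - w) \<partial>lborel)
        = (\<integral>w. heat_kernel t ((y - x) - w) * normal_density 0 1 w \<partial>lborel)"
      using lborel_integral_real_affine[of 1 "\<lambda>w. std_normal_density (w - x) * heat_kernel t (y - w)" x]
      by (simp add: algebra_simps)
    also have "\<dots> = heat_kernel (t + 1) (y - x)"
      using t by (subst real_normal_density_conv) auto
    finally show "(\<integral>w. ?g (w, y) \<partial>lborel) = heat_kernel (t + 1) (y - x) * f y" .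
  qed
  finally show ?thesis by (simp add: heat_def)
qed

section \<open>Heat flow of odd functions by reflection\<close>

lemma heat_odd_eq:
  assumes t: "0 < t" and [measurable]: "f \<in> borel_measurable borel" and f: "\<And>y. \<bar>f y\<bar> \<le> B"
    and odd: "\<And>y. f (- y) = - f y"
  shows "heat t f x = (\<integral>y. (heat_kernel t (y - x) - heat_kernel t (y + x)) * f y * indicator {0<..} y \<partial>lborel)"
proof -
  let ?h = "\<lambda>y. heat_kernel t (y - x) * f y"
  have i: "integrable lborel ?h" by (rule heat_kernel_integrable[OF t assms(2) f])
  have i1: "integrable lborel (\<lambda>y. ?h y * indicator {0<..} y)"
    and i2: "integrable lborel (\<lambda>y. ?h y * indicator {..<0} y)"
    using integrable_real_mult_indicator[OF _ i, of "{0<..}"]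
      integrable_real_mult_indicator[OF _ i, of "{..<0}"] by simp_all
  have "heat t f x = (\<integral>y. ?h y * indicator {0<..} y + ?h y * indicator {..<0} y \<partial>lborel)"
    unfolding heat_def
  proof (rule integral_cong_AE)
    have "f 0 = 0" using odd[of 0] by simp
    then have "?h y = ?h y * indicator {0<..} y + ?h y * indicator {..<0} y" for y
      by (cases "y = 0") (auto split: split_indicator)
    then show "AE y in lborel. ?h y = ?h y * indicator {0<..} y + ?h y * indicator {..<0} y" by simp
  qed measurable
  also have "\<dots> = (\<integral>y. ?h y * indicator {0<..} y \<partial>lborel) + (\<integral>y. ?h y * indicator {..<0} y \<partial>lborel)"
    using i1 i2 by simp
  also have "(\<integral>y. ?h y * indicator {..<0} y \<partial>lborel)
      = (\<integral>y. - (heat_kernel t (y + x) * f y * indicator {0<..} y) \<partial>lborel)"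
  proof -
    have "- y - x = - (y + x)" for y by simp
    then have "heat_kernel t (- y - x) = heat_kernel t (y + x)" for y
      by (simp only: heat_kernel_uminus)
    moreover have "indicator {..<0} (- y) = (indicator {0<..} y :: real)" for y :: real
      by (auto split: split_indicator)
    ultimately show ?thesis
      using lborel_integral_real_affine[of "-1" "\<lambda>y. ?h y * indicator {..<0} y" 0]
      by (simp add: odd)
  qed
  also have "(\<integral>y. ?h y * indicator {0<..} y \<partial>lborel) + \<dots>
      = (\<integral>y. ?h y * indicator {0<..} y + - (heat_kernel t (y + x) * f y * indicator {0<..} y) \<partial>lborel)"
  proof (rule Bochner_Integration.integral_add[symmetric])
    show "integrable lborel (\<lambda>y. ?h y * indicator {0<..} y)" by (rule i1)
    have "integrable lborel (\<lambda>y. heat_kernel t (y - (- x)) * f y)"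
      by (rule heat_kernel_integrable[OF t assms(2) f])
    then have "integrable lborel (\<lambda>y. heat_kernel t (y + x) * f y)" by simp
    from integrable_real_mult_indicator[OF _ this, of "{0<..}"]
    show "integrable lborel (\<lambda>y. - (heat_kernel t (y + x) * f y * indicator {0<..} y))" by simp
  qed
  finally show ?thesis by (simp add: algebra_simps)
qed

lemma heat_odd_uminus:
  assumes odd: "\<And>y. f (- y) = - f y"
  shows "heat t f (- x) = - heat t f x"
proof -
  have "heat t f (- x) = (\<integral>y. heat_kernel t (- y + x) * f (- y) \<partial>lborel)"
    unfolding heat_def using lborel_integral_real_affine[of "-1" "\<lambda>y. heat_kernel t (y + x) * f y" 0] by simp
  also have "\<dots> = (\<integral>y. - (heat_kernel t (y - x) * f y) \<partial>lborel)"
  proof -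
    have "- y + x = - (y - x)" for y by simp
    then have "heat_kernel t (- y + x) = heat_kernel t (y - x)" for y
      by (simp only: heat_kernel_uminus)
    then show ?thesis by (simp add: odd)
  qed
  finally show ?thesis by (simp add: heat_def)
qed

lemma heat_kernel_diff_nonneg:
  assumes "0 < t" "0 \<le> x" "0 \<le> y"
  shows "0 \<le> heat_kernel t (y - x) - heat_kernel t (y + x)"
proof -
  have "(y - x)\<^sup>2 \<le> (y + x)\<^sup>2" using assms by (simp add: power2_eq_square algebra_simps)
  then have "exp (- (y + x)\<^sup>2 / (2 * t)) \<le> exp (- (y - x)\<^sup>2 / (2 * t))"
    using assms by (simp add: divide_right_mono)
  then show ?thesis using assms by (simp add: heat_kernel_eq divide_right_mono)
qed

text \<open>For odd data the kernel minus its mirror image acts as the heat kernel of the half-line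
  with Dirichlet condition at 0, which is nonnegative. Oddness thus replaces a boundary condition
  and gives a comparison principle.\<close>

lemma heat_odd_nonneg:
  assumes "0 < t" "f \<in> borel_measurable borel" "\<And>y. \<bar>f y\<bar> \<le> B" "\<And>y. f (- y) = - f y"
    and "\<And>y. 0 < y \<Longrightarrow> 0 \<le> f y" and "0 \<le> x"
  shows "0 \<le> heat t f x"
  unfolding heat_odd_eq[OF assms(1-4)]
proof (rule integral_nonneg_AE, rule AE_I2)
  fix y
  show "0 \<le> (heat_kernel t (y - x) - heat_kernel t (y + x)) * f y * indicator {0<..} y"
    using heat_kernel_diff_nonneg[of t x y] assms(1,5,6)
    by (cases "0 < y") (auto intro!: mult_nonneg_nonneg)
qed

lemma integrable_indicator_Icc [simp]: "integrable lborel (indicator {a..b :: real} :: real \<Rightarrow> real)"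
  by (cases "a \<le> b") (auto intro!: integrable_real_indicator)

lemma integral_indicator_Icc:
  fixes a b c :: real
  assumes "a \<le> b"
  shows "(\<integral>y. c * indicator {a..b} y \<partial>lborel) = c * (b - a)"
  using assms by simp

text \<open>A Gaussian step across 0 overshoots by an amount with an exponential moment bounded uniformly in
  the starting point.\<close>
lemma overshoot:
  obtains A :: real where "0 < A" and "\<And>x. 0 \<le> x \<Longrightarrow>
    (\<integral>y. std_normal_density (y - x) * exp (- y / 2) * indicator {..0} y \<partial>lborel)
      \<le> A * (\<integral>y. std_normal_density (y - x) * indicator {..0} y \<partial>lborel)"
proof -
  define K where "K = (\<integral>y. std_normal_density y * exp (- y / 2) \<partial>lborel)"
  have iK: "integrable lborel (\<lambda>y. std_normal_density y * exp (- y / 2))"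
    using gauss_integrable_exp[of "-1/2"]
    by (subst (asm) integrable_density) (auto simp: normal_density_nonneg)
  have K0: "0 \<le> K" unfolding K_def by (intro integral_nonneg_AE) (auto simp: normal_density_nonneg)
  show ?thesis
  proof
    show "0 < exp (1/2) + exp (1/2) * sqrt (2 * pi) * K"
      using K0 by (intro add_pos_nonneg) auto
    fix x :: real assume x: "0 \<le> x"
    let ?p = "std_normal_density"
    have f: "?p (y - x) = ?p x * exp (x * y) * (sqrt (2 * pi) * ?p y)" for y
      by (simp add: std_normal_density_def mult_exp_exp power2_eq_square algebra_simps
          add_divide_distrib diff_divide_distrib)
    have i1: "integrable lborel (\<lambda>y. ?p (y - x) * indicator {..0} y)"
      using heat_kernel_integrable[of 1 "indicator {..0}" 1 x] by (simp split: split_indicator)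
    have i2: "integrable lborel (\<lambda>y. ?p (y - x) * exp (- y / 2) * indicator {..0} y)"
    proof -
      have "integrable lborel (\<lambda>y. exp (- x / 2) * (?p (- x + 1 * y) * exp (- (- x + 1 * y) / 2)))"
        by (intro integrable_mult_right lborel_integrable_real_affine iK) auto
      also have "(\<lambda>y. exp (- x / 2) * (?p (- x + 1 * y) * exp (- (- x + 1 * y) / 2)))
          = (\<lambda>y. ?p (y - x) * exp (- y / 2))"
      proof
        fix y
        have "exp (- x / 2) * exp (- (- x + 1 * y) / 2) = exp (- y / 2)"
          by (simp add: mult_exp_exp diff_divide_distrib)
        moreover have "exp (- x / 2) * (?p (- x + 1 * y) * exp (- (- x + 1 * y) / 2))
            = ?p (y - x) * (exp (- x / 2) * exp (- (- x + 1 * y) / 2))" by simp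
        ultimately show "exp (- x / 2) * (?p (- x + 1 * y) * exp (- (- x + 1 * y) / 2))
            = ?p (y - x) * exp (- y / 2)" by (simp only:)
      qed
      finally have "integrable lborel (\<lambda>y. ?p (y - x) * exp (- y / 2))" .
      from integrable_real_mult_indicator[OF _ this, of "{..0}"] show ?thesis by simp
    qed
    \<comment> \<open>Both sides are compared through \<open>?p x * exp (- x)\<close>: the interval
      \<open>{-1..0}\<close> alone has this mass up to a constant, and below -1 the tilt
      \<open>exp (x * y)\<close> is at most \<open>exp (- x)\<close>.\<close>
    have low: "?p x * exp (- x - 1/2) \<le> (\<integral>y. ?p (y - x) * indicator {..0} y \<partial>lborel)"
    proof -
      have "?p x * exp (- x - 1/2) = (\<integral>y. ?p x * exp (- x - 1/2) * indicator {-1..0::real} y \<partial>lborel)"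
        by (subst integral_indicator_Icc) auto
      also have "\<dots> \<le> (\<integral>y. ?p (y - x) * indicator {..0} y \<partial>lborel)"
      proof (rule integral_mono)
        show "integrable lborel (\<lambda>y. ?p x * exp (- x - 1/2) * indicator {-1..0::real} y)"
          by (intro integrable_mult_right integrable_indicator_Icc)
        fix y :: real
        have "?p x * exp (- x - 1/2) \<le> ?p (y - x)" if y: "-1 \<le> y" "y \<le> 0"
        proof -
          have "y\<^sup>2 \<le> 1" using y abs_square_le_1[of y] by (simp add: abs_le_iff)
          moreover have "- x \<le> x * y" using mult_left_mono[OF y(1) x] by simp
          ultimately have "exp (- x - 1/2) \<le> exp (x * y - y\<^sup>2 / 2)" by simp
          then have "?p x * exp (- x - 1/2) \<le> ?p x * exp (x * y - y\<^sup>2 / 2)"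
            by (intro mult_left_mono) (auto simp: normal_density_nonneg)
          also have "\<dots> = ?p (y - x)"
            unfolding f by (simp add: std_normal_density_def mult_exp_exp)
          finally show ?thesis .
        qed
        then show "?p x * exp (- x - 1/2) * indicator {-1..0} y \<le> ?p (y - x) * indicator {..0} y"
          by (auto split: split_indicator simp: normal_density_nonneg)
      qed (rule i1)
      finally show ?thesis .
    qed
    have "(\<integral>y. ?p (y - x) * exp (- y / 2) * indicator {..0} y \<partial>lborel)
        \<le> (\<integral>y. exp (1/2) * (?p (y - x) * indicator {..0} y)
            + (?p x * exp (- x) * sqrt (2 * pi)) * (?p y * exp (- y / 2)) \<partial>lborel)"
    proof (rule integral_mono[OF i2])
      show "integrable lborel (\<lambda>y. exp (1/2) * (?p (y - x) * indicator {..0} y)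
            + (?p x * exp (- x) * sqrt (2 * pi)) * (?p y * exp (- y / 2)))"
        by (intro Bochner_Integration.integrable_add integrable_mult_right i1 iK)
      fix y :: real
      have pn: "0 \<le> ?p v" for v by (simp add: normal_density_nonneg)
      have "?p (y - x) * exp (- y / 2) \<le> exp (1/2) * ?p (y - x)
            + (?p x * exp (- x) * sqrt (2 * pi)) * (?p y * exp (- y / 2))" if y: "y \<le> 0"
      proof (cases "-1 \<le> y")
        case True
        then have "exp (- y / 2) \<le> exp (1/2)" by simp
        then have "?p (y - x) * exp (- y / 2) \<le> ?p (y - x) * exp (1/2)"
          by (intro mult_left_mono pn)
        moreover have "0 \<le> (?p x * exp (- x) * sqrt (2 * pi)) * (?p y * exp (- y / 2))"
          by (intro mult_nonneg_nonneg pn) auto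
        moreover have "?p (y - x) * exp (1/2) = exp (1/2) * ?p (y - x)" by (rule mult.commute)
        ultimately show ?thesis by linarith
      next
        case False
        then have "x * y \<le> - x" using mult_left_mono[of y "-1" x] x by simp
        then have "?p x * exp (x * y) * (sqrt (2 * pi) * ?p y) * exp (- y / 2)
          \<le> ?p x * exp (- x) * (sqrt (2 * pi) * ?p y) * exp (- y / 2)"
          by (intro mult_right_mono mult_left_mono mult_nonneg_nonneg pn) auto
        then have "?p (y - x) * exp (- y / 2)
          \<le> (?p x * exp (- x) * sqrt (2 * pi)) * (?p y * exp (- y / 2))"
          unfolding f by (simp only: mult.assoc)
        moreover have "0 \<le> exp (1/2) * ?p (y - x)" by (intro mult_nonneg_nonneg pn) auto
        ultimately show ?thesis by linarith
      qed
      moreover have "0 \<le> (?p x * exp (- x) * sqrt (2 * pi)) * (?p y * exp (- y / 2))"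
        by (intro mult_nonneg_nonneg pn) auto
      ultimately show "?p (y - x) * exp (- y / 2) * indicator {..0} y
        \<le> exp (1/2) * (?p (y - x) * indicator {..0} y)
            + (?p x * exp (- x) * sqrt (2 * pi)) * (?p y * exp (- y / 2))"
        by (simp split: split_indicator)
    qed
    also have "\<dots> = exp (1/2) * (\<integral>y. ?p (y - x) * indicator {..0} y \<partial>lborel)
        + exp (1/2) * sqrt (2 * pi) * K * (?p x * exp (- x - 1/2))"
    proof -
      have e: "exp (- x) = exp (1/2) * exp (- x - 1/2)" by (simp add: mult_exp_exp)
      have "?p x * exp (- x) * sqrt (2 * pi) * K
          = exp (1/2) * sqrt (2 * pi) * K * (?p x * exp (- x - 1/2))"
        unfolding e by (simp only: ac_simps)
      then show ?thesis
        by (subst Bochner_Integration.integral_add) (use i1 iK in \<open>auto simp: K_def\<close>)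
    qed
    also have "\<dots> \<le> exp (1/2) * (\<integral>y. ?p (y - x) * indicator {..0} y \<partial>lborel)
        + exp (1/2) * sqrt (2 * pi) * K * (\<integral>y. ?p (y - x) * indicator {..0} y \<partial>lborel)"
      by (intro add_left_mono mult_left_mono low mult_nonneg_nonneg K0) auto
    finally show "(\<integral>y. ?p (y - x) * exp (- y / 2) * indicator {..0} y \<partial>lborel)
        \<le> (exp (1/2) + exp (1/2) * sqrt (2 * pi) * K) * (\<integral>y. ?p (y - x) * indicator {..0} y \<partial>lborel)"
      by (simp only: distrib_right)
  qed
qed

text \<open>By reflection this is the probability that Brownian motion from \<open>x\<close> avoids
  0 up to time \<open>t\<close>. The next two lemmas bound it by the extreme values of the density
  on the interval, which makes it linear in \<open>x\<close> with slope of order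
  \<open>1 / sqrt t\<close>.\<close>

lemma heat_sgn_eq:
  assumes t: "0 < t" and x: "0 \<le> x"
  shows "heat t sgn x = (\<integral>v. heat_kernel t v * indicator {-x..x} v \<partial>lborel)"
proof -
  have i: "integrable lborel (\<lambda>v. heat_kernel t v * sgn (x + v))"
    using heat_kernel_integrable[OF t, of "\<lambda>v. sgn (x + v)" 1 0] by (simp add: sgn_if)
  have i': "integrable lborel (\<lambda>v. heat_kernel t v * sgn (x - v))"
    using heat_kernel_integrable[OF t, of "\<lambda>v. sgn (x - v)" 1 0] by (simp add: sgn_if)
  have 1: "heat t sgn x = (\<integral>v. heat_kernel t v * sgn (x + v) \<partial>lborel)"
    unfolding heat_def using lborel_integral_real_affine[of 1 "\<lambda>y. heat_kernel t (y - x) * sgn y" x] by simp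
  have 2: "\<dots> = (\<integral>v. heat_kernel t v * sgn (x - v) \<partial>lborel)"
    using lborel_integral_real_affine[of "-1" "\<lambda>v. heat_kernel t v * sgn (x + v)" 0]
    by (simp add: heat_kernel_uminus)
  \<comment> \<open>Averaging with the mirror image turns the integrand into the indicator, up to
    the two end points.\<close>
  have "heat t sgn x = ((\<integral>v. heat_kernel t v * sgn (x + v) \<partial>lborel)
      + (\<integral>v. heat_kernel t v * sgn (x - v) \<partial>lborel)) / 2"
    using 1 2 by simp
  also have "\<dots> = (\<integral>v. (heat_kernel t v * sgn (x + v) + heat_kernel t v * sgn (x - v)) / 2 \<partial>lborel)"
    using i i' by simp
  also have "\<dots> = (\<integral>v. heat_kernel t v * indicator {-x..x} v \<partial>lborel)"
  proof (rule integral_cong_AE)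
    have "AE v in lborel. v \<noteq> x" "AE v in lborel. v \<noteq> - x" by (auto intro: AE_lborel_singleton)
    then show "AE v in lborel. (heat_kernel t v * sgn (x + v) + heat_kernel t v * sgn (x - v)) / 2
        = heat_kernel t v * indicator {-x..x} v"
    proof eventually_elim
      case (elim v)
      then show ?case using x by (auto simp: sgn_if split: split_indicator)
    qed
  qed measurable
  finally show ?thesis .
qed

lemma heat_sgn_upper:
  assumes t: "0 < t" and x: "0 \<le> x"
  shows "heat t sgn x \<le> 2 / sqrt (2 * pi * t) * x"
proof -
  have "heat t sgn x \<le> (\<integral>v. 1 / sqrt (2 * pi * t) * indicator {-x..x} v \<partial>lborel)"
    unfolding heat_sgn_eq[OF assms]
  proof (rule integral_mono)
    show "integrable lborel (\<lambda>v. heat_kernel t v * indicator {-x..x} v)"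
      using heat_kernel_integrable[OF t, of "indicator {-x..x}" 1 0] by (simp split: split_indicator)
    show "integrable lborel (\<lambda>v. 1 / sqrt (2 * pi * t) * indicator {-x..x} v)"
      by (intro integrable_mult_right integrable_indicator_Icc)
    show "heat_kernel t v * indicator {-x..x} v \<le> 1 / sqrt (2 * pi * t) * indicator {-x..x} v" for v
      by (intro mult_right_mono heat_kernel_le t) simp
  qed
  also have "\<dots> = 2 / sqrt (2 * pi * t) * x" using x by simp
  finally show ?thesis .
qed

lemma heat_sgn_lower:
  assumes t: "0 < t" and x: "0 \<le> x"
  shows "2 / sqrt (2 * pi * t) * x * exp (- x\<^sup>2 / (2 * t)) \<le> heat t sgn x"
proof -
  have "2 / sqrt (2 * pi * t) * x * exp (- x\<^sup>2 / (2 * t))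
      = (\<integral>v. heat_kernel t x * indicator {-x..x} v \<partial>lborel)"
    using x t by (simp add: heat_kernel_eq)
  also have "\<dots> \<le> heat t sgn x"
    unfolding heat_sgn_eq[OF assms]
  proof (rule integral_mono)
    show "integrable lborel (\<lambda>v. heat_kernel t v * indicator {-x..x} v)"
      using heat_kernel_integrable[OF t, of "indicator {-x..x}" 1 0] by (simp split: split_indicator)
    fix v :: real
    have "heat_kernel t x \<le> heat_kernel t v" if "-x \<le> v" "v \<le> x"
    proof -
      have "v\<^sup>2 \<le> x\<^sup>2" using that by (simp add: abs_le_square_iff[symmetric] abs_le_iff)
      then show ?thesis using t by (simp add: heat_kernel_eq divide_right_mono)
    qed
    then show "heat_kernel t x * indicator {-x..x} v \<le> heat_kernel t v * indicator {-x..x} v"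
      by (auto split: split_indicator)
  qed (intro integrable_mult_right integrable_indicator_Icc)
  finally show ?thesis .
qed

section \<open>The Gaussian walk killed at zero\<close>

text \<open>The starting point carries the indicator as well, so that the kernel is symmetric and
  \<open>killed\<close> is self-adjoint. Values in \<open>ennreal\<close> spare all integrability
  conditions.\<close>

definition killed :: "(real \<Rightarrow> ennreal) \<Rightarrow> real \<Rightarrow> ennreal" where
  "killed f x = (\<integral>\<^sup>+y. ennreal (std_normal_density (y - x)) * indicator {0<..} x * indicator {0<..} y * f y \<partial>lborel)"

lemma killed_measurable [measurable (raw)]:
  assumes [measurable]: "f \<in> borel_measurable borel"
  shows "killed f \<in> borel_measurable borel"
  unfolding killed_def by measurable

lemma killed_pow_measurable [measurable (raw)]:
  assumes [measurable]: "f \<in> borel_measurable borel"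
  shows "(killed ^^ k) f \<in> borel_measurable borel"
  by (induction k) auto

lemma killed_outside: "x \<le> 0 \<Longrightarrow> killed f x = 0"
  by (simp add: killed_def)

lemma killed_mono: "(\<And>y. 0 < y \<Longrightarrow> f y \<le> g y) \<Longrightarrow> killed f x \<le> killed g x"
  unfolding killed_def by (intro nn_integral_mono) (auto split: split_indicator intro!: mult_left_mono)

lemma killed_cmult:
  assumes [measurable]: "f \<in> borel_measurable borel"
  shows "killed (\<lambda>y. c * f y) x = c * killed f x"
  unfolding killed_def by (subst nn_integral_cmult[symmetric]) (auto simp: ac_simps)

lemma killed_pow_cmult:
  assumes [measurable]: "f \<in> borel_measurable borel"
  shows "(killed ^^ k) (\<lambda>y. c * f y) x = c * (killed ^^ k) f x"
proof (induction k arbitrary: x)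
  case (Suc k)
  then have "(killed ^^ k) (\<lambda>y. c * f y) = (\<lambda>x. c * (killed ^^ k) f x)" by auto
  then show ?case by (simp add: killed_cmult)
qed auto

lemma killed_pow_mono: "(\<And>y. f y \<le> g y) \<Longrightarrow> (killed ^^ k) f x \<le> (killed ^^ k) g x"
  by (induction k arbitrary: x) (auto intro: killed_mono)

lemma killed_dual:
  assumes [measurable]: "f \<in> borel_measurable borel" "g \<in> borel_measurable borel"
  shows "(\<integral>\<^sup>+x. f x * killed g x \<partial>lborel) = (\<integral>\<^sup>+x. killed f x * g x \<partial>lborel)"
proof -
  have s: "std_normal_density (y - x) = std_normal_density (x - y)" for x y
    using heat_kernel_uminus[of 1 "y - x"] by simp
  have "(\<integral>\<^sup>+x. f x * killed g x \<partial>lborel) = (\<integral>\<^sup>+x. (\<integral>\<^sup>+y. f x * (ennreal (std_normal_density (y - x))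
      * indicator {0<..} x * indicator {0<..} y * g y) \<partial>lborel) \<partial>lborel)"
    unfolding killed_def by (subst nn_integral_cmult) auto
  also have "\<dots> = (\<integral>\<^sup>+y. (\<integral>\<^sup>+x. f x * (ennreal (std_normal_density (y - x))
      * indicator {0<..} x * indicator {0<..} y * g y) \<partial>lborel) \<partial>lborel)"
    by (rule lborel_pair.Fubini') measurable
  also have "\<dots> = (\<integral>\<^sup>+y. killed f y * g y \<partial>lborel)"
    unfolding killed_def
    by (subst nn_integral_multc[symmetric]) (auto simp: ac_simps s intro!: nn_integral_cong)
  finally show ?thesis .
qed

lemma killed_pow_dual:
  assumes [measurable]: "f \<in> borel_measurable borel" "g \<in> borel_measurable borel"
  shows "(\<integral>\<^sup>+x. f x * (killed ^^ k) g x \<partial>lborel) = (\<integral>\<^sup>+x. (killed ^^ k) f x * g x \<partial>lborel)"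
  using assms
proof (induction k arbitrary: f g)
  case (Suc k)
  note [measurable] = Suc.prems
  have "(\<integral>\<^sup>+x. f x * (killed ^^ Suc k) g x \<partial>lborel) = (\<integral>\<^sup>+x. killed f x * (killed ^^ k) g x \<partial>lborel)"
    using killed_dual[OF Suc.prems(1) killed_pow_measurable[OF Suc.prems(2)]] by simp
  also have "\<dots> = (\<integral>\<^sup>+x. (killed ^^ k) (killed f) x * g x \<partial>lborel)"
    by (rule Suc.IH) auto
  finally show ?case by (simp add: funpow_swap1)
qed auto

text \<open>Forget the killing except at the last step. The power is \<open>Suc j\<close> because
  the kernel at time 0 is not a density.\<close>

lemma killed_pow_heat_kernel:
  assumes [measurable]: "g \<in> borel_measurable borel"
  shows "(killed ^^ Suc j) g x
    \<le> (\<integral>\<^sup>+y. ennreal (heat_kernel (real (Suc j)) (y - x)) * (indicator {0<..} y * g y) \<partial>lborel)"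
proof (induction j arbitrary: x)
  case 0
  show ?case unfolding funpow.simps o_def killed_def
    by (auto intro!: nn_integral_mono split: split_indicator)
next
  case (Suc j)
  let ?t = "real (Suc j)"
  have "(killed ^^ Suc (Suc j)) g x \<le> (\<integral>\<^sup>+y. ennreal (std_normal_density (y - x)) *
      (\<integral>\<^sup>+v. ennreal (heat_kernel ?t (v - y)) * (indicator {0<..} v * g v) \<partial>lborel) \<partial>lborel)"
    unfolding funpow.simps(2)[of "Suc j"] o_def killed_def[of "(killed ^^ Suc j) g"]
    using Suc.IH by (auto intro!: nn_integral_mono mult_left_mono split: split_indicator simp del: funpow.simps)
  also have "\<dots> = (\<integral>\<^sup>+y. (\<integral>\<^sup>+v. ennreal (std_normal_density (y - x)) *
      (ennreal (heat_kernel ?t (v - y)) * (indicator {0<..} v * g v)) \<partial>lborel) \<partial>lborel)"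
    by (subst nn_integral_cmult) auto
  also have "\<dots> = (\<integral>\<^sup>+v. (\<integral>\<^sup>+y. ennreal (std_normal_density (y - x)) *
      (ennreal (heat_kernel ?t (v - y)) * (indicator {0<..} v * g v)) \<partial>lborel) \<partial>lborel)"
    by (rule lborel_pair.Fubini') measurable
  also have "\<dots> = (\<integral>\<^sup>+v. ennreal (heat_kernel (real (Suc (Suc j))) (v - x)) * (indicator {0<..} v * g v) \<partial>lborel)"
  proof (rule nn_integral_cong)
    fix v
    have "(\<integral>\<^sup>+y. ennreal (std_normal_density (y - x)) *
      (ennreal (heat_kernel ?t (v - y)) * (indicator {0<..} v * g v)) \<partial>lborel)
      = (\<integral>\<^sup>+y. ennreal (heat_kernel ?t (v - y) * std_normal_density (y - x)) \<partial>lborel) * (indicator {0<..} v * g v)"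
      by (subst nn_integral_multc[symmetric])
         (auto simp: ennreal_mult normal_density_nonneg ac_simps intro!: nn_integral_cong)
    also have "(\<integral>\<^sup>+y. ennreal (heat_kernel ?t (v - y) * std_normal_density (y - x)) \<partial>lborel)
      = (\<integral>\<^sup>+y. ennreal (heat_kernel ?t ((v - x) - y) * std_normal_density y) \<partial>lborel)"
      by (subst nn_integral_real_affine[of _ 1 x]) (auto simp: algebra_simps)
    also have "\<dots> = ennreal (heat_kernel (real (Suc (Suc j))) (v - x))"
      using fun_cong[OF conv_normal_density_zero_mean[of "sqrt ?t" 1], of "v - x"]
      by (simp add: add_ac)
    finally show "(\<integral>\<^sup>+y. ennreal (std_normal_density (y - x)) *
      (ennreal (heat_kernel ?t (v - y)) * (indicator {0<..} v * g v)) \<partial>lborel)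
      = ennreal (heat_kernel (real (Suc (Suc j))) (v - x)) * (indicator {0<..} v * g v)" .
  qed
  finally show ?case .
qed

lemma killed_pow_sup:
  assumes [measurable]: "g \<in> borel_measurable borel" and j: "0 < j"
  shows "(killed ^^ j) g x \<le> ennreal (1 / sqrt (real j)) * (\<integral>\<^sup>+y. indicator {0<..} y * g y \<partial>lborel)"
proof -
  obtain i where ji: "j = Suc i" using j by (cases j) auto
  have b: "heat_kernel (real j) v \<le> 1 / sqrt (real j)" for v
  proof -
    have "heat_kernel (real j) v \<le> 1 / sqrt (2 * pi * real j)" using j by (intro heat_kernel_le) auto
    also have "\<dots> \<le> 1 / sqrt (real j)"
      using j pi_gt3 by (intro divide_left_mono mult_pos_pos real_sqrt_le_mono) auto
    finally show ?thesis .
  qed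
  have "(killed ^^ j) g x \<le> (\<integral>\<^sup>+y. ennreal (heat_kernel (real j) (y - x)) * (indicator {0<..} y * g y) \<partial>lborel)"
    unfolding ji by (rule killed_pow_heat_kernel) simp
  also have "\<dots> \<le> (\<integral>\<^sup>+y. ennreal (1 / sqrt (real j)) * (indicator {0<..} y * g y) \<partial>lborel)"
    by (intro nn_integral_mono mult_right_mono ennreal_leI b) auto
  also have "\<dots> = ennreal (1 / sqrt (real j)) * (\<integral>\<^sup>+y. indicator {0<..} y * g y \<partial>lborel)"
    by (rule nn_integral_cmult) measurable
  finally show ?thesis .
qed

text \<open>The supersolution is the heat flow of \<open>sgn\<close> seen from \<open>x + b\<close>, where the shift \<open>b\<close> compensates the
  overshoot.\<close>
lemma killed_survival:
  obtains C :: real where "0 < C"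
    and "\<And>k x. (killed ^^ k) (indicator {0<..}) x \<le> ennreal (C * (1 + x) / sqrt (real (Suc k))) * indicator {0<..} x"
proof -
  obtain A where A: "0 < A" and over: "\<And>x. 0 \<le> x \<Longrightarrow>
    (\<integral>y. std_normal_density (y - x) * exp (- y / 2) * indicator {..0} y \<partial>lborel)
      \<le> A * (\<integral>y. std_normal_density (y - x) * indicator {..0} y \<partial>lborel)"
    by (rule overshoot) blast
  \<comment> \<open>\<rho> bounds the loss in the Gaussian factor at distance at most
    \<open>b\<close>, given that the clock \<open>t\<close> starts at \<open>b\<^sup>2\<close>. The
    shift \<open>b\<close> is so large that \<open>\<rho> * b\<close> absorbs the overshoot
    constant.\<close>
  define \<rho> :: real where "\<rho> = exp (- 1/2)"
  define b where "b = 2 * A / \<rho> + 1"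
  have b: "1 \<le> b" "2 * A \<le> \<rho> * b" using A by (auto simp: b_def \<rho>_def field_simps)
  define t where "t k = real k + b\<^sup>2" for k :: nat
  have t: "0 < t k" "b\<^sup>2 \<le> t k" for k using b by (auto simp: t_def add_nonneg_pos)
  have tS: "t (Suc k) = t k + 1" for k by (simp add: t_def)
  define F where "F k x = heat (t k) sgn (x + b)" for k x
  define \<sigma> where "\<sigma> k = 2 / sqrt (2 * pi * t k)" for k
  have \<sigma>: "0 < \<sigma> k" for k using t[of k] by (simp add: \<sigma>_def)
  have [measurable]: "F k \<in> borel_measurable borel" for k
    unfolding F_def by (rule measurable_compose[OF _ heat_measurable]) (auto simp: borel_measurable_sgn)
  have F_bound: "\<bar>F k x\<bar> \<le> 1" for k x
    unfolding F_def by (rule heat_bound) (use t in \<open>auto simp: sgn_if\<close>)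
  have F_nonneg: "0 \<le> F k x" if "- b \<le> x" for k x
    unfolding F_def by (rule heat_odd_nonneg[where B=1]) (use t that in \<open>auto simp: sgn_if\<close>)
  have F_upper: "F k x \<le> \<sigma> k * (x + b)" if "- b \<le> x" for k x
    unfolding F_def \<sigma>_def by (rule heat_sgn_upper) (use t that in auto)
  have F_lower: "\<sigma> k * \<rho> * (x + b) \<le> F k x" if "- b \<le> x" "x \<le> 0" for k x
  proof -
    have "(x + b)\<^sup>2 \<le> b\<^sup>2" using that by (intro power_mono) auto
    then have "(x + b)\<^sup>2 / (2 * t k) \<le> t k / (2 * t k)"
      using t[of k] by (intro divide_right_mono) auto
    also have "\<dots> = 1/2" using t[of k] by simp
    finally have "\<rho> \<le> exp (- (x + b)\<^sup>2 / (2 * t k))" by (simp add: \<rho>_def)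
    then have "\<sigma> k * (x + b) * \<rho> \<le> \<sigma> k * (x + b) * exp (- (x + b)\<^sup>2 / (2 * t k))"
      using \<sigma>[of k] that by (intro mult_left_mono) auto
    also have "\<dots> \<le> F k x" unfolding F_def \<sigma>_def by (rule heat_sgn_lower) (use t that in auto)
    finally show ?thesis by (simp add: ac_simps)
  qed
  have \<rho>: "0 < \<rho>" "\<rho> \<le> 1" by (auto simp: \<rho>_def)
  \<comment> \<open>A linear minorant on the whole negative half-line: right of \<open>- b\<close>
    from the lower bound for the flow, left of it from the upper bound and oddness.\<close>
  have F_neg: "\<sigma> k * (\<rho> * b + x) \<le> F k x" if x: "x \<le> 0" for k x
  proof (cases "- b \<le> x")
    case True
    have "\<rho> * b + x \<le> \<rho> * (x + b)" using mult_right_mono_neg[of \<rho> 1 x] \<rho> x by (simp add: algebra_simps)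
    then have "\<sigma> k * (\<rho> * b + x) \<le> \<sigma> k * (\<rho> * (x + b))"
      using \<sigma>[of k] by (intro mult_left_mono) auto
    then show ?thesis using F_lower[OF True x, of k] by (simp add: mult.assoc)
  next
    case False
    have "F k x = - F k (- x - 2 * b)"
    proof -
      have "x + b = - (- x - 2 * b + b)" by simp
      then show ?thesis unfolding F_def by (metis heat_odd_uminus sgn_minus)
    qed
    also have "\<dots> \<ge> - (\<sigma> k * (- x - 2 * b + b))" using F_upper[of "- x - 2 * b" k] False by simp
    also have "- (\<sigma> k * (- x - 2 * b + b)) = \<sigma> k * (b + x)" by (simp add: algebra_simps)
    finally have "\<sigma> k * (b + x) \<le> F k x" .
    moreover have "\<sigma> k * (\<rho> * b + x) \<le> \<sigma> k * (b + x)"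
      using \<sigma>[of k] \<rho> b by (intro mult_left_mono) (auto intro: mult_left_le_one_le)
    ultimately show ?thesis by linarith
  qed
  let ?p = "std_normal_density"
  have pn: "0 \<le> ?p v" for v by (simp add: normal_density_nonneg)
  have step: "(\<integral>y. ?p (y - x) * F k y * indicator {0<..} y \<partial>lborel) \<le> F (Suc k) x" if x: "0 \<le> x" for k x
  proof -
    have iF: "integrable lborel (\<lambda>y. ?p (y - x) * F k y)"
      using heat_kernel_integrable[of 1 "F k" 1 x] F_bound by simp
    have iFn: "integrable lborel (\<lambda>y. ?p (y - x) * F k y * indicator {..0} y)"
      and iFp: "integrable lborel (\<lambda>y. ?p (y - x) * F k y * indicator {0<..} y)"
      using integrable_real_mult_indicator[OF _ iF, of "{..0}"]
        integrable_real_mult_indicator[OF _ iF, of "{0<..}"] by simp_all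
    have i1: "integrable lborel (\<lambda>y. ?p (y - x) * indicator {..0} y)"
      using heat_kernel_integrable[of 1 "indicator {..0}" 1 x] by (simp split: split_indicator)
    have i2: "integrable lborel (\<lambda>y. ?p (y - x) * exp (- y / 2) * indicator {..0} y)"
    proof -
      have "integrable std_normal_distribution (\<lambda>z. exp (- x / 2) * exp (- 1/2 * z))"
        by (intro integrable_mult_right gauss_integrable_exp)
      then have "integrable lborel (\<lambda>z. ?p z * (exp (- x / 2) * exp (- 1/2 * z)))"
        by (subst (asm) integrable_density) (auto simp: pn)
      from lborel_integrable_real_affine[OF this, of 1 "- x"]
      have "integrable lborel (\<lambda>y. ?p (- x + 1 * y) * (exp (- x / 2) * exp (- 1/2 * (- x + 1 * y))))"
        by simp
      also have "(\<lambda>y. ?p (- x + 1 * y) * (exp (- x / 2) * exp (- 1/2 * (- x + 1 * y))))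
          = (\<lambda>y. ?p (y - x) * exp (- y / 2))"
      proof
        fix y
        have "exp (- x / 2) * exp (- 1/2 * (- x + 1 * y)) = exp (- y / 2)"
          by (simp add: mult_exp_exp diff_divide_distrib)
        then show "?p (- x + 1 * y) * (exp (- x / 2) * exp (- 1/2 * (- x + 1 * y)))
          = ?p (y - x) * exp (- y / 2)" by simp
      qed
      finally have "integrable lborel (\<lambda>y. ?p (y - x) * exp (- y / 2))" .
      from integrable_real_mult_indicator[OF _ this, of "{..0}"] show ?thesis by simp
    qed
    \<comment> \<open>The part that the killing removes has nonnegative integral:
      \<open>- y \<le> 2 * exp (- y / 2)\<close> reduces this to the overshoot estimate. Hence
      \<open>F\<close> is a supersolution for the killed walk.\<close>
    have "0 \<le> \<sigma> k * ((\<rho> * b) * (\<integral>y. ?p (y - x) * indicator {..0} y \<partial>lborel)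
        - 2 * (\<integral>y. ?p (y - x) * exp (- y / 2) * indicator {..0} y \<partial>lborel))"
    proof -
      have "0 \<le> (\<integral>y. ?p (y - x) * indicator {..0} y \<partial>lborel)"
        by (intro integral_nonneg_AE) (auto simp: pn)
      then have "2 * A * (\<integral>y. ?p (y - x) * indicator {..0} y \<partial>lborel)
          \<le> \<rho> * b * (\<integral>y. ?p (y - x) * indicator {..0} y \<partial>lborel)"
        using b by (intro mult_right_mono) auto
      then show ?thesis using over[OF x] \<sigma>[of k] by (intro mult_nonneg_nonneg) auto
    qed
    also have "\<dots> = (\<integral>y. \<sigma> k * ((\<rho> * b) * (?p (y - x) * indicator {..0} y)
        - 2 * (?p (y - x) * exp (- y / 2) * indicator {..0} y)) \<partial>lborel)"
      using i1 i2 by simp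
    also have "\<dots> \<le> (\<integral>y. ?p (y - x) * F k y * indicator {..0} y \<partial>lborel)"
    proof (rule integral_mono[OF _ iFn])
      show "integrable lborel (\<lambda>y. \<sigma> k * ((\<rho> * b) * (?p (y - x) * indicator {..0} y)
        - 2 * (?p (y - x) * exp (- y / 2) * indicator {..0} y)))"
        using i1 i2 by (intro integrable_mult_right Bochner_Integration.integrable_diff)
      fix y :: real
      have "\<sigma> k * (\<rho> * b - 2 * exp (- y / 2)) \<le> F k y" if y: "y \<le> 0"
      proof -
        have "- y \<le> 2 * exp (- y / 2)" using exp_ge_add_one_self[of "- y / 2"] by linarith
        then have "\<sigma> k * (\<rho> * b - 2 * exp (- y / 2)) \<le> \<sigma> k * (\<rho> * b + y)"
          using \<sigma>[of k] by (intro mult_left_mono) auto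
        then show ?thesis using F_neg[OF y, of k] by linarith
      qed
      then have "?p (y - x) * (\<sigma> k * (\<rho> * b - 2 * exp (- y / 2))) \<le> ?p (y - x) * F k y" if "y \<le> 0"
        using that by (intro mult_left_mono pn)
      then show "\<sigma> k * ((\<rho> * b) * (?p (y - x) * indicator {..0} y)
        - 2 * (?p (y - x) * exp (- y / 2) * indicator {..0} y)) \<le> ?p (y - x) * F k y * indicator {..0} y"
        by (auto split: split_indicator simp: algebra_simps)
    qed
    finally have neg: "0 \<le> (\<integral>y. ?p (y - x) * F k y * indicator {..0} y \<partial>lborel)" .
    have "F (Suc k) x = gconv (heat (t k) sgn) (x + b)"
      unfolding F_def tS by (rule gconv_heat[symmetric, where B=1]) (use t in \<open>auto simp: sgn_if\<close>)
    also have "\<dots> = gconv (F k) x" by (simp add: gconv_def F_def ac_simps)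
    also have "\<dots> = (\<integral>y. ?p (y - x) * F k y \<partial>lborel)" by (rule gconv_lborel) simp
    also have "\<dots> = (\<integral>y. ?p (y - x) * F k y * indicator {0<..} y + ?p (y - x) * F k y * indicator {..0} y \<partial>lborel)"
      by (intro Bochner_Integration.integral_cong) (auto split: split_indicator)
    also have "\<dots> = (\<integral>y. ?p (y - x) * F k y * indicator {0<..} y \<partial>lborel)
        + (\<integral>y. ?p (y - x) * F k y * indicator {..0} y \<partial>lborel)"
      by (rule Bochner_Integration.integral_add[OF iFp iFn])
    finally show ?thesis using neg by simp
  qed
  define m where "m = \<sigma> 0 * \<rho> * b"
  have m: "0 < m" using \<sigma>[of 0] \<rho> b by (simp add: m_def)
  have F0: "m \<le> F 0 x" if "0 < x" for x
  proof -
    have "heat (t 0) sgn b \<le> heat (t 0) sgn (x + b)"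
      unfolding heat_sgn_eq[OF t(1), of b, OF order_trans[OF zero_le_one b(1)]]
      using b that t[of 0]
    proof (subst heat_sgn_eq, simp, simp, intro integral_mono)
      show "integrable lborel (\<lambda>v. heat_kernel (t 0) v * indicator {-b..b} v)"
        using heat_kernel_integrable[OF t(1)[of 0], of "indicator {-b..b}" 1 0] by (simp split: split_indicator)
      show "integrable lborel (\<lambda>v. heat_kernel (t 0) v * indicator {-(x+b)..x+b} v)"
        using heat_kernel_integrable[OF t(1)[of 0], of "indicator {-(x+b)..x+b}" 1 0] by (simp split: split_indicator)
      show "heat_kernel (t 0) v * indicator {-b..b} v \<le> heat_kernel (t 0) v * indicator {-(x+b)..x+b} v" for v
        using that by (auto split: split_indicator simp: normal_density_nonneg)
    qed
    moreover have "m \<le> F 0 0" using F_lower[of 0 0] b by (simp add: m_def)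
    ultimately show ?thesis by (simp add: F_def)
  qed
  have main: "(killed ^^ k) (indicator {0<..}) x \<le> ennreal (F k x / m) * indicator {0<..} x" for k x
  proof (induction k arbitrary: x)
    case 0
    have "1 \<le> ennreal (F 0 x / m)" if "0 < x"
      using ennreal_leI[of 1 "F 0 x / m"] F0[OF that] m by simp
    then show ?case by (auto split: split_indicator)
  next
    case (Suc k)
    show ?case
    proof (cases "0 < x")
      case True
      have "(killed ^^ Suc k) (indicator {0<..}) x = killed ((killed ^^ k) (indicator {0<..})) x" by simp
      also have "\<dots> \<le> killed (\<lambda>y. ennreal (F k y / m) * indicator {0<..} y) x"
        by (intro killed_mono Suc.IH)
      also have "\<dots> = (\<integral>\<^sup>+y. ennreal (?p (y - x) * F k y * indicator {0<..} y / m) \<partial>lborel)"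
        unfolding killed_def using True m F_nonneg[of _ k] b
        by (intro nn_integral_cong) (auto split: split_indicator simp: ennreal_mult[symmetric] pn)
      also have "\<dots> = ennreal (\<integral>y. ?p (y - x) * F k y * indicator {0<..} y / m \<partial>lborel)"
      proof (rule nn_integral_eq_integral)
        have iF: "integrable lborel (\<lambda>y. ?p (y - x) * F k y)"
          using heat_kernel_integrable[of 1 "F k" 1 x] F_bound by simp
        from integrable_real_mult_indicator[OF _ this, of "{0<..}"]
        show "integrable lborel (\<lambda>y. ?p (y - x) * F k y * indicator {0<..} y / m)" by simp
        show "AE y in lborel. 0 \<le> ?p (y - x) * F k y * indicator {0<..} y / m"
          using F_nonneg[of _ k] b m by (intro AE_I2) (auto split: split_indicator simp: pn)
      qed
      also have "\<dots> \<le> ennreal (F (Suc k) x / m)"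
        using step[of x k] True m by (intro ennreal_leI) (simp add: divide_right_mono)
      finally show ?thesis using True by simp
    qed (simp add: killed_outside)
  qed
  define C where "C = 2 * (1 + b) / m"
  have C: "0 < C" using b m by (simp add: C_def)
  have "(killed ^^ k) (indicator {0<..}) x \<le> ennreal (C * (1 + x) / sqrt (real (Suc k))) * indicator {0<..} x" for k x
  proof (cases "0 < x")
    case True
    have "real (Suc k) \<le> 2 * pi * t k"
    proof -
      have "1 \<le> b\<^sup>2" using b by simp
      then have "real (Suc k) \<le> t k" by (simp add: t_def)
      also have "\<dots> \<le> 2 * pi * t k" using t[of k] pi_gt3 by simp
      finally show ?thesis .
    qed
    then have "\<sigma> k \<le> 2 / sqrt (real (Suc k))"
      unfolding \<sigma>_def using t[of k] by (intro divide_left_mono mult_pos_pos) auto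
    moreover have "x + b \<le> (1 + b) * (1 + x)" using b True by (simp add: algebra_simps)
    ultimately have "\<sigma> k * (x + b) \<le> 2 / sqrt (real (Suc k)) * ((1 + b) * (1 + x))"
      using True b \<sigma>[of k] by (intro mult_mono) auto
    then have "F k x / m \<le> 2 / sqrt (real (Suc k)) * ((1 + b) * (1 + x)) / m"
      using F_upper[of x k] True b m by (intro divide_right_mono) auto
    also have "\<dots> = C * (1 + x) / sqrt (real (Suc k))"
      unfolding C_def by (simp only: times_divide_eq_left times_divide_eq_right divide_divide_eq_left ac_simps)
    finally show ?thesis
      using main[of k x] by (meson ennreal_leI mult_right_mono order_trans zero_le)
  next
    case False
    then show ?thesis using main[of k x] by simp
  qed
  with C show ?thesis by (rule that)
qed

text \<open>Three stages of length about \<open>k / 3\<close>, each contributing a factor \<open>k powr (-1/2)\<close>: survival from \<open>x\<close>, the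
  sup bound of the heat kernel, and survival for the dual walk.\<close>
lemma killed_bound:
  obtains C :: real where "0 < C"
    and "\<And>g k x. g \<in> borel_measurable borel \<Longrightarrow> 0 < k \<Longrightarrow> 0 < x \<Longrightarrow> (killed ^^ k) g x
      \<le> ennreal (C * (1 + x) / real k powr (3/2)) * (\<integral>\<^sup>+y. ennreal (1 + y) * indicator {0<..} y * g y \<partial>lborel)"
proof -
  obtain C where C: "0 < C"
    and surv: "\<And>k x. (killed ^^ k) (indicator {0<..}) x \<le> ennreal (C * (1 + x) / sqrt (real (Suc k))) * indicator {0<..} x"
    by (rule killed_survival) blast
  have "(killed ^^ k) g x \<le> ennreal (C * (1 + x) * (C * 3 powr (3/2)) / real k powr (3/2)) *
      (\<integral>\<^sup>+y. ennreal (1 + y) * indicator {0<..} y * g y \<partial>lborel)"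
    if [measurable]: "g \<in> borel_measurable borel" and k: "0 < k" and x: "0 < x" for g k x
  proof -
    let ?I = "\<integral>\<^sup>+y. ennreal (1 + y) * indicator {0<..} y * g y \<partial>lborel"
    \<comment> \<open>The offset in \<open>(k - 1) div 3\<close> keeps the middle stage nonempty,
      also for \<open>k = 1\<close>; survival is stated with \<open>Suc k\<close>, so
      \<open>i = 0\<close> is harmless.\<close>
    define i where "i = (k - 1) div 3"
    define j where "j = k - 2 * i"
    have ij: "k = i + (j + i)" "0 < j" "k \<le> 3 * Suc i" "k \<le> 3 * j" using k unfolding j_def i_def by auto
    define s where "s = sqrt (real k / 3)"
    have s: "0 < s" using k by (simp add: s_def)
    have si: "s \<le> sqrt (real (Suc i))" and sj: "s \<le> sqrt (real j)"
      unfolding s_def using ij by (simp_all add: field_simps)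
    let ?G = "(killed ^^ i) g"
    have "(\<integral>\<^sup>+y. indicator {0<..} y * ?G y \<partial>lborel) = (\<integral>\<^sup>+y. (killed ^^ i) (indicator {0<..}) y * g y \<partial>lborel)"
      by (rule killed_pow_dual) auto
    also have "\<dots> \<le> (\<integral>\<^sup>+y. ennreal (C / s) * (ennreal (1 + y) * indicator {0<..} y * g y) \<partial>lborel)"
    proof (rule nn_integral_mono)
      fix y :: real
      have "(killed ^^ i) (indicator {0<..}) y \<le> ennreal (C / s) * (ennreal (1 + y) * indicator {0<..} y)"
      proof (cases "0 < y")
        case True
        have "C * (1 + y) / sqrt (real (Suc i)) \<le> C * (1 + y) / s"
          using si s C True by (intro divide_left_mono) auto
        then have "(killed ^^ i) (indicator {0<..}) y \<le> ennreal (C * (1 + y) / s)"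
          using order_trans[OF surv[of i y]] True by (simp add: ennreal_leI)
        also have "\<dots> = ennreal (C / s) * ennreal (1 + y)"
          using True C s by (subst ennreal_mult[symmetric]) auto
        finally show ?thesis using True by simp
      next
        case False
        then show ?thesis using surv[of i y] by simp
      qed
      then show "(killed ^^ i) (indicator {0<..}) y * g y \<le> ennreal (C / s) * (ennreal (1 + y) * indicator {0<..} y * g y)"
        by (simp add: mult.assoc[symmetric] mult_right_mono)
    qed
    also have "\<dots> = ennreal (C / s) * ?I" by (rule nn_integral_cmult) measurable
    finally have mass: "(\<integral>\<^sup>+y. indicator {0<..} y * ?G y \<partial>lborel) \<le> ennreal (C / s) * ?I" .
    have sup: "(killed ^^ j) ?G y \<le> (ennreal (1 / s) * (ennreal (C / s) * ?I)) * indicator {0<..} y" for y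
    proof (cases "0 < y")
      case True
      have "(killed ^^ j) ?G y \<le> ennreal (1 / sqrt (real j)) * (\<integral>\<^sup>+y. indicator {0<..} y * ?G y \<partial>lborel)"
        by (rule killed_pow_sup) (use ij in auto)
      also have "\<dots> \<le> ennreal (1 / s) * (ennreal (C / s) * ?I)"
        by (intro mult_mono mass ennreal_leI divide_left_mono sj) (use s ij in auto)
      finally show ?thesis using True by simp
    next
      case False
      then show ?thesis using ij(2) by (cases j) (auto simp: killed_outside)
    qed
    have "(killed ^^ k) g x = (killed ^^ i) ((killed ^^ j) ?G) x"
      using fun_cong[OF arg_cong[OF ij(1), of "\<lambda>k. (killed ^^ k) g"], of x] by (simp add: funpow_add)
    also have "\<dots> \<le> (killed ^^ i) (\<lambda>y. (ennreal (1 / s) * (ennreal (C / s) * ?I)) * indicator {0<..} y) x"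
      by (rule killed_pow_mono) (rule sup)
    also have "\<dots> = (ennreal (1 / s) * (ennreal (C / s) * ?I)) * (killed ^^ i) (indicator {0<..}) x"
      by (rule killed_pow_cmult) simp
    also have "\<dots> \<le> (ennreal (1 / s) * (ennreal (C / s) * ?I)) * ennreal (C * (1 + x) / s)"
    proof (rule mult_left_mono)
      have "C * (1 + x) / sqrt (real (Suc i)) \<le> C * (1 + x) / s"
        using si s C x by (intro divide_left_mono) auto
      then show "(killed ^^ i) (indicator {0<..}) x \<le> ennreal (C * (1 + x) / s)"
        using surv[of i x] x by (auto intro: order_trans ennreal_leI)
    qed simp
    also have "\<dots> = ennreal (1 / s * (C / s) * (C * (1 + x) / s)) * ?I"
    proof -
      have "ennreal (1 / s * (C / s) * (C * (1 + x) / s)) = ennreal (1 / s) * ennreal (C / s) * ennreal (C * (1 + x) / s)"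
        using s C x by (simp only: ennreal_mult divide_nonneg_pos mult_nonneg_nonneg less_imp_le zero_le_one add_nonneg_nonneg)
      then show ?thesis by (simp only: ac_simps)
    qed
    also have "1 / s * (C / s) * (C * (1 + x) / s) = C * (1 + x) * (C * 3 powr (3/2)) / real k powr (3/2)"
    proof -
      have "s = (real k / 3) powr (1/2)" using k by (simp add: s_def powr_half_sqrt)
      then have "s ^ 3 = (real k / 3) powr (3/2)"
        using k by (simp add: powr_realpow[symmetric] powr_powr)
      also have "\<dots> = real k powr (3/2) / 3 powr (3/2)" by (simp add: powr_divide)
      finally have "s * s * s = real k powr (3/2) / 3 powr (3/2)" by (simp add: power3_eq_cube)
      moreover have "1 / s * (C / s) * (C * (1 + x) / s) = C * (1 + x) * C / (s * s * s)" by simp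
      ultimately show ?thesis by (simp only: divide_divide_eq_right mult.assoc)
    qed
    finally show ?thesis .
  qed
  moreover have "C * (1 + x) * (C * 3 powr (3/2)) = (C * (C * 3 powr (3/2))) * (1 + x)" for x
    by (simp only: ac_simps)
  ultimately have *: "(killed ^^ k) g x \<le> ennreal ((C * (C * 3 powr (3/2))) * (1 + x) / real k powr (3/2)) *
      (\<integral>\<^sup>+y. ennreal (1 + y) * indicator {0<..} y * g y \<partial>lborel)"
    if "g \<in> borel_measurable borel" "0 < k" "0 < x" for g k x
    using that by (simp only:)
  show ?thesis by (rule that[OF _ *]) (use C in auto)
qed

section \<open>Upper bound for the maximum of the field\<close>

lemma c0_square: "c0\<^sup>2 = 2 * ln 2"
  by (simp add: c0_def)

lemma c0_ge_1: "1 \<le> c0" and c0_less: "c0 < 3/2"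
proof -
  have "1 \<le> c0\<^sup>2" using ln2_ge_two_thirds by (simp add: c0_square)
  then show "1 \<le> c0" using abs_le_square_iff[of 1 c0] by (simp add: c0_def)
  have "c0\<^sup>2 < (3/2)\<^sup>2" unfolding c0_square using ln_2_less_1 by (simp add: power2_eq_square)
  then show "c0 < 3/2" by (rule power2_less_imp_less) simp
qed

lemma c0_pos: "0 < c0" using c0_ge_1 by simp

text \<open>The probability that the maximum of the field exceeds \<open>y + c0 n\<close>, multiplied by \<open>exp (c0 y)\<close>:
  to first order this solves the heat equation.\<close>
definition front :: "nat \<Rightarrow> real \<Rightarrow> real" where
  "front n y = exp (c0 * y) * (1 - wall n (y + c0 * real n))"

lemma front_measurable [measurable]: "front n \<in> borel_measurable borel"
  unfolding front_def by measurable

lemma front_nonneg [simp]: "0 \<le> front n y"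
  by (simp add: front_def)

lemma front_le_exp: "front n y \<le> exp (c0 * y)"
  by (simp add: front_def mult_left_le)

text \<open>Tilting by \<open>- c0\<close> removes the drift of the moving frame and costs
  \<open>exp (- c0\<^sup>2 / 2) = 1/2\<close>, which the two children compensate in the next step.
  This is what makes \<open>c0\<close> the critical speed.\<close>

lemma gconv_front:
  "1 - gconv (wall n) (y + c0 * real (Suc n)) = exp (- c0 * y) * gconv (front n) y / 2"
proof -
  have e: "1 - wall n (y + c0 * real (Suc n) + z)
      = exp (- c0 * y - c0\<^sup>2 / 2) * (exp ((- c0) * z - (- c0)\<^sup>2 / 2) * front n (y + (c0 + z)))" for z
    by (simp add: front_def mult_exp_exp power2_eq_square algebra_simps)
  have "1 - gconv (wall n) (y + c0 * real (Suc n))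
      = (\<integral>z. 1 - wall n (y + c0 * real (Suc n) + z) \<partial>std_normal_distribution)"
    using gauss.prob_space by (simp add: gconv_def)
  also have "\<dots> = exp (- c0 * y - c0\<^sup>2 / 2) *
      (\<integral>z. exp ((- c0) * z - (- c0)\<^sup>2 / 2) * front n (y + (c0 + z)) \<partial>std_normal_distribution)"
    unfolding e by (rule integral_mult_right_zero)
  also have "(\<integral>z. exp ((- c0) * z - (- c0)\<^sup>2 / 2) * front n (y + (c0 + z)) \<partial>std_normal_distribution)
      = gconv (front n) y"
    by (subst gauss_tilt) (auto simp: gconv_def)
  also have "exp (- c0 * y - c0\<^sup>2 / 2) = exp (- c0 * y) / 2"
    by (simp add: c0_square exp_diff)
  finally show ?thesis by simp
qed

text \<open>From 1 - q^2 = 2 (1 - q) - (1 - q)^2. The union bound over the two children is a pure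
  heat step; the loss is quadratic, with a weight \<open>exp (- c0 * y)\<close> that decays to the
  right.\<close>

lemma front_Suc:
  "front (Suc n) y = gconv (front n) y - exp (- c0 * y) * (gconv (front n) y)\<^sup>2 / 4"
proof -
  let ?V = "gconv (front n) y" and ?q = "gconv (wall n) (y + c0 * real (Suc n))"
  have q: "1 - ?q = exp (- c0 * y) * ?V / 2" by (rule gconv_front)
  have "front (Suc n) y = exp (c0 * y) * (2 * (1 - ?q) - (1 - ?q)\<^sup>2)"
    by (simp add: front_def power2_eq_square algebra_simps)
  also have "\<dots> = (exp (c0 * y) * exp (- c0 * y)) * (?V - exp (- c0 * y) * ?V\<^sup>2 / 4)"
    unfolding q by (simp add: power2_eq_square algebra_simps)
  also have "exp (c0 * y) * exp (- c0 * y) = 1" by (simp add: mult_exp_exp)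
  finally show ?thesis by simp
qed

lemma gconv_front_nonneg [simp]: "0 \<le> gconv (front n) y"
  by (rule gconv_nonneg) simp

lemma front_Suc_le: "front (Suc n) y \<le> gconv (front n) y"
  unfolding front_Suc by simp

lemma gconv_front_le_exp: "gconv (front n) y \<le> 2 * exp (c0 * y)"
proof -
  have "exp (- c0 * y) * gconv (front n) y / 2 \<le> 1"
    using gconv_front[of n y] gconv_wall_nonneg[of n "y + c0 * real (Suc n)"] by linarith
  then have "exp (c0 * y) * (exp (- c0 * y) * gconv (front n) y) \<le> exp (c0 * y) * 2"
    by (intro mult_left_mono) auto
  then show ?thesis by (simp add: mult.assoc[symmetric] mult_exp_exp)
qed

lemma front_le_1: "front n y \<le> 1"
proof (induction n arbitrary: y)
  case 0
  then show ?case using c0_pos by (auto simp: front_def mult_nonneg_nonpos)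
next
  case (Suc n)
  then have "gconv (front n) y \<le> 1" by (intro gconv_le) auto
  then show ?case using front_Suc_le order_trans by blast
qed

lemma front_integrable [simp]: "integrable std_normal_distribution (\<lambda>z. front n (y + z))"
  by (rule gauss_integrable_bounded[where B=1]) (auto simp: front_le_1)

lemma nn_integral_gauss:
  assumes [measurable]: "f \<in> borel_measurable borel"
  shows "(\<integral>\<^sup>+z. f (x + z) \<partial>std_normal_distribution) = (\<integral>\<^sup>+y. ennreal (std_normal_density (y - x)) * f y \<partial>lborel)"
proof -
  have "(\<integral>\<^sup>+z. f (x + z) \<partial>std_normal_distribution)
      = (\<integral>\<^sup>+z. ennreal (std_normal_density z) * f (x + z) \<partial>lborel)"
    by (subst nn_integral_density) auto
  also have "\<dots> = (\<integral>\<^sup>+y. ennreal (std_normal_density (y - x)) * f y \<partial>lborel)"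
    by (subst (2) nn_integral_real_affine[of _ 1 x]) auto
  finally show ?thesis .
qed

lemma ennreal_integral_le_nn_integral:
  assumes "integrable M f"
  shows "ennreal (\<integral>x. f x \<partial>M) \<le> (\<integral>\<^sup>+x. ennreal (f x) \<partial>M)"
proof -
  have "(\<integral>x. f x \<partial>M) \<le> (\<integral>x. max 0 (f x) \<partial>M)"
    using assms by (intro integral_mono) auto
  then have "ennreal (\<integral>x. f x \<partial>M) \<le> ennreal (\<integral>x. max 0 (f x) \<partial>M)" by (rule ennreal_leI)
  also have "\<dots> = (\<integral>\<^sup>+x. ennreal (max 0 (f x)) \<partial>M)"
    using assms by (subst nn_integral_eq_integral) auto
  also have "\<dots> = (\<integral>\<^sup>+x. ennreal (f x) \<partial>M)"
    by (intro nn_integral_cong) (simp add: max_def ennreal_neg)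
  finally show ?thesis .
qed

text \<open>The constant \<open>exp (c0 * a)\<close> pays for everything that crosses the barrier \<open>a\<close>.\<close>
lemma front_le_killed:
  assumes "0 < x"
  shows "ennreal (front (m + k) (a + x) - exp (c0 * a)) \<le> (killed ^^ k) (\<lambda>x. ennreal (front m (a + x))) x"
  using assms
proof (induction k arbitrary: x)
  case 0
  then show ?case by (auto intro!: ennreal_leI)
next
  case (Suc k)
  let ?s = "exp (c0 * a)"
  let ?f = "\<lambda>y. ennreal (front (m + k) (a + y) - ?s)"
  have "ennreal (front (m + Suc k) (a + x) - ?s)
      \<le> ennreal (\<integral>z. front (m + k) (a + x + z) - ?s \<partial>std_normal_distribution)"
    using front_Suc_le[of "m + k" "a + x"] gauss.prob_space
    by (intro ennreal_leI) (simp add: gconv_def)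
  also have "\<dots> \<le> (\<integral>\<^sup>+z. ennreal (front (m + k) (a + x + z) - ?s) \<partial>std_normal_distribution)"
    by (rule ennreal_integral_le_nn_integral) simp
  also have "\<dots> = (\<integral>\<^sup>+y. ennreal (std_normal_density (y - x)) * ?f y \<partial>lborel)"
    using nn_integral_gauss[of ?f x] by (simp add: add.assoc)
  also have "\<dots> \<le> killed ((killed ^^ k) (\<lambda>x. ennreal (front m (a + x)))) x"
    unfolding killed_def[of "(killed ^^ k) _"]
  proof (rule nn_integral_mono)
    fix y
    show "ennreal (std_normal_density (y - x)) * ?f y
      \<le> ennreal (std_normal_density (y - x)) * indicator {0<..} x * indicator {0<..} y *
          (killed ^^ k) (\<lambda>x. ennreal (front m (a + x))) y"
    proof (cases "0 < y")
      case True
      then show ?thesis using Suc by (auto intro!: mult_left_mono)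
    next
      case False
      then have "c0 * (a + y) \<le> c0 * a" using c0_pos by simp
      then have "front (m + k) (a + y) \<le> ?s"
        using front_le_exp[of "m + k" "a + y"] order_trans exp_le_cancel_iff by blast
      then show ?thesis by (simp add: ennreal_neg)
    qed
  qed
  finally show ?case by simp
qed

text \<open>The level \<open>a\<close> stays free. At \<open>a = - lag n\<close> the barrier cost
  has the same order \<open>n powr (-3/2)\<close> as the killed walk, so everything depends on the
  weighted mass \<open>A\<close> of the profile at the restart time \<open>m\<close>.\<close>

lemma front_barrier_bound:
  obtains C where "0 < C" and
    "\<And>m k a x A. 0 < k \<Longrightarrow> 0 < x \<Longrightarrow> 0 \<le> A \<Longrightarrow>
      (\<integral>\<^sup>+y. ennreal (1 + y) * indicator {0<..} y * ennreal (front m (a + y)) \<partial>lborel) \<le> ennreal A \<Longrightarrow>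
      front (m + k) (a + x) \<le> exp (c0 * a) + C * (1 + x) / real k powr (3/2) * A"
proof -
  obtain C where C: "0 < C" and kb: "\<And>g k x. g \<in> borel_measurable borel \<Longrightarrow> 0 < k \<Longrightarrow> 0 < x \<Longrightarrow> (killed ^^ k) g x
      \<le> ennreal (C * (1 + x) / real k powr (3/2)) * (\<integral>\<^sup>+y. ennreal (1 + y) * indicator {0<..} y * g y \<partial>lborel)"
    by (rule killed_bound) blast
  show ?thesis
  proof (rule that[OF C])
    fix m k :: nat and a x A :: real
    assume k: "0 < k" and x: "0 < x" and A: "0 \<le> A"
      "(\<integral>\<^sup>+y. ennreal (1 + y) * indicator {0<..} y * ennreal (front m (a + y)) \<partial>lborel) \<le> ennreal A"
    have "ennreal (front (m + k) (a + x) - exp (c0 * a)) \<le> (killed ^^ k) (\<lambda>x. ennreal (front m (a + x))) x"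
      by (rule front_le_killed[OF x])
    also have "\<dots> \<le> ennreal (C * (1 + x) / real k powr (3/2)) *
        (\<integral>\<^sup>+y. ennreal (1 + y) * indicator {0<..} y * ennreal (front m (a + y)) \<partial>lborel)"
      by (rule kb) (use k x in auto)
    also have "\<dots> \<le> ennreal (C * (1 + x) / real k powr (3/2)) * ennreal A"
      by (rule mult_left_mono[OF A(2)]) simp
    also have "\<dots> = ennreal (C * (1 + x) / real k powr (3/2) * A)"
      using C x A by (subst ennreal_mult) auto
    finally show "front (m + k) (a + x) \<le> exp (c0 * a) + C * (1 + x) / real k powr (3/2) * A"
      using C x A by (subst (asm) ennreal_le_iff) auto
  qed
qed

section \<open>The logarithmic correction and upper bounds for the front\<close>

definition lag :: "nat \<Rightarrow> real" where
  "lag n = 3 / (2 * c0) * ln (real n)"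

lemma m_seq_lag: "m_seq n = c0 * real n - lag n"
  by (simp add: m_seq_def lag_def inverse_eq_divide)

lemma lag_nonneg: "1 \<le> n \<Longrightarrow> 0 \<le> lag n"
  using c0_pos by (simp add: lag_def)

lemma exp_lag: "1 \<le> n \<Longrightarrow> exp (- c0 * lag n) = real n powr (- 3/2)"
  using c0_pos by (simp add: lag_def powr_def)

text \<open>The exponent 1/12 is chosen so that the cube of \<open>1 + lag n\<close> costs at most
  \<open>n powr (1/4)\<close>, which turns -3/2 into the still summable -5/4.\<close>

lemma lag_growth:
  obtains C where "1 \<le> C" and "\<And>n. 1 \<le> n \<Longrightarrow> 1 + lag n \<le> C * real n powr (1/12)"
proof
  let ?C = "1 + 3 / (2 * c0) * 12"
  show "1 \<le> ?C" using c0_pos by simp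
  fix n :: nat assume n: "1 \<le> n"
  have "ln (real n) \<le> real n powr (1/12) / (1/12)" by (rule ln_powr_bound) (use n in auto)
  then have "lag n \<le> 3 / (2 * c0) * 12 * real n powr (1/12)"
    unfolding lag_def mult.assoc using c0_pos by (intro mult_left_mono) auto
  moreover have "1 \<le> real n powr (1/12)" using n by (simp add: ge_one_powr_ge_zero)
  ultimately show "1 + lag n \<le> ?C * real n powr (1/12)" by (simp add: algebra_simps)
qed

lemma lag_cube_growth:
  obtains C where "1 \<le> C" and "\<And>n. 1 \<le> n \<Longrightarrow> (1 + lag n) ^ 3 \<le> C * real n powr (1/4)"
    and "\<And>n. 1 \<le> n \<Longrightarrow> 1 + lag n \<le> C * sqrt (real n)"
proof -
  obtain C where C: "1 \<le> C" "\<And>n. 1 \<le> n \<Longrightarrow> 1 + lag n \<le> C * real n powr (1/12)"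
    by (rule lag_growth) blast
  show ?thesis
  proof
    show "1 \<le> C ^ 3" using C(1) by simp
    fix n :: nat assume n: "1 \<le> n"
    have "(1 + lag n) ^ 3 \<le> (C * real n powr (1/12)) ^ 3"
      using C(2)[OF n] lag_nonneg[OF n] by (intro power_mono) auto
    also have "\<dots> = C ^ 3 * real n powr (1/4)"
      using n by (simp add: power_mult_distrib powr_power)
    finally show "(1 + lag n) ^ 3 \<le> C ^ 3 * real n powr (1/4)" .
    have "real n powr (1/12) \<le> sqrt (real n)"
      using n by (simp add: powr_half_sqrt[symmetric] powr_mono)
    then have "C * real n powr (1/12) \<le> C ^ 3 * sqrt (real n)"
      using C(1) by (intro mult_mono self_le_power) auto
    then show "1 + lag n \<le> C ^ 3 * sqrt (real n)" using C(2)[OF n] by linarith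
  qed
qed

text \<open>The barrier bound started at time 0 with \<open>a = - lag n\<close>. The profile
  \<open>front 0\<close> vanishes on the right half-line, so its weighted mass beyond the barrier is
  at most \<open>(1 + lag n)\<^sup>2\<close>; a further factor \<open>1 + lag n\<close> comes from
  measuring \<open>1 + x\<close> by \<open>1 + \<bar>y\<bar>\<close>. The exponent below -1 is what
  later sums over generations need.\<close>

lemma front_rough_bound:
  obtains C where "0 < C" and "\<And>n y. 1 \<le> n \<Longrightarrow> front n y \<le> C * (1 + \<bar>y\<bar>) * real n powr (- 5/4)"
proof -
  obtain C where C: "0 < C" and fb:
    "\<And>m k a x A. 0 < k \<Longrightarrow> 0 < x \<Longrightarrow> 0 \<le> A \<Longrightarrow>
      (\<integral>\<^sup>+y. ennreal (1 + y) * indicator {0<..} y * ennreal (front m (a + y)) \<partial>lborel) \<le> ennreal A \<Longrightarrow>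
      front (m + k) (a + x) \<le> exp (c0 * a) + C * (1 + x) / real k powr (3/2) * A"
    by (rule front_barrier_bound) blast
  obtain D where D: "1 \<le> D" and lag3: "\<And>n. 1 \<le> n \<Longrightarrow> (1 + lag n) ^ 3 \<le> D * real n powr (1/4)"
    by (rule lag_cube_growth) blast
  have "front n y \<le> (1 + C) * D * (1 + \<bar>y\<bar>) * real n powr (- 5/4)" if n: "1 \<le> n" for n y
  proof -
    let ?l = "lag n"
    have l: "0 \<le> ?l" by (rule lag_nonneg[OF n])
    have e: "exp (c0 * (- ?l)) = real n powr (- 3/2)" using exp_lag[OF n] by simp
    have p: "real n powr (1/4) * real n powr (- 3/2) = real n powr (- 5/4)"
      by (simp add: powr_add[symmetric])
    have l3: "(1 + ?l) ^ 3 * real n powr (- 3/2) \<le> D * real n powr (- 5/4)"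
      using mult_right_mono[OF lag3[OF n] powr_ge_zero[of "real n" "- 3/2"]] by (simp only: mult.assoc p)
    have l31: "1 \<le> (1 + ?l) ^ 3" using l by simp
    have pp: "0 \<le> real n powr (- 3/2)" by simp
    have "front n y \<le> (1 + C) * (1 + \<bar>y\<bar>) * ((1 + ?l) ^ 3 * real n powr (- 3/2))"
    proof (cases "- ?l < y")
      case False
      have "front n y \<le> exp (c0 * y)" by (rule front_le_exp)
      also have "\<dots> \<le> exp (c0 * (- ?l))"
        using False c0_pos by (intro iffD2[OF exp_le_cancel_iff] mult_left_mono) auto
      also have "\<dots> = 1 * (1 * real n powr (- 3/2))" unfolding e by simp
      also have "\<dots> \<le> (1 + C) * (1 + \<bar>y\<bar>) * ((1 + ?l) ^ 3 * real n powr (- 3/2))"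
        using C l l31 mult_mono[of 1 "1 + C" 1 "1 + \<bar>y\<bar>"] by (intro mult_mono) auto
      finally show ?thesis .
    next
      case True
      define x where "x = y + ?l"
      have x: "0 < x" "y = - ?l + x" using True by (auto simp: x_def)
      have "(\<integral>\<^sup>+y. ennreal (1 + y) * indicator {0<..} y * ennreal (front 0 (- ?l + y)) \<partial>lborel)
          \<le> (\<integral>\<^sup>+y. ennreal (1 + ?l) * indicator {0..?l} y \<partial>lborel)"
      proof (rule nn_integral_mono)
        fix y :: real
        have "ennreal (1 + y) * ennreal (front 0 (- ?l + y)) \<le> ennreal (1 + ?l)" if "0 < y" "y \<le> ?l"
        proof -
          have "(1 + y) * front 0 (- ?l + y) \<le> (1 + ?l) * 1"
            using that l front_le_1 by (intro mult_mono) auto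
          then have "ennreal ((1 + y) * front 0 (- ?l + y)) \<le> ennreal (1 + ?l)"
            by (intro ennreal_leI) simp
          then show ?thesis using that by (subst ennreal_mult[symmetric]) (auto simp del: ennreal_plus)
        qed
        moreover have "front 0 (- ?l + y) = 0" if "?l < y" using that by (simp add: front_def)
        ultimately show "ennreal (1 + y) * indicator {0<..} y * ennreal (front 0 (- ?l + y))
            \<le> ennreal (1 + ?l) * indicator {0..?l} y"
          by (cases "0 < y"; cases "y \<le> ?l") auto
      qed
      also have "\<dots> = ennreal (1 + ?l) * ennreal ?l" using l by (subst nn_integral_cmult_indicator) auto
      also have "\<dots> \<le> ennreal ((1 + ?l)\<^sup>2)"
        using l by (subst ennreal_mult[symmetric]) (auto simp: power2_eq_square intro!: ennreal_leI mult_left_mono)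
      finally have "front (0 + n) (- ?l + x) \<le> exp (c0 * (- ?l)) + C * (1 + x) / real n powr (3/2) * (1 + ?l)\<^sup>2"
        using n x by (intro fb) auto
      then have "front n y \<le> real n powr (- 3/2) * (1 + C * ((1 + x) * (1 + ?l)\<^sup>2))"
      proof -
        have "C * (1 + x) / real n powr (3/2) * (1 + ?l)\<^sup>2 = real n powr (- 3/2) * (C * ((1 + x) * (1 + ?l)\<^sup>2))"
          by (simp add: powr_minus_divide)
        moreover assume "front (0 + n) (- ?l + x) \<le> exp (c0 * (- ?l)) + C * (1 + x) / real n powr (3/2) * (1 + ?l)\<^sup>2"
        ultimately show ?thesis unfolding e x(2)[symmetric] by (simp add: distrib_left)
      qed
      also have "\<dots> \<le> real n powr (- 3/2) * ((1 + C) * ((1 + \<bar>y\<bar>) * (1 + ?l) ^ 3))"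
      proof (intro mult_left_mono pp)
        have "1 + x \<le> (1 + \<bar>y\<bar>) * (1 + ?l)"
        proof -
          have "0 \<le> \<bar>y\<bar> * ?l" using l by simp
          moreover have "y \<le> \<bar>y\<bar>" by simp
          moreover have "(1 + \<bar>y\<bar>) * (1 + ?l) = 1 + \<bar>y\<bar> + ?l + \<bar>y\<bar> * ?l" by (simp add: algebra_simps)
          ultimately show ?thesis unfolding x_def by linarith
        qed
        then have "(1 + x) * (1 + ?l)\<^sup>2 \<le> (1 + \<bar>y\<bar>) * (1 + ?l) * (1 + ?l)\<^sup>2"
          by (intro mult_right_mono) auto
        also have "\<dots> = (1 + \<bar>y\<bar>) * (1 + ?l) ^ 3" by (simp add: power2_eq_square power3_eq_cube)
        finally have "C * ((1 + x) * (1 + ?l)\<^sup>2) \<le> C * ((1 + \<bar>y\<bar>) * (1 + ?l) ^ 3)"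
          using C by (intro mult_left_mono) auto
        moreover have "1 \<le> (1 + \<bar>y\<bar>) * (1 + ?l) ^ 3"
          using mult_mono[of 1 "1 + \<bar>y\<bar>" 1 "(1 + ?l) ^ 3"] l31 by simp
        ultimately show "1 + C * ((1 + x) * (1 + ?l)\<^sup>2) \<le> (1 + C) * ((1 + \<bar>y\<bar>) * (1 + ?l) ^ 3)"
          by (simp add: distrib_right)
      qed
      finally show ?thesis by (simp only: ac_simps)
    qed
    also have "\<dots> \<le> (1 + C) * (1 + \<bar>y\<bar>) * (D * real n powr (- 5/4))"
      using C l3 by (intro mult_left_mono) auto
    finally show ?thesis by (simp only: ac_simps)
  qed
  then show ?thesis using that[of "(1 + C) * D"] C D by auto
qed

lemma nn_integral_std_normal_density_abs:
  "(\<integral>\<^sup>+y. ennreal (std_normal_density y * (1 + \<bar>y\<bar>)) \<partial>lborel) \<le> 2"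
proof -
  have "(\<integral>\<^sup>+y. ennreal (std_normal_density y * (1 + \<bar>y\<bar>)) \<partial>lborel)
      = (\<integral>\<^sup>+y. ennreal (1 + \<bar>y\<bar>) \<partial>std_normal_distribution)"
    by (subst nn_integral_density) (auto simp: ennreal_mult normal_density_nonneg)
  also have "\<dots> = ennreal (\<integral>y. 1 + \<bar>y\<bar> \<partial>std_normal_distribution)"
    by (rule nn_integral_eq_integral) auto
  also have "\<dots> \<le> ennreal 2"
    using gauss_integral_abs_le gauss.prob_space by (intro ennreal_leI) simp
  finally show ?thesis by simp
qed

text \<open>A centred step changes the mean of the positive part only by crossing the kink at 0. The
  crossing is bounded by an exponential with tilt \<open>\<bar>v\<bar> + 1\<close>, whose Gaussian
  mean is of the order of the density at \<open>v\<close>.\<close>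

lemma gauss_positive_part:
  "(\<integral>\<^sup>+y. ennreal (std_normal_density (y - v)) * ennreal (max 0 y) \<partial>lborel)
    \<le> ennreal (max 0 v + exp 1 * sqrt (2 * pi) * std_normal_density v)"
proof -
  have pos_le_exp: "max 0 u \<le> exp ((a + 1) * u)" if "0 \<le> a" for a u :: real
  proof (cases "0 \<le> u")
    case True
    then have "u \<le> (a + 1) * u" using that by (simp add: algebra_simps)
    then show ?thesis using True exp_ge_add_one_self[of "(a + 1) * u"] by linarith
  qed simp
  let ?a = "\<bar>v\<bar>"
  \<comment> \<open>The sign of the step that leads from \<open>v\<close> towards the kink.\<close>
  define s :: real where "s = (if 0 \<le> v then -1 else 1)"
  have s: "s\<^sup>2 = 1" "s * v = - ?a" by (auto simp: s_def)
  have pw: "max 0 (v + z) \<le> max 0 v + (if 0 \<le> v then z else 0) + exp ((?a + 1) * (s * z - ?a))" for z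
  proof (cases "0 \<le> v")
    case True
    have "max 0 (v + z) = v + z + max 0 (- z - v)" by (simp add: max_def)
    also have "\<dots> \<le> v + z + exp ((v + 1) * (- z - v))" using pos_le_exp[OF True] by simp
    finally show ?thesis using True by (simp add: s_def)
  next
    case False
    then have "max 0 (v + z) \<le> exp ((- v + 1) * (z + v))" using pos_le_exp[of "- v" "z + v"] by (simp add: add.commute)
    then show ?thesis using False by (simp add: s_def)
  qed
  have e: "exp ((?a + 1) * (s * z - ?a)) = exp (- ((?a + 1) * ?a)) * exp (((?a + 1) * s) * z)" for z
    by (simp add: mult_exp_exp algebra_simps)
  have ie: "integrable std_normal_distribution (\<lambda>z. exp ((?a + 1) * (s * z - ?a)))"
    unfolding e by (intro integrable_mult_right gauss_integrable_exp)
  have ve: "(\<integral>z. exp ((?a + 1) * (s * z - ?a)) \<partial>std_normal_distribution) \<le> exp 1 * exp (- v\<^sup>2 / 2)"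
  proof -
    have "(\<integral>z. exp ((?a + 1) * (s * z - ?a)) \<partial>std_normal_distribution)
        = exp (- ((?a + 1) * ?a)) * exp (((?a + 1) * s)\<^sup>2 / 2)"
      unfolding e by (simp add: gauss_integral_exp)
    also have "\<dots> = exp (1/2 - v\<^sup>2 / 2)"
    proof -
      have "- ((?a + 1) * ?a) + ((?a + 1) * s)\<^sup>2 / 2 = 1/2 - ?a\<^sup>2 / 2"
        unfolding power_mult_distrib s by (simp add: power2_eq_square field_simps)
      then show ?thesis by (simp only: mult_exp_exp power2_abs)
    qed
    also have "\<dots> \<le> exp 1 * exp (- v\<^sup>2 / 2)" by (simp add: mult_exp_exp)
    finally show ?thesis .
  qed
  have iz: "integrable std_normal_distribution (\<lambda>z. if 0 \<le> v then z else 0)"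
    and z: "(\<integral>z. (if 0 \<le> v then z else 0) \<partial>std_normal_distribution) = 0"
    by (cases "0 \<le> v"; simp add: gauss_integral_id)+
  have sum: "(\<integral>z. max 0 v + (if 0 \<le> v then z else 0) + exp ((?a + 1) * (s * z - ?a)) \<partial>std_normal_distribution)
      = max 0 v + (\<integral>z. exp ((?a + 1) * (s * z - ?a)) \<partial>std_normal_distribution)"
    using ie iz gauss.prob_space
    by (subst Bochner_Integration.integral_add, simp, simp,
        subst Bochner_Integration.integral_add, simp, simp, simp add: z)
  have im: "integrable std_normal_distribution (\<lambda>z. max 0 (v + z))"
    by (intro integrable_max Bochner_Integration.integrable_add) auto
  have "(\<integral>\<^sup>+y. ennreal (std_normal_density (y - v)) * ennreal (max 0 y) \<partial>lborel)
      = (\<integral>\<^sup>+z. ennreal (max 0 (v + z)) \<partial>std_normal_distribution)"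
    using nn_integral_gauss[of "\<lambda>y. ennreal (max 0 y)" v] by simp
  also have "\<dots> = ennreal (\<integral>z. max 0 (v + z) \<partial>std_normal_distribution)"
    by (rule nn_integral_eq_integral[OF im]) simp
  also have "\<dots> \<le> ennreal (\<integral>z. max 0 v + (if 0 \<le> v then z else 0) + exp ((?a + 1) * (s * z - ?a)) \<partial>std_normal_distribution)"
  proof (intro ennreal_leI integral_mono im pw)
    show "integrable std_normal_distribution
        (\<lambda>z. max 0 v + (if 0 \<le> v then z else 0) + exp ((?a + 1) * (s * z - ?a)))"
      by (intro Bochner_Integration.integrable_add ie iz) simp
  qed
  also have "\<dots> \<le> ennreal (max 0 v + exp 1 * exp (- v\<^sup>2 / 2))"
    unfolding sum by (intro ennreal_leI add_left_mono ve)
  finally have "(\<integral>\<^sup>+y. ennreal (std_normal_density (y - v)) * ennreal (max 0 y) \<partial>lborel)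
    \<le> ennreal (max 0 v + exp 1 * exp (- v\<^sup>2 / 2))" .
  moreover have "exp 1 * exp (- v\<^sup>2 / 2) = exp 1 * sqrt (2 * pi) * std_normal_density v"
    unfolding std_normal_density_def by simp
  ultimately show ?thesis by (simp only:)
qed

text \<open>The first moment of the front stays bounded because it grows only by the mass near 0, which
  is summable by the rough bound.\<close>
lemma front_first_moment:
  obtains C where "0 < C" and
    "\<And>n. (\<integral>\<^sup>+y. ennreal (max 0 y) * ennreal (front n y) \<partial>lborel) \<le> ennreal C"
proof -
  obtain R where R: "0 < R" and rough: "\<And>n y. 1 \<le> n \<Longrightarrow> front n y \<le> R * (1 + \<bar>y\<bar>) * real n powr (- 5/4)"
    by (rule front_rough_bound) blast
  let ?J = "\<lambda>n. \<integral>\<^sup>+y. ennreal (max 0 y) * ennreal (front n y) \<partial>lborel"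
  let ?p = "std_normal_density"
  define K where "K = exp 1 * sqrt (2 * pi)"
  have K: "0 < K" by (simp add: K_def)
  have step: "?J (Suc n) \<le> ?J n + ennreal K * (\<integral>\<^sup>+y. ennreal (?p y) * ennreal (front n y) \<partial>lborel)" for n
  proof -
    have sym: "?p (v - y) = ?p (y - v)" for v y using heat_kernel_uminus[of 1 "y - v"] by simp
    have "?J (Suc n) \<le> (\<integral>\<^sup>+y. ennreal (max 0 y) * (\<integral>\<^sup>+v. ennreal (?p (v - y)) * ennreal (front n v) \<partial>lborel) \<partial>lborel)"
    proof (intro nn_integral_mono mult_left_mono)
      fix y
      have "ennreal (front (Suc n) y) \<le> ennreal (gconv (front n) y)"
        by (intro ennreal_leI front_Suc_le)
      also have "\<dots> = (\<integral>\<^sup>+z. ennreal (front n (y + z)) \<partial>std_normal_distribution)"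
        unfolding gconv_def by (rule nn_integral_eq_integral[symmetric]) auto
      also have "\<dots> = (\<integral>\<^sup>+v. ennreal (?p (v - y)) * ennreal (front n v) \<partial>lborel)"
        by (rule nn_integral_gauss) simp
      finally show "ennreal (front (Suc n) y) \<le> (\<integral>\<^sup>+v. ennreal (?p (v - y)) * ennreal (front n v) \<partial>lborel)" .
    qed simp
    also have "\<dots> = (\<integral>\<^sup>+y. (\<integral>\<^sup>+v. ennreal (max 0 y) * (ennreal (?p (v - y)) * ennreal (front n v)) \<partial>lborel) \<partial>lborel)"
      by (intro nn_integral_cong nn_integral_cmult[symmetric]) measurable
    also have "\<dots> = (\<integral>\<^sup>+v. (\<integral>\<^sup>+y. ennreal (max 0 y) * (ennreal (?p (v - y)) * ennreal (front n v)) \<partial>lborel) \<partial>lborel)"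
      by (rule lborel_pair.Fubini') measurable
    also have "\<dots> = (\<integral>\<^sup>+v. (\<integral>\<^sup>+y. ennreal (?p (y - v)) * ennreal (max 0 y) \<partial>lborel) * ennreal (front n v) \<partial>lborel)"
      by (intro nn_integral_cong, subst nn_integral_multc[symmetric])
         (auto simp: sym ac_simps intro!: nn_integral_cong)
    also have "\<dots> \<le> (\<integral>\<^sup>+v. ennreal (max 0 v + K * ?p v) * ennreal (front n v) \<partial>lborel)"
      by (intro nn_integral_mono mult_right_mono) (use gauss_positive_part in \<open>auto simp: K_def\<close>)
    also have "\<dots> = (\<integral>\<^sup>+v. ennreal (max 0 v) * ennreal (front n v) + ennreal K * (ennreal (?p v) * ennreal (front n v)) \<partial>lborel)"
    proof (intro nn_integral_cong)
      fix v
      have "ennreal (max 0 v + K * ?p v) = ennreal (max 0 v) + ennreal K * ennreal (?p v)"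
        using K by (subst ennreal_plus) (auto simp: ennreal_mult normal_density_nonneg)
      then show "ennreal (max 0 v + K * ?p v) * ennreal (front n v)
          = ennreal (max 0 v) * ennreal (front n v) + ennreal K * (ennreal (?p v) * ennreal (front n v))"
        by (simp only: distrib_right mult.assoc)
    qed
    also have "\<dots> = ?J n + (\<integral>\<^sup>+v. ennreal K * (ennreal (?p v) * ennreal (front n v)) \<partial>lborel)"
      by (rule nn_integral_add) measurable
    also have "(\<integral>\<^sup>+v. ennreal K * (ennreal (?p v) * ennreal (front n v)) \<partial>lborel)
        = ennreal K * (\<integral>\<^sup>+y. ennreal (?p y) * ennreal (front n y) \<partial>lborel)"
      by (rule nn_integral_cmult) measurable
    finally show ?thesis .
  qed
  have J0: "?J 0 = 0"
    by (subst nn_integral_0_iff_AE) (auto simp: front_def max_def intro!: AE_I2)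
  have mass: "(\<integral>\<^sup>+y. ennreal (?p y) * ennreal (front n y) \<partial>lborel) \<le> ennreal B * 2"
    if "\<And>y. front n y \<le> B * (1 + \<bar>y\<bar>)" "0 \<le> B" for n B
  proof -
    have "(\<integral>\<^sup>+y. ennreal (?p y) * ennreal (front n y) \<partial>lborel)
        \<le> (\<integral>\<^sup>+y. ennreal B * ennreal (?p y * (1 + \<bar>y\<bar>)) \<partial>lborel)"
    proof (rule nn_integral_mono)
      fix y
      have "?p y * front n y \<le> B * (?p y * (1 + \<bar>y\<bar>))"
        using mult_left_mono[OF that(1)[of y], of "?p y"] by (simp add: normal_density_nonneg ac_simps)
      then show "ennreal (?p y) * ennreal (front n y) \<le> ennreal B * ennreal (?p y * (1 + \<bar>y\<bar>))"
        using that(2) by (simp add: ennreal_mult[symmetric] normal_density_nonneg ennreal_leI)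
    qed
    also have "\<dots> = ennreal B * (\<integral>\<^sup>+y. ennreal (?p y * (1 + \<bar>y\<bar>)) \<partial>lborel)"
      by (rule nn_integral_cmult) measurable
    also have "\<dots> \<le> ennreal B * 2"
      by (intro mult_left_mono nn_integral_std_normal_density_abs) simp
    finally show ?thesis .
  qed
  define b where "b n = K * (R * real n powr (- 5/4)) * 2" for n :: nat
  have bn: "0 \<le> b n" for n using K R by (simp add: b_def)
  \<comment> \<open>The rough bound starts at generation 1, so the first step uses that the front is
    at most 1.\<close>
  have J1: "?J 1 \<le> ennreal (2 * K)"
  proof -
    have "?J (Suc 0) \<le> ?J 0 + ennreal K * (ennreal 1 * 2)"
      by (rule order_trans[OF step]) (intro add_left_mono mult_left_mono mass, auto intro: order_trans[OF front_le_1])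
    then show ?thesis using K unfolding J0 by (simp add: ennreal_mult mult.commute)
  qed
  have "?J (Suc n) \<le> ennreal (2 * K + (\<Sum>k<n. b (Suc k)))" for n
  proof (induction n)
    case (Suc n)
    have "?J (Suc (Suc n)) \<le> ?J (Suc n) + ennreal K * (ennreal (R * real (Suc n) powr (- 5/4)) * 2)"
      using rough[of "Suc n"] R
      by (intro order_trans[OF step] add_left_mono mult_left_mono mass) (auto simp: ac_simps)
    also have "ennreal K * (ennreal (R * real (Suc n) powr (- 5/4)) * 2) = ennreal (b (Suc n))"
      unfolding b_def using K R by (simp add: ennreal_mult mult.assoc del: of_nat_Suc)
    also have "?J (Suc n) + ennreal (b (Suc n)) \<le> ennreal (2 * K + (\<Sum>k<n. b (Suc k))) + ennreal (b (Suc n))"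
      by (intro add_right_mono Suc.IH)
    also have "\<dots> = ennreal (2 * K + (\<Sum>k<Suc n. b (Suc k)))"
      using K bn by (subst ennreal_plus[symmetric]) (auto intro!: add_nonneg_nonneg sum_nonneg simp: add.assoc)
    finally show ?case .
  qed (use J1 in simp)
  moreover have "summable b"
    unfolding b_def by (intro summable_mult summable_mult2) (simp add: summable_real_powr_iff)
  then have "(\<Sum>k<n. b (Suc k)) \<le> (\<Sum>k. b (Suc k))" for n
    using bn by (intro sum_le_suminf) (auto simp: summable_Suc_iff)
  ultimately have Jb: "?J (Suc n) \<le> ennreal (2 * K + (\<Sum>k. b (Suc k)))" for n
    by (meson add_left_mono ennreal_leI order_trans)
  have S: "0 \<le> (\<Sum>k. b (Suc k))" using bn \<open>summable b\<close> by (intro suminf_nonneg) (auto simp: summable_Suc_iff)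
  show ?thesis
  proof
    show "0 < 2 * K + (\<Sum>k. b (Suc k))" using K S by simp
    show "?J n \<le> ennreal (2 * K + (\<Sum>k. b (Suc k)))" for n
      using Jb J0 by (cases n) auto
  qed
qed

lemma affine_le_product:
  fixes r l :: real
  assumes "1 \<le> r" "0 \<le> l"
  shows "1 + l + r \<le> 2 * (r * (1 + l))"
proof -
  have "0 \<le> (r - 1) * (1 + l) + r * l" using assms by (intro add_nonneg_nonneg mult_nonneg_nonneg) auto
  then show ?thesis by (simp add: algebra_simps)
qed

text \<open>Restart the barrier bound at half time. The weight \<open>1 + y\<close> is
  \<open>1 + lag n\<close> plus the distance from 0 in front coordinates: the latter is paid by the
  first moment, which also covers the constant beyond \<open>sqrt n\<close>. Closer in, the rough
  bound is just good enough.\<close>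

lemma front_bound:
  obtains C where "0 < C" and
    "\<And>n x. 1 \<le> n \<Longrightarrow> front n (- lag n + x) \<le> C * (1 + max 0 x) * real n powr (- 3/2)"
proof -
  obtain C where C: "0 < C" and fb:
    "\<And>m k a x A. 0 < k \<Longrightarrow> 0 < x \<Longrightarrow> 0 \<le> A \<Longrightarrow>
      (\<integral>\<^sup>+y. ennreal (1 + y) * indicator {0<..} y * ennreal (front m (a + y)) \<partial>lborel) \<le> ennreal A \<Longrightarrow>
      front (m + k) (a + x) \<le> exp (c0 * a) + C * (1 + x) / real k powr (3/2) * A"
    by (rule front_barrier_bound) blast
  obtain D where D: "1 \<le> D" and lag3: "\<And>n. 1 \<le> n \<Longrightarrow> (1 + lag n) ^ 3 \<le> D * real n powr (1/4)"
    and lag1: "\<And>n. 1 \<le> n \<Longrightarrow> 1 + lag n \<le> D * sqrt (real n)"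
    by (rule lag_cube_growth) blast
  obtain R where R: "0 < R" and rough: "\<And>n y. 1 \<le> n \<Longrightarrow> front n y \<le> R * (1 + \<bar>y\<bar>) * real n powr (- 5/4)"
    by (rule front_rough_bound) blast
  obtain J where J: "0 < J" and moment: "\<And>n. (\<integral>\<^sup>+y. ennreal (max 0 y) * ennreal (front n y) \<partial>lborel) \<le> ennreal J"
    by (rule front_first_moment) blast
  define A where "A = (1 + D) * J + 4 * (R * 3 powr (5/4)) * D"
  have A: "0 < A" using D J R by (simp add: A_def add_pos_pos)
  define E where "E = 1 + C * A * 2 powr (3/2)"
  have E: "1 \<le> E" using C A by (simp add: E_def)
  have "front n (- lag n + x) \<le> E * (1 + max 0 x) * real n powr (- 3/2)" if n: "1 \<le> n" for n x
  proof -
    let ?l = "lag n"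
    have l: "0 \<le> ?l" by (rule lag_nonneg[OF n])
    have e: "exp (c0 * (- ?l)) = real n powr (- 3/2)" using exp_lag[OF n] by simp
    consider "x \<le> 0" | "n = 1" | "0 < x" "2 \<le> n" using n by linarith
    then show ?thesis
    proof cases
      case 1
      have "front n (- ?l + x) \<le> exp (c0 * (- ?l + x))" by (rule front_le_exp)
      also have "\<dots> \<le> exp (c0 * (- ?l))"
        using 1 c0_pos by (intro iffD2[OF exp_le_cancel_iff] mult_left_mono) auto
      also have "\<dots> = 1 * 1 * real n powr (- 3/2)" unfolding e by simp
      also have "\<dots> \<le> E * (1 + max 0 x) * real n powr (- 3/2)" using E by (intro mult_mono) auto
      finally show ?thesis .
    next
      case 2
      have "front n (- ?l + x) \<le> 1 * 1 * 1" using front_le_1 by simp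
      also have "\<dots> \<le> E * (1 + max 0 x) * 1" using E by (intro mult_mono) auto
      finally show ?thesis using 2 by simp
    next
      case 3
      define m where "m = n div 2"
      define k where "k = n - m"
      have mk: "n = m + k" "1 \<le> m" "0 < k" "real n \<le> 3 * real m" "real n \<le> 2 * real k"
      proof -
        have "n = m + k" "1 \<le> m" "0 < k" "n \<le> 3 * m" "n \<le> 2 * k"
          using 3(2) unfolding k_def m_def by linarith+
        then show "n = m + k" "1 \<le> m" "0 < k" "real n \<le> 3 * real m" "real n \<le> 2 * real k"
          using of_nat_le_iff[of n "3 * m", where 'a=real] of_nat_le_iff[of n "2 * k", where 'a=real]
          by (simp_all del: of_nat_le_iff)
      qed
      let ?r = "sqrt (real n)"
      have r: "1 \<le> ?r" using n by simp
      let ?B = "R * 3 powr (5/4) * real n powr (- 5/4)"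
      have B: "0 \<le> ?B" using R by simp
      have fm: "front m y \<le> ?B * (1 + \<bar>y\<bar>)" for y
      proof -
        have "real n powr (5/4) \<le> (3 * real m) powr (5/4)" using mk by (intro powr_mono2) auto
        also have "\<dots> = 3 powr (5/4) * real m powr (5/4)" by (simp add: powr_mult)
        finally have "real m powr (- 5/4) \<le> 3 powr (5/4) * real n powr (- 5/4)"
          using mk by (simp add: powr_minus field_simps)
        then have "R * (1 + \<bar>y\<bar>) * real m powr (- 5/4) \<le> R * (1 + \<bar>y\<bar>) * (3 powr (5/4) * real n powr (- 5/4))"
          using R by (intro mult_left_mono) auto
        then show ?thesis using rough[OF mk(2), of y] by (simp only: ac_simps)
      qed
      have lr: "(1 + ?l) / ?r \<le> D" using lag1[OF n] r by (simp add: field_simps)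
      \<comment> \<open>Left of \<open>sqrt n\<close> the rough bound pays for the weight
        \<open>1 + ?l\<close>; to the right \<open>1 + ?l \<le> D * ?r\<close> lets the first moment
        absorb it.\<close>
      have pw: "(1 + y) * front m (- ?l + y) \<le> (1 + D) * (max 0 (- ?l + y) * front m (- ?l + y))
          + 2 * ?B * (1 + ?l)\<^sup>2 * ?r * indicator {0..?r + ?l} y" if y: "0 < y" for y
      proof -
        let ?y = "- ?l + y"
        have f: "0 \<le> front m ?y" by simp
        show ?thesis
        proof (cases "?y \<le> ?r")
          case True
          have "1 + ?l + ?r \<le> 2 * (?r * (1 + ?l))"
            by (rule affine_le_product[OF r l])
          moreover have "\<bar>?y\<bar> \<le> ?l + ?r" using True y r l by (simp only: abs_le_iff) linarith
          ultimately have 1: "1 + \<bar>?y\<bar> \<le> 2 * (?r * (1 + ?l))" by linarith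
          have "front m ?y \<le> ?B * (1 + \<bar>?y\<bar>)" by (rule fm)
          also have "\<dots> \<le> ?B * (2 * (?r * (1 + ?l)))" by (rule mult_left_mono[OF 1 B])
          finally have "(1 + ?l) * front m ?y \<le> (1 + ?l) * (?B * (2 * (?r * (1 + ?l))))"
            using l by (intro mult_left_mono) auto
          moreover have "(1 + ?l) * (?B * (2 * (?r * (1 + ?l)))) = 2 * ?B * (1 + ?l)\<^sup>2 * ?r"
            by (simp add: power2_eq_square)
          moreover have "?y * front m ?y \<le> (1 + D) * (max 0 ?y * front m ?y)"
            using D f mult_right_mono[of ?y "max 0 ?y" "front m ?y"]
              mult_right_mono[of 1 "1 + D" "max 0 ?y * front m ?y"] by simp
          moreover have "(1 + y) * front m ?y = (1 + ?l) * front m ?y + ?y * front m ?y"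
            by (simp add: algebra_simps)
          moreover have "indicator {0..?r + ?l} y = (1 :: real)" using True y by simp
          ultimately show ?thesis by (simp only: mult_1_right)
        next
          case False
          have "1 + y = (1 + ?l) + ?y" by simp
          also have "1 + ?l \<le> D * ?r" using lag1[OF n] .
          also have "D * ?r \<le> D * ?y" using False D by (intro mult_left_mono) auto
          finally have "1 + y \<le> D * ?y + ?y" by simp
          moreover have "max 0 ?y = ?y" using False r by (simp only: max_def split: if_split) linarith
          ultimately have "1 + y \<le> (1 + D) * max 0 ?y" by (simp only: distrib_right mult_1)
          then have "(1 + y) * front m ?y \<le> (1 + D) * max 0 ?y * front m ?y"
            by (intro mult_right_mono f)
          moreover have "0 \<le> 2 * ?B * (1 + ?l)\<^sup>2 * ?r * indicator {0..?r + ?l} y"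
            using R B r l by (intro mult_nonneg_nonneg) auto
          ultimately show ?thesis
            using mult.assoc[of "1 + D" "max 0 ?y" "front m ?y"] by linarith
        qed
      qed
      let ?G = "2 * ?B * (1 + ?l)\<^sup>2 * ?r"
      have G: "0 \<le> ?G" using R B r by (intro mult_nonneg_nonneg) auto
      have "(\<integral>\<^sup>+y. ennreal (1 + y) * indicator {0<..} y * ennreal (front m (- ?l + y)) \<partial>lborel)
        \<le> (\<integral>\<^sup>+y. ennreal (1 + D) * (ennreal (max 0 (- ?l + y)) * ennreal (front m (- ?l + y)))
            + ennreal ?G * indicator {0..?r + ?l} y \<partial>lborel)"
      proof (rule nn_integral_mono)
        fix y
        show "ennreal (1 + y) * indicator {0<..} y * ennreal (front m (- ?l + y))
          \<le> ennreal (1 + D) * (ennreal (max 0 (- ?l + y)) * ennreal (front m (- ?l + y)))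
            + ennreal ?G * indicator {0..?r + ?l} y"
        proof (cases "0 < y")
          case True
          have "ennreal (1 + y) * ennreal (front m (- ?l + y)) = ennreal ((1 + y) * front m (- ?l + y))"
            using True by (subst ennreal_mult) auto
          also have "\<dots> \<le> ennreal ((1 + D) * (max 0 (- ?l + y) * front m (- ?l + y)) + ?G * indicator {0..?r + ?l} y)"
            by (rule ennreal_leI[OF pw[OF True]])
          also have "\<dots> = ennreal (1 + D) * (ennreal (max 0 (- ?l + y)) * ennreal (front m (- ?l + y)))
              + ennreal ?G * ennreal (indicator {0..?r + ?l} y)"
            using D G by (subst ennreal_plus) (auto simp: ennreal_mult simp del: ennreal_plus)
          also have "ennreal (indicator {0..?r + ?l} y) = indicator {0..?r + ?l} y"
            by (simp split: split_indicator)
          finally show ?thesis using True by simp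
        qed simp
      qed
      also have "\<dots> = (\<integral>\<^sup>+y. ennreal (1 + D) * (ennreal (max 0 (- ?l + y)) * ennreal (front m (- ?l + y))) \<partial>lborel)
          + (\<integral>\<^sup>+y. ennreal ?G * indicator {0..?r + ?l} y \<partial>lborel)"
        by (rule nn_integral_add) measurable
      also have "(\<integral>\<^sup>+y. ennreal ?G * indicator {0..?r + ?l} y \<partial>lborel) = ennreal (?G * (?r + ?l))"
        using r l G by (subst nn_integral_cmult_indicator) (auto simp: ennreal_mult)
      also have "(\<integral>\<^sup>+y. ennreal (1 + D) * (ennreal (max 0 (- ?l + y)) * ennreal (front m (- ?l + y))) \<partial>lborel)
          = ennreal (1 + D) * (\<integral>\<^sup>+y. ennreal (max 0 (- ?l + y)) * ennreal (front m (- ?l + y)) \<partial>lborel)"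
        by (rule nn_integral_cmult) measurable
      also have "(\<integral>\<^sup>+y. ennreal (max 0 (- ?l + y)) * ennreal (front m (- ?l + y)) \<partial>lborel)
          = (\<integral>\<^sup>+y. ennreal (max 0 y) * ennreal (front m y) \<partial>lborel)"
        by (subst (2) nn_integral_real_affine[of _ 1 "- ?l"]) auto
      also have "ennreal (1 + D) * \<dots> + ennreal (?G * (?r + ?l)) \<le> ennreal (1 + D) * ennreal J + ennreal (4 * (R * 3 powr (5/4)) * D)"
      proof (intro add_mono mult_left_mono moment ennreal_leI)
        have "?r + ?l \<le> 2 * (?r * (1 + ?l))"
          using affine_le_product[OF r l] by linarith
        then have "?G * (?r + ?l) \<le> ?G * (2 * (?r * (1 + ?l)))" using G by (intro mult_left_mono) auto
        also have "\<dots> = 4 * ?B * (?r * ?r) * (1 + ?l) ^ 3"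
          by (simp add: power2_eq_square power3_eq_cube del: real_sqrt_mult_self)
        also have "?r * ?r = real n" by simp
        also have "4 * ?B * real n * (1 + ?l) ^ 3 \<le> 4 * ?B * real n * (D * real n powr (1/4))"
          using B by (intro mult_left_mono lag3[OF n]) auto
        also have "\<dots> = 4 * (R * 3 powr (5/4)) * D * (real n powr (- 5/4) * real n powr 1 * real n powr (1/4))"
          using n by simp
        \<comment> \<open>The exponents add up to 0: rough bound, squared window size, and cube of
          the lag.\<close>
        also have "real n powr (- 5/4) * real n powr 1 * real n powr (1/4) = 1"
          using n by (simp only: powr_add[symmetric]) simp
        finally show "?G * (?r + ?l) \<le> 4 * (R * 3 powr (5/4)) * D" by simp
      qed simp
      also have "\<dots> = ennreal A"
        unfolding A_def using D J R by (subst ennreal_plus) (auto simp: ennreal_mult simp del: ennreal_plus)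
      finally have "front (m + k) (- ?l + x) \<le> exp (c0 * (- ?l)) + C * (1 + x) / real k powr (3/2) * A"
        using A 3 mk by (intro fb) auto
      then have 1: "front n (- ?l + x) \<le> real n powr (- 3/2) + C * A * (1 + x) * (1 / real k powr (3/2))"
        unfolding e mk(1)[symmetric] by (simp add: mult.commute mult.left_commute)
      have "real n powr (3/2) \<le> (2 * real k) powr (3/2)" using mk by (intro powr_mono2) auto
      also have "\<dots> = 2 powr (3/2) * real k powr (3/2)" by (simp add: powr_mult)
      finally have "1 / real k powr (3/2) \<le> 2 powr (3/2) * real n powr (- 3/2)"
        using mk n by (simp add: powr_minus field_simps)
      then have "C * A * (1 + x) * (1 / real k powr (3/2)) \<le> C * A * (1 + x) * (2 powr (3/2) * real n powr (- 3/2))"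
        using C A 3 by (intro mult_left_mono) auto
      also have "\<dots> = (C * A * 2 powr (3/2)) * (1 + x) * real n powr (- 3/2)" by simp
      finally have "front n (- ?l + x) \<le> 1 * real n powr (- 3/2) + (C * A * 2 powr (3/2)) * (1 + x) * real n powr (- 3/2)"
        using 1 by simp
      also have "\<dots> \<le> (1 + x) * real n powr (- 3/2) + (C * A * 2 powr (3/2)) * (1 + x) * real n powr (- 3/2)"
        using 3 by (intro add_right_mono mult_right_mono) auto
      also have "\<dots> = E * (1 + max 0 x) * real n powr (- 3/2)"
        using 3 by (simp add: E_def distrib_right)
      finally show ?thesis .
    qed
  qed
  then show ?thesis using that[of E] E by auto
qed

text \<open>An explicit point where the exponential beats a given linear function; the upper and the
  lower bound both place their level there.\<close>

lemma linear_le_exp: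
  fixes K :: real
  assumes "0 \<le> K"
  shows "2 * (K * (1 + (8 * K + 8))) \<le> exp (8 * K + 8)"
proof -
  define a where "a = 8 * K + 8"
  have a: "8 \<le> a" using assms by (simp add: a_def)
  have "2 * (K * (1 + a)) = (a - 8) * (1 + a) / 4" by (simp add: a_def)
  also have "\<dots> \<le> (1 + a / 2)\<^sup>2" using a by (simp add: power2_eq_square algebra_simps)
  also have "\<dots> \<le> (exp (a / 2))\<^sup>2" using a by (intro power_mono exp_ge_add_one_self) auto
  also have "\<dots> = exp a" by (simp add: exp_double[symmetric])
  finally show ?thesis by (simp add: a_def)
qed

text \<open>Undoing the normalization, the sharp front bound says that the tail at
  \<open>m_seq n + a\<close> is at most \<open>C * (1 + a) * exp (- c0 * a)\<close>, uniformly in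
  \<open>n\<close>; one large \<open>a\<close> brings this below 1/2.\<close>

lemma front_upper_tail:
  obtains a where "0 < a" and "\<And>n. 1 \<le> n \<Longrightarrow> 1/2 \<le> wall n (m_seq n + a)"
proof -
  obtain C where C: "0 < C" and fb: "\<And>n x. 1 \<le> n \<Longrightarrow> front n (- lag n + x) \<le> C * (1 + max 0 x) * real n powr (- 3/2)"
    by (rule front_bound) blast
  define a where "a = 8 * C + 8"
  have a: "0 < a" using C by (simp add: a_def)
  have "1/2 \<le> wall n (m_seq n + a)" if n: "1 \<le> n" for n
  proof -
    have np: "0 < real n powr (- 3/2)" using n by simp
    have "front n (- lag n + a) = exp (c0 * a) * exp (- c0 * lag n) * (1 - wall n (m_seq n + a))"
      by (simp add: front_def m_seq_lag mult_exp_exp algebra_simps)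
    then have "exp (c0 * a) * (1 - wall n (m_seq n + a)) * real n powr (- 3/2) \<le> C * (1 + a) * real n powr (- 3/2)"
      using fb[OF n, of a] a unfolding exp_lag[OF n] by (simp add: mult_ac)
    then have 1: "exp (c0 * a) * (1 - wall n (m_seq n + a)) \<le> C * (1 + a)" using np by simp
    have "2 * (C * (1 + a)) \<le> exp a" unfolding a_def using C by (intro linear_le_exp) auto
    also have "\<dots> \<le> exp (c0 * a)" using a c0_ge_1 by simp
    finally have "exp (c0 * a) * (1 - wall n (m_seq n + a)) \<le> exp (c0 * a) * (1/2)" using 1 by linarith
    then show ?thesis by simp
  qed
  with a show ?thesis by (rule that)
qed

section \<open>Lower bound for the maximum of the field\<close>

definition bump :: "real \<Rightarrow> real \<Rightarrow> real" where
  "bump \<alpha> y = indicator {\<alpha>..2 * \<alpha>} y - indicator {- 2 * \<alpha>..- \<alpha>} y"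

lemma bump_measurable [measurable]: "bump \<alpha> \<in> borel_measurable borel"
  unfolding bump_def by measurable

lemma bump_odd: "bump \<alpha> (- y) = - bump \<alpha> y"
  by (auto simp: bump_def split: split_indicator)

lemma bump_abs_le_1: "\<bar>bump \<alpha> y\<bar> \<le> 1"
  by (auto simp: bump_def split: split_indicator)

lemma bump_eq: "0 < \<alpha> \<Longrightarrow> 0 \<le> y \<Longrightarrow> bump \<alpha> y = indicator {\<alpha>..2 * \<alpha>} y"
  by (auto simp: bump_def split: split_indicator)

text \<open>On the positive half-line this is the Dirichlet heat flow of the indicator of
  \<open>{\<alpha>..2 * \<alpha>}\<close>, by oddness. Time 0 is separate because
  \<open>heat 0\<close> has no kernel.\<close>

definition bump_flow :: "real \<Rightarrow> nat \<Rightarrow> real \<Rightarrow> real" where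
  "bump_flow \<alpha> t = (if t = 0 then bump \<alpha> else heat (real t) (bump \<alpha>))"

lemma bump_flow_measurable [measurable]: "bump_flow \<alpha> t \<in> borel_measurable borel"
  unfolding bump_flow_def by auto

lemma bump_flow_abs_le_1: "\<bar>bump_flow \<alpha> t y\<bar> \<le> 1"
  using heat_bound[of "real t" "bump \<alpha>" 1 y] by (auto simp: bump_flow_def bump_abs_le_1)

lemma gconv_bump_flow: "gconv (bump_flow \<alpha> t) = bump_flow \<alpha> (Suc t)"
proof (cases "t = 0")
  case True
  then show ?thesis by (simp add: bump_flow_def heat_1)
next
  case False
  then show ?thesis
    using gconv_heat[of "real t" "bump \<alpha>" 1] by (auto simp: bump_flow_def bump_abs_le_1 fun_eq_iff add.commute)
qed

lemma bump_flow_odd: "bump_flow \<alpha> t (- y) = - bump_flow \<alpha> t y"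
  by (simp add: bump_flow_def bump_odd heat_odd_uminus)

lemma bump_flow_nonneg:
  assumes "0 < \<alpha>" "0 \<le> y" shows "0 \<le> bump_flow \<alpha> t y"
proof (cases "t = 0")
  case True
  then show ?thesis using assms by (simp add: bump_flow_def bump_eq)
next
  case False
  then show ?thesis using assms
    by (auto simp: bump_flow_def bump_eq bump_abs_le_1 bump_odd intro!: heat_odd_nonneg[where B=1])
qed

lemma bump_flow_nonpos: "0 < \<alpha> \<Longrightarrow> y \<le> 0 \<Longrightarrow> bump_flow \<alpha> t y \<le> 0"
  using bump_flow_nonneg[of \<alpha> "- y" t] by (simp add: bump_flow_odd)

text \<open>Comparison with an odd \<open>1/\<alpha>\<close>-Lipschitz function, whose heat flow is again of this kind.\<close>
lemma bump_flow_le: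
  assumes \<alpha>: "0 < \<alpha>" and y: "0 \<le> y"
  shows "bump_flow \<alpha> t y \<le> y / \<alpha>"
proof (cases "t = 0")
  case True
  then show ?thesis using assms by (auto simp: bump_flow_def bump_eq field_simps split: split_indicator)
next
  case False
  then have t: "0 < real t" by simp
  define f where "f x = max (- 1) (min 1 (x / \<alpha>))" for x
  have [measurable]: "f \<in> borel_measurable borel" unfolding f_def by measurable
  have fb: "\<bar>f x\<bar> \<le> 1" for x by (auto simp: f_def)
  have fodd: "f (- x) = - f x" for x by (simp add: f_def max_def min_def)
  have dodd: "f (- x) - bump \<alpha> (- x) = - (f x - bump \<alpha> x)" for x by (simp add: fodd bump_odd)
  have "0 \<le> f x - bump \<alpha> x" if "0 < x" for x
    using that \<alpha> by (auto simp: f_def bump_eq field_simps split: split_indicator)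
  then have "0 \<le> heat (real t) (\<lambda>x. f x - bump \<alpha> x) y"
  proof (intro heat_odd_nonneg[where B=2] t y dodd)
    show "\<bar>f x - bump \<alpha> x\<bar> \<le> 2" for x
      using abs_triangle_ineq4[of "f x" "bump \<alpha> x"] fb[of x] bump_abs_le_1[of \<alpha> x] by linarith
  qed auto
  also have "heat (real t) (\<lambda>x. f x - bump \<alpha> x) y = heat (real t) f y - heat (real t) (bump \<alpha>) y"
    unfolding heat_def right_diff_distrib
    by (rule Bochner_Integration.integral_diff; rule heat_kernel_integrable[OF t, where B=1])
       (auto simp: fb bump_abs_le_1)
  finally have "bump_flow \<alpha> t y \<le> heat (real t) f y" using False by (simp add: bump_flow_def)
  also have "heat (real t) f y = (\<integral>v. heat_kernel (real t) v * (f (y + v) - f v) \<partial>lborel)"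
  proof -
    have i: "integrable lborel (\<lambda>v. heat_kernel (real t) v * f (y + v))"
      "integrable lborel (\<lambda>v. heat_kernel (real t) v * f v)"
      using heat_kernel_integrable[OF t, of "\<lambda>v. f (y + v)" 1 0]
        heat_kernel_integrable[OF t, of f 1 0] fb by simp_all
    have "heat (real t) f 0 = 0" using heat_odd_uminus[of f "real t" 0] fodd by simp
    then have "(\<integral>v. heat_kernel (real t) v * f v \<partial>lborel) = 0" by (simp add: heat_def)
    moreover have "heat (real t) f y = (\<integral>v. heat_kernel (real t) v * f (y + v) \<partial>lborel)"
      unfolding heat_def
      using lborel_integral_real_affine[of 1 "\<lambda>x. heat_kernel (real t) (x - y) * f x" y] by simp
    ultimately show ?thesis using i by (simp add: right_diff_distrib)
  qed
  also have "\<dots> \<le> (\<integral>v. heat_kernel (real t) v * (y / \<alpha>) \<partial>lborel)"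
  proof (rule integral_mono)
    have "\<bar>f (y + v) - f v\<bar> \<le> 2" for v
      using abs_triangle_ineq4[of "f (y + v)" "f v"] fb[of "y + v"] fb[of v] by linarith
    then show "integrable lborel (\<lambda>v. heat_kernel (real t) v * (f (y + v) - f v))"
      using heat_kernel_integrable[OF t, of "\<lambda>v. f (y + v) - f v" 2 0]
      by simp
    show "integrable lborel (\<lambda>v. heat_kernel (real t) v * (y / \<alpha>))"
      using heat_kernel_integrable[OF t, of "\<lambda>v. y / \<alpha>" "\<bar>y / \<alpha>\<bar>" 0] by simp
    fix v
    have "f (y + v) - f v \<le> y / \<alpha>"
    proof -
      have "max (- 1) (min 1 (d + e)) - max (- 1) (min 1 e) \<le> d" if "0 \<le> d" for d e :: real
        using that by linarith
      from this[of "y / \<alpha>" "v / \<alpha>"] show ?thesis using \<alpha> y by (simp add: f_def add_divide_distrib)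
    qed
    then show "heat_kernel (real t) v * (f (y + v) - f v) \<le> heat_kernel (real t) v * (y / \<alpha>)"
      by (intro mult_left_mono) (auto simp: normal_density_nonneg)
  qed
  also have "\<dots> = y / \<alpha>" using heat_kernel_integral[OF t, of 0] by simp
  finally show ?thesis .
qed

text \<open>On the bump the kernel minus its image is a Gaussian factor, bounded below through the
  largest distance \<open>D\<close>, times a factor that vanishes linearly at 0 and measures the
  absorption there.\<close>

lemma bump_flow_ge:
  assumes \<alpha>: "0 < \<alpha>" and t: "t \<noteq> 0" and y: "0 \<le> y"
    and D: "2 * \<alpha> \<le> D" "y \<le> D"
  shows "\<alpha> * (1 / sqrt (2 * pi * real t) * exp (- D\<^sup>2 / (2 * real t)) * (1 - exp (- 2 * \<alpha> * y / real t)))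
    \<le> bump_flow \<alpha> t y"
proof -
  have t': "0 < real t" using t by simp
  let ?n = "heat_kernel (real t)"
  let ?c = "1 / sqrt (2 * pi * real t) * exp (- D\<^sup>2 / (2 * real t)) * (1 - exp (- 2 * \<alpha> * y / real t))"
  have "\<alpha> * ?c = (\<integral>v. ?c * indicator {\<alpha>..2 * \<alpha>} v \<partial>lborel)"
    using \<alpha> by (subst integral_indicator_Icc) auto
  also have "\<dots> \<le> (\<integral>v. (?n (v - y) - ?n (v + y)) * bump \<alpha> v * indicator {0<..} v \<partial>lborel)"
  proof (rule integral_mono)
    show "integrable lborel (\<lambda>v. ?c * indicator {\<alpha>..2 * \<alpha>} v)"
      by (intro integrable_mult_right integrable_indicator_Icc)
    have "integrable lborel (\<lambda>v. ?n (v - y) * (bump \<alpha> v * indicator {0<..} v) - ?n (v - (- y)) * (bump \<alpha> v * indicator {0<..} v))"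
      by (intro Bochner_Integration.integrable_diff heat_kernel_integrable[OF t', where B=1])
         (auto simp: bump_def split: split_indicator)
    then show "integrable lborel (\<lambda>v. (?n (v - y) - ?n (v + y)) * bump \<alpha> v * indicator {0<..} v)"
      by (simp add: algebra_simps)
    fix v :: real
    have "?c \<le> ?n (v - y) - ?n (v + y)" if v: "\<alpha> \<le> v" "v \<le> 2 * \<alpha>"
    proof -
      have e: "- (v + y)\<^sup>2 / (2 * real t) = - (v - y)\<^sup>2 / (2 * real t) + - 2 * v * y / real t"
        using t' by (simp add: power2_eq_square field_simps)
      have "?n (v - y) - ?n (v + y)
          = 1 / sqrt (2 * pi * real t) * exp (- (v - y)\<^sup>2 / (2 * real t)) * (1 - exp (- 2 * v * y / real t))"
        unfolding heat_kernel_eq[OF t'] e exp_add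
        by (simp only: right_diff_distrib mult_1_right mult.assoc)
      also have "\<dots> \<ge> ?c"
      proof (intro mult_mono)
        have "\<bar>v - y\<bar> \<le> D" using v D \<alpha> y by (simp add: abs_le_iff)
        then have "(v - y)\<^sup>2 \<le> D\<^sup>2" using power_mono[of "\<bar>v - y\<bar>" D 2] by simp
        then show "exp (- D\<^sup>2 / (2 * real t)) \<le> exp (- (v - y)\<^sup>2 / (2 * real t))"
          using t' by (simp add: divide_right_mono)
        have "\<alpha> * y \<le> v * y" using v y by (intro mult_right_mono)
        then show "1 - exp (- 2 * \<alpha> * y / real t) \<le> 1 - exp (- 2 * v * y / real t)"
          using t' by (simp add: divide_right_mono)
        have "0 \<le> \<alpha> * y" using \<alpha> y by simp
        then show "0 \<le> 1 - exp (- 2 * \<alpha> * y / real t)" using t' by simp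
      qed auto
      finally show ?thesis .
    qed
    then show "?c * indicator {\<alpha>..2 * \<alpha>} v \<le> (?n (v - y) - ?n (v + y)) * bump \<alpha> v * indicator {0<..} v"
      using \<alpha> by (cases "0 < v") (auto simp: bump_eq split: split_indicator)
  qed
  also have "\<dots> = bump_flow \<alpha> t y"
    using t by (simp add: bump_flow_def heat_odd_eq[OF t' bump_measurable bump_abs_le_1 bump_odd])
  finally show ?thesis .
qed

lemma one_minus_exp_ge:
  fixes x :: real
  assumes "0 \<le> x" "x \<le> 1"
  shows "x / 2 \<le> 1 - exp (- x)"
proof -
  have "1 + x \<le> exp x" by (rule exp_ge_add_one_self)
  then have "exp (- x) \<le> 1 / (1 + x)" using assms by (simp add: exp_minus field_simps)
  also have "\<dots> \<le> 1 - x / 2" using assms by (simp add: field_simps power2_eq_square mult_left_le)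
  finally show ?thesis by simp
qed

text \<open>On the positive half-line the nonlinearity acts as a killing rate of order \<open>k powr (-5/4)\<close>, which
  is summable, so the front stays comparable to the heat flow of an odd bump.\<close>
lemma front_interior:
  obtains \<kappa> N0 where "0 < \<kappa>" and
    "\<And>N y. N0 \<le> N \<Longrightarrow> sqrt (real N) / 2 \<le> y \<Longrightarrow> y \<le> 6 * sqrt (real N) \<Longrightarrow> \<kappa> / real N \<le> front N y"
proof -
  obtain R where R: "0 < R" and rough: "\<And>n y. 1 \<le> n \<Longrightarrow> front n y \<le> R * (1 + \<bar>y\<bar>) * real n powr (- 5/4)"
    by (rule front_rough_bound) blast
  \<comment> \<open>The killing rate: the quadratic term of the recursion relative to the heat step,
    from the rough bound and \<open>exp (- c0 * y) * (2 + y) \<le> 2\<close> on the positive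
    half-line.\<close>
  define b where "b k = R / 2 * real k powr (- 5/4)" for k :: nat
  have b0: "0 \<le> b k" for k using R by (simp add: b_def)
  have sb: "summable b" unfolding b_def by (intro summable_mult) (simp add: summable_real_powr_iff)
  have step: "(1 - b k) * gconv (front k) y \<le> front (Suc k) y" if k: "1 \<le> k" and y: "0 \<le> y" for k y
  proof -
    let ?V = "gconv (front k) y"
    have "?V \<le> (\<integral>z. R * real k powr (- 5/4) * (1 + \<bar>y\<bar> + \<bar>z\<bar>) \<partial>std_normal_distribution)"
      unfolding gconv_def
    proof (rule integral_mono)
      fix z
      have "front k (y + z) \<le> R * real k powr (- 5/4) * (1 + \<bar>y + z\<bar>)" using rough[OF k, of "y + z"] by (simp add: ac_simps)
      also have "\<dots> \<le> R * real k powr (- 5/4) * (1 + \<bar>y\<bar> + \<bar>z\<bar>)" using R by (intro mult_left_mono) auto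
      finally show "front k (y + z) \<le> R * real k powr (- 5/4) * (1 + \<bar>y\<bar> + \<bar>z\<bar>)" .
    qed auto
    also have "\<dots> = R * real k powr (- 5/4) * (1 + \<bar>y\<bar> + (\<integral>z. \<bar>z\<bar> \<partial>std_normal_distribution))"
      using gauss.prob_space by simp
    also have "\<dots> \<le> R * real k powr (- 5/4) * (2 + y)"
      using R y gauss_integral_abs_le by (intro mult_left_mono) auto
    finally have V: "?V \<le> R * real k powr (- 5/4) * (2 + y)" .
    have "2 + y \<le> 2 * exp (c0 * y)"
    proof -
      have "y \<le> c0 * y" using c0_ge_1 y mult_right_mono[of 1 c0 y] by simp
      then show ?thesis using exp_ge_add_one_self[of "c0 * y"] y by linarith
    qed
    then have "exp (- c0 * y) * (2 + y) \<le> exp (- c0 * y) * (2 * exp (c0 * y))" by (intro mult_left_mono) auto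
    also have "exp (- c0 * y) * (2 * exp (c0 * y)) = 2" by (simp add: exp_minus)
    finally have e: "exp (- c0 * y) * (2 + y) \<le> 2" .
    have "exp (- c0 * y) * ?V \<le> exp (- c0 * y) * (R * real k powr (- 5/4) * (2 + y))"
      by (intro mult_left_mono V) auto
    also have "\<dots> = R * real k powr (- 5/4) * (exp (- c0 * y) * (2 + y))" by simp
    also have "\<dots> \<le> R * real k powr (- 5/4) * 2" using R by (intro mult_left_mono e) auto
    finally have "exp (- c0 * y) * ?V / 4 \<le> b k" unfolding b_def by linarith
    then have "exp (- c0 * y) * ?V / 4 * ?V \<le> b k * ?V" by (intro mult_right_mono) auto
    then show ?thesis unfolding front_Suc by (simp add: power2_eq_square algebra_simps)
  qed
  have "b \<longlonglongrightarrow> 0" by (rule summable_LIMSEQ_zero[OF sb])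
  then have "\<forall>\<^sub>F k in sequentially. b k < 1/2" by (rule order_tendstoD) simp
  then obtain k1 where k1: "\<And>k. k1 \<le> k \<Longrightarrow> b k < 1/2" by (auto simp: eventually_sequentially)
  define k0 where "k0 = Suc k1"
  have k0: "1 \<le> k0" "\<And>k. k0 \<le> k \<Longrightarrow> b k < 1/2" using k1 by (auto simp: k0_def)
  \<comment> \<open>A lower bound for the front on \<open>{1..2}\<close> at the starting generation:
    \<open>wall k0\<close> is increasing and below 1, so its value at the right end
    suffices.\<close>
  define ci where "ci = 1 - wall k0 (2 + c0 * real k0)"
  have ci: "0 < ci" using wall_less_1[of k0] k0 by (simp add: ci_def)
  define c where "c t = ci * (\<Prod>i<t. 1 - b (k0 + i))" for t
  have c_pos: "0 < c t" for t
    unfolding c_def using ci k0(2) by (intro mult_pos_pos prod_pos) (auto simp: less_imp_le intro: less_trans[of _ "1/2"])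
  define S where "S = (\<Sum>k. b (k0 + k))"
  have sb': "summable (\<lambda>k. b (k0 + k))" using summable_ignore_initial_segment[OF sb, of k0] by (simp add: add.commute)
  \<comment> \<open>The rates are summable and, from \<open>k0\<close> on, at most 1/2, so
    \<open>1 - x \<ge> exp (- 2 * x)\<close> keeps the accumulated factor above a positive
    constant.\<close>
  have c_ge: "ci * exp (- 2 * S) \<le> c t" for t
  proof -
    have "exp (- 2 * S) \<le> exp (\<Sum>i<t. - 2 * b (k0 + i))"
      using sum_le_suminf[OF sb', of "{..<t}"] b0 by (simp add: sum_distrib_left[symmetric] S_def sum_negf)
    also have "\<dots> = (\<Prod>i<t. exp (- 2 * b (k0 + i)))" by (rule exp_sum) simp
    also have "\<dots> \<le> (\<Prod>i<t. 1 - b (k0 + i))"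
    proof (rule prod_mono, safe)
      fix i
      let ?x = "b (k0 + i)"
      have x: "0 \<le> ?x" "?x \<le> 1/2" using b0 k0(2)[of "k0 + i"] by auto
      have "?x\<^sup>2 \<le> 1/2 * ?x" unfolding power2_eq_square using x by (intro mult_right_mono) auto
      then have "- 2 * ?x \<le> - ?x - 2 * ?x\<^sup>2" by simp
      also have "\<dots> \<le> ln (1 - ?x)" using x by (intro ln_one_minus_pos_lower_bound) auto
      finally show "exp (- 2 * ?x) \<le> 1 - ?x" using x by (simp add: ln_ge_iff)
    qed auto
    finally show ?thesis unfolding c_def using ci by (intro mult_left_mono) auto
  qed
  have main: "c t * bump_flow 1 t y \<le> front (k0 + t) y" for t y
  proof (induction t arbitrary: y)
    case 0
    show ?case
    proof (cases "1 \<le> y \<and> y \<le> 2")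
      case True
      have "1 * ci \<le> exp (c0 * y) * (1 - wall k0 (y + c0 * real k0))"
        unfolding ci_def using True c0_pos by (intro mult_mono diff_left_mono wall_mono) auto
      then show ?thesis using True by (simp add: c_def bump_flow_def bump_eq front_def)
    next
      case False
      then have "bump 1 y \<le> 0" by (auto simp: bump_def split: split_indicator)
      then have "c 0 * bump_flow 1 0 y \<le> 0"
        using c_pos[of 0] by (auto simp: bump_flow_def intro: mult_nonneg_nonpos)
      then show ?thesis using front_nonneg[of "k0 + 0" y] by linarith
    qed
  next
    case (Suc t)
    show ?case
    proof (cases "0 \<le> y")
      case True
      have bt: "b (k0 + t) < 1" using k0(2)[of "k0 + t"] by simp
      have ib: "integrable std_normal_distribution (\<lambda>z. bump_flow 1 t (y + z))"
        by (rule gauss_integrable_bounded[where B=1]) (auto simp: bump_flow_abs_le_1)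
      have "c (Suc t) * bump_flow 1 (Suc t) y = (1 - b (k0 + t)) * gconv (\<lambda>y. c t * bump_flow 1 t y) y"
        unfolding gconv_bump_flow[symmetric] by (simp add: c_def gconv_def)
      also have "\<dots> \<le> (1 - b (k0 + t)) * gconv (front (k0 + t)) y"
        using bt ib by (intro mult_left_mono gconv_mono Suc.IH integrable_mult_right) auto
      also have "\<dots> \<le> front (k0 + Suc t) y" using step[of "k0 + t" y] True k0 by simp
      finally show ?thesis .
    next
      case False
      then have "c (Suc t) * bump_flow 1 (Suc t) y \<le> 0"
        using c_pos[of "Suc t"] bump_flow_nonpos[of 1 y "Suc t"] by (intro mult_nonneg_nonpos) auto
      then show ?thesis using front_nonneg[of "k0 + Suc t" y] by linarith
    qed
  qed
  \<comment> \<open>The kernel and the absorption factor each contribute \<open>1 / sqrt N\<close>;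
    \<open>exp (- 36)\<close> comes from \<open>y \<le> 6 * sqrt N\<close> when at least half of the
    time remains.\<close>
  define \<kappa> where "\<kappa> = ci * exp (- 2 * S) * (exp (- 36) / (2 * sqrt (2 * pi)))"
  have \<kappa>: "0 < \<kappa>" using ci by (simp add: \<kappa>_def)
  show ?thesis
  proof (rule that[OF \<kappa>])
    fix N y assume N: "2 * k0 \<le> N" and y: "sqrt (real N) / 2 \<le> y" "y \<le> 6 * sqrt (real N)"
    define t where "t = N - k0"
    have t: "N = k0 + t" "t \<noteq> 0" "N \<le> 2 * t" "t \<le> N" using N k0 by (auto simp: t_def)
    have rt: "real N \<le> 2 * real t" "real t \<le> real N" "0 < real t" "0 < real N" using t by simp_all
    let ?s = "sqrt (real N)"
    have s: "1 \<le> ?s" using rt by simp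
    have ss: "?s * ?s = real N" by simp
    have "exp (- 36) / (2 * sqrt (2 * pi)) / real N
        = 1 / (sqrt (2 * pi) * ?s) * exp (- 36) * (1 / ?s / 2)"
      using ss s by (simp add: divide_simps)
    also have "\<dots> \<le> 1 / sqrt (2 * pi * real t) * exp (- (6 * ?s)\<^sup>2 / (2 * real t)) * (1 - exp (- 2 * 1 * y / real t))"
    proof (intro mult_mono)
      show "1 / (sqrt (2 * pi) * ?s) \<le> 1 / sqrt (2 * pi * real t)"
        using rt by (simp only: real_sqrt_mult[symmetric], intro divide_left_mono) auto
      have "(6 * ?s)\<^sup>2 / (2 * real t) \<le> 36" using rt by (simp add: power_mult_distrib field_simps)
      then show "exp (- 36) \<le> exp (- (6 * ?s)\<^sup>2 / (2 * real t))" by simp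
      have "1 / ?s / 2 \<le> 1 - exp (- (1 / ?s))" using s by (intro one_minus_exp_ge) auto
      also have "1 / ?s \<le> 2 * 1 * y / real t"
      proof -
        have "1 / ?s = ?s / real N" using ss s by (simp add: divide_simps)
        also have "\<dots> \<le> 2 * y / real N" using y rt by (intro divide_right_mono) auto
        also have "\<dots> \<le> 2 * y / real t" using y s rt by (intro divide_left_mono) auto
        finally show ?thesis by simp
      qed
      then have "1 - exp (- (1 / ?s)) \<le> 1 - exp (- 2 * 1 * y / real t)" by simp
      finally show "1 / ?s / 2 \<le> 1 - exp (- 2 * 1 * y / real t)" .
    qed (use s in auto)
    also have "\<dots> \<le> bump_flow 1 t y"
    proof -
      have "0 \<le> y" using y(1) s by linarith
      then show ?thesis
        using bump_flow_ge[of 1 t y "6 * ?s"] t(2) y(2) s by (simp only: mult_1_left) simp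
    qed
    finally have "ci * exp (- 2 * S) * (exp (- 36) / (2 * sqrt (2 * pi)) / real N) \<le> c t * bump_flow 1 t y"
      using ci c_ge[of t] c_pos[of t] by (intro mult_mono) auto
    also have "\<dots> \<le> front N y" unfolding t(1) by (rule main)
    finally show "\<kappa> / real N \<le> front N y" by (simp add: \<kappa>_def)
  qed
qed

lemma exp_wins_product:
  fixes x :: real
  assumes "0 \<le> x"
  shows "(1 + x)\<^sup>2 \<le> 16 * exp (x / 2)"
proof -
  have "1 + x \<le> 4 * exp (x / 4)" using exp_ge_add_one_self[of "x / 4"] by linarith
  then have "(1 + x)\<^sup>2 \<le> (4 * exp (x / 4))\<^sup>2" using assms by (intro power_mono) auto
  also have "\<dots> = 16 * exp (x / 2)" by (simp add: power_mult_distrib exp_double[symmetric])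
  finally show ?thesis .
qed

text \<open>From time \<open>n div 2\<close> on, the subsolution to the right of a barrier is the heat flow of an odd bump minus
  a small constant; the correction \<open>exp (- z / 2)\<close> beats both the nonlinearity and the overshoot.\<close>
lemma front_lower_eventually:
  obtains b \<kappa> n0 where "0 < \<kappa>" "1 \<le> n0" and
    "\<And>n. n0 \<le> n \<Longrightarrow> \<kappa> * real n powr (- 3/2) \<le> front n (- lag n + b)"
proof -
  obtain A where A: "0 < A" and over: "\<And>x. 0 \<le> x \<Longrightarrow>
    (\<integral>y. std_normal_density (y - x) * exp (- y / 2) * indicator {..0} y \<partial>lborel)
      \<le> A * (\<integral>y. std_normal_density (y - x) * indicator {..0} y \<partial>lborel)"
    by (rule overshoot) blast
  obtain C1 where C1: "0 < C1" and fb: "\<And>n x. 1 \<le> n \<Longrightarrow> front n (- lag n + x) \<le> C1 * (1 + max 0 x) * real n powr (- 3/2)"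
    by (rule front_bound) blast
  obtain \<kappa> N0 where \<kappa>: "0 < \<kappa>" and inner: "\<And>N y. N0 \<le> N \<Longrightarrow> sqrt (real N) / 2 \<le> y \<Longrightarrow> y \<le> 6 * sqrt (real N) \<Longrightarrow> \<kappa> / real N \<le> front N y"
    by (rule front_interior) blast
  define C where "C = C1 * 3 powr (3/2)"
  have C: "0 < C" using C1 by (simp add: C_def)
  \<comment> \<open>\<open>A\<close> covers the overshoot across the barrier; the 2 covers
    \<open>exp (1/8)\<close> and keeps the bracket in \<open>G\<close> below nonnegative.\<close>
  define B where "B = A + 2"
  have B: "2 \<le> B" "A \<le> B" using A by (auto simp: B_def)
  \<comment> \<open>The barrier will sit at \<open>- lag n + a\<close>. The factor 32 is chosen so
    that the killing \<open>r\<close>, multiplied by \<open>z\<close>, ends up below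
    \<open>exp (- z / 2) / 8\<close>.\<close>
  define a where "a = 8 * (32 * C) + 8"
  have a: "8 \<le> a" using C by (simp add: a_def)
  have aC: "64 * C * (1 + a) \<le> exp a" using linear_le_exp[of "32 * C"] C by (simp add: a_def)
  define c3 where "c3 = exp (- 4) / sqrt (2 * pi)"
  have c3: "0 < c3" by (simp add: c3_def)
  \<comment> \<open>At \<open>z0\<close> the bump term is at least
    \<open>\<sigma> * (B + 1)\<close>, one \<sigma> more than the largest constant
    subtracted.\<close>
  define z0 where "z0 = (B + 1) / c3"
  have z0: "0 < z0" using B c3 by (simp add: z0_def)
  obtain D where D: "1 \<le> D" and lag: "\<And>n. 1 \<le> n \<Longrightarrow> 1 + lag n \<le> D * real n powr (1/12)"
    by (rule lag_growth) blast
  \<comment> \<open>For large \<open>n\<close> all shifts together are small against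
    \<open>sqrt n\<close>, so the bump seen from the barrier lies in the window of
    \<open>front_interior\<close> at half time.\<close>
  have "\<forall>\<^sub>F n in sequentially. D * real n powr (1/12) + a + 2 * z0 + 4 < sqrt (real n) / 4"
    by real_asymp
  then obtain n1 where n1: "\<And>n. n1 \<le> n \<Longrightarrow> D * real n powr (1/12) + a + 2 * z0 + 4 < sqrt (real n) / 4"
    by (auto simp: eventually_sequentially)
  define n0 where "n0 = max n1 (max (2 * N0 + 2) 4)"
  let ?p = "std_normal_density"
  have pn: "0 \<le> ?p v" for v by (simp add: normal_density_nonneg)
  have "\<kappa> * real n powr (- 3/2) \<le> front n (- lag n + (a + z0))" if nn: "n0 \<le> n" for n
  proof -
    have n: "1 \<le> n" "n1 \<le> n" "2 * N0 + 2 \<le> n" "4 \<le> n" using nn by (auto simp: n0_def)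
    define N where "N = n div 2"
    have "N0 \<le> N" "1 \<le> N" "N \<le> n" "2 * N \<le> n" "n \<le> 3 * N" using n unfolding N_def by linarith+
    then have N: "N0 \<le> N" "1 \<le> N" "N \<le> n" "2 * real N \<le> real n" "real n \<le> 3 * real N"
      using of_nat_le_iff[of "2 * N" n, where 'a=real] of_nat_le_iff[of n "3 * N", where 'a=real]
      by (simp_all del: of_nat_le_iff)
    let ?s = "sqrt (real n)"
    have s: "1 \<le> ?s" "?s * ?s = real n" using n by simp_all
    have big: "lag n + a + 2 * z0 + 3 < ?s / 4" using n1[OF n(2)] lag[OF n(1)] by linarith
    have lg: "0 \<le> lag n" by (rule lag_nonneg[OF n(1)])
    \<comment> \<open>The front has height of order \<open>\<kappa> / n\<close> in the interior; the
      slope \<open>1 / sqrt n\<close> of the bump flow at the barrier brings this down to order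
      \<open>n powr (-3/2)\<close>.\<close>
    define \<sigma> where "\<sigma> = \<kappa> * real n powr (- 3/2)"
    have np: "0 < real n powr (- 3/2)" using n by simp
    have \<sigma>: "0 < \<sigma>" using \<kappa> np by (simp add: \<sigma>_def)
    have n32: "real n powr (- 3/2) = 1 / real n / ?s"
    proof -
      have "real n powr (3/2) = real n * ?s"
        using powr_add[of "real n" 1 "1/2"] n by (simp add: powr_half_sqrt)
      then show ?thesis using powr_minus_divide[of "real n" "3/2"] by simp
    qed
    define L where "L = - lag n + a"
    define Df where "Df j z = \<kappa> / real n * bump_flow ?s j z - \<sigma> * (B - exp (- z / 2))" for j z
    have Df_up: "\<kappa> / real n * bump_flow ?s j z \<le> \<sigma> * z" if "0 \<le> z" for j z
    proof -
      have "\<kappa> / real n * bump_flow ?s j z \<le> \<kappa> / real n * (z / ?s)"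
        using bump_flow_le[of ?s z j] that s \<kappa> by (intro mult_left_mono) auto
      then show ?thesis unfolding \<sigma>_def n32 by simp
    qed
    have upper: "gconv (front (N + j)) (L + z) \<le> C * real n powr (- 3/2) * (2 + a + z)" if j: "N + j \<le> n" and z: "0 \<le> z" for j z
    proof -
      let ?k = "N + j"
      have k: "1 \<le> ?k" "real n \<le> 3 * real ?k" using N by auto
      have lk: "lag ?k \<le> lag n" unfolding lag_def using j k c0_pos by (intro mult_left_mono) auto
      have kp: "real ?k powr (- 3/2) \<le> 3 powr (3/2) * real n powr (- 3/2)"
      proof -
        have "real n powr (3/2) \<le> (3 * real ?k) powr (3/2)" using k by (intro powr_mono2) auto
        also have "\<dots> = 3 powr (3/2) * real ?k powr (3/2)" by (subst powr_mult) (simp_all only: of_nat_0_le_iff zero_le_numeral)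
        finally have 1: "real n powr (3/2) \<le> 3 powr (3/2) * real ?k powr (3/2)" .
        have 2: "0 < real n powr (3/2)" "0 < real ?k powr (3/2)" using n k by auto
        have "x \<le> c * y \<Longrightarrow> 1 / y \<le> c * (1 / x)" if "0 < x" "0 < y" for x y c :: real
          using that by (simp add: field_simps)
        from this[OF 2 1] show ?thesis
          using powr_minus_divide[of "real n" "3/2"] powr_minus_divide[of "real ?k" "3/2"] by simp
      qed
      have "front ?k (L + z + v) \<le> C * real n powr (- 3/2) * (1 + a + z + \<bar>v\<bar>)" for v
      proof -
        have "front ?k (- lag ?k + (lag ?k + L + z + v)) \<le> C1 * (1 + max 0 (lag ?k + L + z + v)) * real ?k powr (- 3/2)"
          by (rule fb[OF k(1)])
        also have "\<dots> \<le> C1 * (1 + a + z + \<bar>v\<bar>) * (3 powr (3/2) * real n powr (- 3/2))"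
        proof (intro mult_mono mult_left_mono kp)
          have "lag ?k + L + z + v \<le> a + z + \<bar>v\<bar>" using lk by (simp add: L_def)
          then show "1 + max 0 (lag ?k + L + z + v) \<le> 1 + a + z + \<bar>v\<bar>" using a z by (simp add: max_def)
        qed (use C1 a z in auto)
        also have "\<dots> = C * real n powr (- 3/2) * (1 + a + z + \<bar>v\<bar>)" by (simp add: C_def)
        finally show ?thesis by (simp add: add_ac)
      qed
      then have "gconv (front ?k) (L + z) \<le> (\<integral>v. C * real n powr (- 3/2) * (1 + a + z + \<bar>v\<bar>) \<partial>std_normal_distribution)"
        unfolding gconv_def by (intro integral_mono) auto
      also have "\<dots> = C * real n powr (- 3/2) * (1 + a + z + (\<integral>v. \<bar>v\<bar> \<partial>std_normal_distribution))"
        using gauss.prob_space by simp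
      also have "\<dots> \<le> C * real n powr (- 3/2) * (2 + a + z)"
        using C gauss_integral_abs_le by (intro mult_left_mono) auto
      finally show ?thesis .
    qed
    have main: "N + j \<le> n \<Longrightarrow> 0 \<le> z \<Longrightarrow> Df j z \<le> front (N + j) (L + z)" for j z
    proof (induction j arbitrary: z)
      case 0
      have e1: "0 \<le> \<sigma> * (B - exp (- z / 2))"
      proof -
        have "exp (- z / 2) \<le> 1" using 0 by simp
        then have "0 \<le> B - exp (- z / 2)" using B by linarith
        then show ?thesis using \<sigma> by (intro mult_nonneg_nonneg) auto
      qed
      show ?case
      proof (cases "?s \<le> z \<and> z \<le> 2 * ?s")
        case True
        have rN: "sqrt (real N) \<le> ?s" using N by simp
        have "?s \<le> sqrt (4 * real N)" using N by (intro real_sqrt_le_mono) auto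
        then have rN2: "?s \<le> 2 * sqrt (real N)" by (simp add: real_sqrt_mult)
        have y: "sqrt (real N) / 2 \<le> L + z" "L + z \<le> 6 * sqrt (real N)"
          using True big lg a z0 rN rN2 s(1) unfolding L_def by linarith+
        have "\<kappa> / real n \<le> \<kappa> / real N" using \<kappa> N n by (intro divide_left_mono) auto
        also have "\<dots> \<le> front N (L + z)" by (rule inner[OF N(1) y])
        finally have "\<kappa> / real n \<le> front N (L + z)" .
        moreover have "bump_flow ?s 0 z = 1" using True s 0 by (simp add: bump_flow_def bump_eq)
        ultimately show ?thesis using e1 by (simp add: Df_def)
      next
        case False
        then have "bump_flow ?s 0 z = 0" using s 0 by (auto simp: bump_flow_def bump_eq split: split_indicator)
        then have "Df 0 z = - (\<sigma> * (B - exp (- z / 2)))" by (simp only: Df_def)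
        then show ?thesis using e1 front_nonneg[of "N + 0" "L + z"] by linarith
      qed
    next
      case (Suc j)
      note z = Suc.prems(2)
      have j: "N + j \<le> n" using Suc.prems by simp
      let ?V = "gconv (front (N + j)) (L + z)"
      \<comment> \<open>One heat step applied to \<open>Df\<close>. The correction grows by
        \<open>exp (1/8)\<close>, the Gaussian mean of \<open>exp (- Z / 2)\<close>; this gain has
        to pay for the nonlinearity.\<close>
      define G where "G = \<kappa> / real n * bump_flow ?s (Suc j) z - \<sigma> * (B - exp (1/8) * exp (- z / 2))"
      have ib: "integrable std_normal_distribution (\<lambda>v. bump_flow ?s j (z + v))"
        by (rule gauss_integrable_bounded[where B=1]) (auto simp: bump_flow_abs_le_1)
      have iexp: "integrable std_normal_distribution (\<lambda>v. exp (- (z + v) / 2))"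
        and gexp: "(\<integral>v. exp (- (z + v) / 2) \<partial>std_normal_distribution) = exp (1/8) * exp (- z / 2)"
      proof -
        have e: "exp (- (z + v) / 2) = exp (- z / 2) * exp (- 1/2 * v)" for v
          by (simp add: mult_exp_exp add_divide_distrib diff_divide_distrib)
        show "integrable std_normal_distribution (\<lambda>v. exp (- (z + v) / 2))"
          unfolding e by (intro integrable_mult_right gauss_integrable_exp)
        show "(\<integral>v. exp (- (z + v) / 2) \<partial>std_normal_distribution) = exp (1/8) * exp (- z / 2)"
          unfolding e by (subst integral_mult_right_zero, subst gauss_integral_exp) (simp add: power2_eq_square)
      qed
      \<comment> \<open>Adding \<open>\<sigma> * neg\<close> leaves only the nonpositive bump term
        left of the barrier, below the front. It does not lower the integral, by the overshoot
        estimate and \<open>A \<le> B\<close>.\<close>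
      define neg where "neg v = (B - exp (- (z + v) / 2)) * indicator {..0} (z + v)" for v
      have ineg: "integrable std_normal_distribution neg"
        and negG: "0 \<le> (\<integral>v. neg v \<partial>std_normal_distribution)"
      proof -
        have i1: "integrable std_normal_distribution (\<lambda>v. indicator {..0} (z + v) :: real)"
          by (rule gauss_integrable_bounded[where B=1]) (auto split: split_indicator)
        have i2: "integrable std_normal_distribution (\<lambda>v. exp (- (z + v) / 2) * indicator {..0} (z + v))"
          by (rule Bochner_Integration.integrable_bound[OF iexp]) (auto split: split_indicator)
        have neg: "neg = (\<lambda>v. B * indicator {..0} (z + v) - exp (- (z + v) / 2) * indicator {..0} (z + v))"
          by (auto simp: neg_def fun_eq_iff left_diff_distrib)
        show "integrable std_normal_distribution neg"
          unfolding neg by (intro Bochner_Integration.integrable_diff integrable_mult_right i1 i2)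
        have "(\<integral>v. exp (- (z + v) / 2) * indicator {..0} (z + v) \<partial>std_normal_distribution)
            = gconv (\<lambda>y. exp (- y / 2) * indicator {..0} y) z" by (simp only: gconv_def)
        also have "\<dots> = (\<integral>y. ?p (y - z) * exp (- y / 2) * indicator {..0} y \<partial>lborel)"
          by (subst gconv_lborel) (auto simp: mult.assoc)
        also have "\<dots> \<le> A * (\<integral>y. ?p (y - z) * indicator {..0} y \<partial>lborel)" by (rule over[OF z])
        also have "(\<integral>y. ?p (y - z) * indicator {..0} y \<partial>lborel) = gconv (indicator {..0}) z"
          by (subst gconv_lborel) auto
        also have "A * gconv (indicator {..0}) z \<le> B * gconv (indicator {..0}) z"
          using B by (intro mult_right_mono gconv_nonneg) auto
        finally show "0 \<le> (\<integral>v. neg v \<partial>std_normal_distribution)"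
          unfolding neg using i1 i2 by (simp add: gconv_def)
      qed
      have iD: "integrable std_normal_distribution (\<lambda>v. Df j (z + v))"
        unfolding Df_def using ib iexp
        by (intro Bochner_Integration.integrable_diff integrable_mult_right) auto
      have GD: "(\<integral>v. Df j (z + v) \<partial>std_normal_distribution) = G"
      proof -
        have "(\<integral>v. Df j (z + v) \<partial>std_normal_distribution)
            = \<kappa> / real n * gconv (bump_flow ?s j) z - \<sigma> * (B - (\<integral>v. exp (- (z + v) / 2) \<partial>std_normal_distribution))"
          unfolding Df_def gconv_def using ib iexp gauss.prob_space by simp
        then show ?thesis unfolding G_def gexp gconv_bump_flow .
      qed
      have "G \<le> (\<integral>v. Df j (z + v) + \<sigma> * neg v \<partial>std_normal_distribution)"
        using negG \<sigma> iD ineg by (simp add: GD)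
      also have "\<dots> \<le> ?V"
        unfolding gconv_def
      proof (rule integral_mono)
        show "integrable std_normal_distribution (\<lambda>v. Df j (z + v) + \<sigma> * neg v)" using iD ineg by simp
        fix v
        show "Df j (z + v) + \<sigma> * neg v \<le> front (N + j) (L + z + v)"
        proof (cases "0 < z + v")
          case True
          then show ?thesis using Suc.IH[of "z + v"] j by (simp add: neg_def add_ac)
        next
          case False
          then have "\<kappa> / real n * bump_flow ?s j (z + v) \<le> 0"
            using bump_flow_nonpos[of ?s "z + v" j] s(1) \<kappa> n by (intro mult_nonneg_nonpos) auto
          then have "Df j (z + v) + \<sigma> * neg v \<le> 0" using False by (simp add: Df_def neg_def)
          then show ?thesis using front_nonneg order_trans by blast
        qed
      qed simp
      finally have GV: "G \<le> ?V" .
      \<comment> \<open>The fraction of the heat step that the nonlinearity removes. It is bounded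
        together with a factor \<open>z\<close> because \<open>G\<close> is at most
        \<open>\<sigma> * z\<close>.\<close>
      define r where "r = exp (- c0 * (L + z)) * ?V / 4"
      have r0: "0 \<le> r" by (simp add: r_def)
      have r1: "r \<le> 1"
      proof -
        have "exp (- c0 * (L + z)) * ?V \<le> exp (- c0 * (L + z)) * (2 * exp (c0 * (L + z)))"
          by (intro mult_left_mono gconv_front_le_exp) auto
        also have "\<dots> = 2" by (simp add: exp_minus)
        finally show ?thesis by (simp add: r_def)
      qed
      have front_r: "front (N + Suc j) (L + z) = (1 - r) * ?V"
        by (simp add: front_Suc r_def power2_eq_square algebra_simps)
      have eL: "exp (- c0 * L) * real n powr (- 3/2) = exp (- c0 * a)"
        unfolding exp_lag[OF n(1), symmetric] by (simp add: L_def mult_exp_exp algebra_simps)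
      have rz: "r * z \<le> (exp (1/8) - 1) * exp (- z / 2)"
      proof -
        have ea: "exp (- c0 * a) \<le> exp (- a)" "exp (- c0 * z) \<le> exp (- z)"
          using a z c0_ge_1 mult_right_mono[of 1 c0 a] mult_right_mono[of 1 c0 z] by auto
        have "r \<le> exp (- c0 * (L + z)) * (C * real n powr (- 3/2) * (2 + a + z)) / 4"
          unfolding r_def by (intro divide_right_mono mult_left_mono upper j z) auto
        also have "\<dots> = C / 4 * (exp (- c0 * L) * real n powr (- 3/2)) * exp (- c0 * z) * (2 + a + z)"
        proof -
          have "- c0 * (L + z) = - c0 * L + - c0 * z" by (simp add: algebra_simps)
          then have "exp (- c0 * (L + z)) = exp (- c0 * L) * exp (- c0 * z)" by (simp only: exp_add)
          then show ?thesis by simp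
        qed
        also have "\<dots> \<le> C / 4 * exp (- a) * exp (- z) * (2 * (1 + a) * (1 + z))"
        proof -
          have "2 + a + z \<le> 2 * (1 + a) * (1 + z)"
            using a z mult_nonneg_nonneg[of a z] by (simp add: algebra_simps)
          then show ?thesis unfolding eL using C ea a z by (intro mult_mono) auto
        qed
        finally have "r * z \<le> C / 4 * exp (- a) * exp (- z) * (2 * (1 + a) * (1 + z)) * (1 + z)"
          using z r0 by (intro mult_mono) auto
        also have "\<dots> = C / 2 * (1 + a) * exp (- a) * exp (- z) * (1 + z)\<^sup>2"
        proof -
          have "C / 4 * e * e' * (2 * p * q) * q = C / 2 * p * e * e' * (q * q)" for e e' p q :: real
            by simp
          then show ?thesis unfolding power2_eq_square .
        qed
        also have "\<dots> \<le> C / 2 * (1 + a) * exp (- a) * exp (- z) * (16 * exp (z / 2))"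
          using C a by (intro mult_left_mono exp_wins_product z) auto
        also have "\<dots> = (64 * C * (1 + a)) * exp (- a) * exp (- z / 2) / 8"
        proof -
          have "exp (- z) * exp (z / 2) = exp (- z / 2)" by (simp add: mult_exp_exp)
          moreover have "C / 2 * p * e * e' * (16 * f) = (64 * C * p) * e * (e' * f) / 8" for e e' f p :: real
            by simp
          ultimately show ?thesis by (simp only:)
        qed
        also have "\<dots> \<le> exp a * exp (- a) * exp (- z / 2) / 8"
          by (intro divide_right_mono mult_right_mono aC) auto
        also have "\<dots> = 1/8 * exp (- z / 2)" by (simp add: mult_exp_exp)
        also have "\<dots> \<le> (exp (1/8) - 1) * exp (- z / 2)"
          using exp_ge_add_one_self[of "1/8"] by (intro mult_right_mono) auto
        finally show ?thesis .
      qed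
      \<comment> \<open>A nonpositive \<open>G\<close> lies below the front trivially. A positive
        one loses \<open>r * G\<close>, which is at most the gain of the exponential
        correction.\<close>
      show ?case
      proof (cases "G \<le> 0")
        case True
        have "exp (1/8) * exp (- z / 2) \<ge> 1 * exp (- z / 2)" by (intro mult_right_mono) auto
        then have "\<sigma> * (B - exp (1/8) * exp (- z / 2)) \<le> \<sigma> * (B - exp (- z / 2))"
          using \<sigma> by (intro mult_left_mono) auto
        then have "Df (Suc j) z \<le> G" by (simp add: Df_def G_def)
        then show ?thesis using True front_nonneg[of "N + Suc j" "L + z"] by linarith
      next
        case False
        have "exp (1/8 :: real) \<le> 2" using exp_bound[of "1/8"] by (simp add: power2_eq_square)
        then have "exp (1/8) * exp (- z / 2) \<le> 2 * (1 :: real)" using z by (intro mult_mono) auto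
        then have "0 \<le> B - exp (1/8) * exp (- z / 2)" using B by linarith
        then have "0 \<le> \<sigma> * (B - exp (1/8) * exp (- z / 2))" using \<sigma> by (intro mult_nonneg_nonneg) auto
        then have Gz: "G \<le> \<sigma> * z" using Df_up[OF z, of "Suc j"] by (simp add: G_def)
        have "r * G \<le> r * (\<sigma> * z)" by (intro mult_left_mono Gz r0)
        also have "\<dots> = \<sigma> * (r * z)" by simp
        also have "\<dots> \<le> \<sigma> * ((exp (1/8) - 1) * exp (- z / 2))" using \<sigma> by (intro mult_left_mono rz) auto
        finally have "r * G \<le> \<sigma> * ((exp (1/8) - 1) * exp (- z / 2))" .
        moreover have "Df (Suc j) z = G - \<sigma> * ((exp (1/8) - 1) * exp (- z / 2))"
          by (simp add: Df_def G_def algebra_simps)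
        moreover have "(1 - r) * G = G - r * G" by (simp add: left_diff_distrib)
        ultimately have "Df (Suc j) z \<le> (1 - r) * G" by linarith
        also have "\<dots> \<le> (1 - r) * ?V" using r1 by (intro mult_left_mono GV) auto
        finally show ?thesis unfolding front_r .
      qed
    qed
    define j where "j = n - N"
    have j: "N + j = n" "j \<noteq> 0" "real n \<le> 2 * real j" "real j \<le> real n"
      using N n by (auto simp: j_def of_nat_diff)
    have j0: "0 < real j" using j by simp
    have z2: "z0 \<le> 2 * ?s" "2 * z0 / ?s \<le> 1" using big lg a z0 s(1) by (simp_all add: field_simps)
    have "c3 * z0 / ?s = ?s * (1 / (sqrt (2 * pi) * ?s) * exp (- 4) * (2 * z0 / ?s / 2))"
      using s(1) by (simp add: c3_def)
    also have "\<dots> \<le> ?s * (1 / sqrt (2 * pi * real j) * exp (- (2 * ?s)\<^sup>2 / (2 * real j)) * (1 - exp (- 2 * ?s * z0 / real j)))"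
    proof (intro mult_mono order_refl)
      show "1 / (sqrt (2 * pi) * ?s) \<le> 1 / sqrt (2 * pi * real j)"
        using j j0 by (simp only: real_sqrt_mult[symmetric], intro divide_left_mono) auto
      have "(2 * ?s)\<^sup>2 / (2 * real j) \<le> 4" using j j0 by (simp add: power_mult_distrib field_simps)
      then show "exp (- 4) \<le> exp (- (2 * ?s)\<^sup>2 / (2 * real j))" by simp
      have "2 * z0 / ?s / 2 \<le> 1 - exp (- (2 * z0 / ?s))" using z0 z2 s by (intro one_minus_exp_ge) auto
      also have "2 * z0 / ?s \<le> 2 * ?s * z0 / real j"
      proof -
        have "2 * z0 / ?s = 2 * ?s * z0 / real n" using s by (simp add: divide_simps)
        also have "\<dots> \<le> 2 * ?s * z0 / real j" using z0 s j j0 by (intro divide_left_mono) auto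
        finally show ?thesis .
      qed
      then have "1 - exp (- (2 * z0 / ?s)) \<le> 1 - exp (- 2 * ?s * z0 / real j)" by simp
      finally show "2 * z0 / ?s / 2 \<le> 1 - exp (- 2 * ?s * z0 / real j)" .
    qed (use s z0 j0 in auto)
    also have "\<dots> \<le> bump_flow ?s j z0"
      using bump_flow_ge[of ?s j z0 "2 * ?s"] j(2) z0 z2 s(1) by simp
    finally have "\<kappa> / real n * (c3 * z0 / ?s) \<le> \<kappa> / real n * bump_flow ?s j z0"
      using \<kappa> by (intro mult_left_mono) auto
    moreover have "\<kappa> / real n * (c3 * z0 / ?s) = \<sigma> * (B + 1)"
      using c3 unfolding \<sigma>_def n32 by (simp add: z0_def)
    ultimately have "\<sigma> * (B + 1) \<le> \<kappa> / real n * bump_flow ?s j z0" by simp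
    moreover have "\<sigma> * (B - exp (- z0 / 2)) \<le> \<sigma> * B" using \<sigma> by (intro mult_left_mono) auto
    ultimately have "\<sigma> \<le> Df j z0" by (simp add: Df_def distrib_left)
    also have "\<dots> \<le> front n (L + z0)" using main[of j z0] j(1) z0 by simp
    also have "L + z0 = - lag n + (a + z0)" by (simp add: L_def)
    finally show ?thesis by (simp only: \<sigma>_def)
  qed
  then show ?thesis using that[of \<kappa> n0 "a + z0"] \<kappa> by (auto simp: n0_def)
qed

lemma front_lower_tail:
  obtains b \<epsilon> where "0 < \<epsilon>" and "\<And>n. 1 \<le> n \<Longrightarrow> wall n (m_seq n + b) \<le> 1 - \<epsilon>"
proof -
  obtain b \<kappa> n0 where \<kappa>: "0 < \<kappa>" and n0: "1 \<le> n0"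
    and low: "\<And>n. n0 \<le> n \<Longrightarrow> \<kappa> * real n powr (- 3/2) \<le> front n (- lag n + b)"
    by (rule front_lower_eventually) blast
  define e where "e n = 1 - wall n (m_seq n + b)" for n
  \<comment> \<open>Each of the finitely many \<open>n\<close> up to \<open>n0\<close> has its own
    gap, as \<open>wall n\<close> is below 1; the minimum makes the gap uniform.\<close>
  define \<epsilon> where "\<epsilon> = Min (insert (\<kappa> * exp (- c0 * b)) (e ` {1..n0}))"
  have "0 < \<epsilon>" unfolding \<epsilon>_def using \<kappa> wall_less_1 by (subst Min_gr_iff) (auto simp: e_def)
  moreover have "wall n (m_seq n + b) \<le> 1 - \<epsilon>" if n: "1 \<le> n" for n
  proof (cases "n \<le> n0")
    case True
    then have "\<epsilon> \<le> e n" unfolding \<epsilon>_def using n by (intro Min_le) auto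
    then show ?thesis by (simp add: e_def)
  next
    case False
    have np: "0 < real n powr (- 3/2)" using n by simp
    have "front n (- lag n + b) = exp (c0 * b) * exp (- c0 * lag n) * e n"
      by (simp add: front_def m_seq_lag e_def mult_exp_exp algebra_simps)
    then have "\<kappa> * real n powr (- 3/2) \<le> exp (c0 * b) * e n * real n powr (- 3/2)"
      using low[of n] False unfolding exp_lag[OF n] by (simp add: mult_ac)
    then have "\<kappa> \<le> exp (c0 * b) * e n" using np by simp
    then have "exp (- c0 * b) * \<kappa> \<le> exp (- c0 * b) * (exp (c0 * b) * e n)" by (intro mult_left_mono) auto
    also have "\<dots> = e n" by (simp add: exp_minus)
    finally have "\<kappa> * exp (- c0 * b) \<le> e n" by (simp add: mult.commute)
    moreover have "\<epsilon> \<le> \<kappa> * exp (- c0 * b)" unfolding \<epsilon>_def by (intro Min_le) auto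
    ultimately show ?thesis by (simp add: e_def)
  qed
  ultimately show ?thesis by (rule that)
qed

section \<open>The logarithmic derivative at zero\<close>

lemma m_seq_Suc_le: "1 \<le> n \<Longrightarrow> m_seq (Suc n) \<le> m_seq n + c0"
proof -
  assume n: "1 \<le> n"
  have "lag n \<le> lag (Suc n)" unfolding lag_def using n c0_pos by (intro mult_left_mono) auto
  then show ?thesis by (simp add: m_seq_lag distrib_left)
qed

lemma gconv_wall_mono: "u \<le> v \<Longrightarrow> gconv (wall n) u \<le> gconv (wall n) v"
  unfolding gconv_def by (intro integral_mono) (auto intro: wall_mono)

lemma wall_Suc_le: "wall (Suc n) u \<le> gconv (wall n) u"
  by (simp add: power2_eq_square mult_left_le)

lemma gconv_exp:
  fixes \<Lambda> c u :: real
  shows "integrable std_normal_distribution (\<lambda>z. exp (c + \<Lambda> * (u + z)))"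
    and "gconv (\<lambda>v. exp (c + \<Lambda> * v)) u = exp (c + \<Lambda> * u + \<Lambda>\<^sup>2 / 2)"
proof -
  have e: "exp (c + \<Lambda> * (u + z)) = exp (c + \<Lambda> * u) * exp (\<Lambda> * z)" for z
    by (simp add: mult_exp_exp algebra_simps)
  show "integrable std_normal_distribution (\<lambda>z. exp (c + \<Lambda> * (u + z)))"
    unfolding e by (intro integrable_mult_right gauss_integrable_exp)
  have "gconv (\<lambda>v. exp (c + \<Lambda> * v)) u = exp (c + \<Lambda> * u) * exp (\<Lambda>\<^sup>2 / 2)"
    unfolding gconv_def e integral_mult_right_zero gauss_integral_exp ..
  then show "gconv (\<lambda>v. exp (c + \<Lambda> * v)) u = exp (c + \<Lambda> * u + \<Lambda>\<^sup>2 / 2)"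
    by (simp only: mult_exp_exp)
qed

section \<open>Left tail of the maximum\<close>

lemma gconv_wall_le_exp:
  assumes "\<And>v. wall n v \<le> exp (c + \<Lambda> * v)"
  shows "gconv (wall n) u \<le> exp (c + \<Lambda> * u + \<Lambda>\<^sup>2 / 2)"
  unfolding gconv_exp(2)[symmetric] by (intro gconv_mono assms gconv_exp) auto

lemma wall_0_le_exp: "0 \<le> \<Lambda> \<Longrightarrow> wall 0 v \<le> exp (0 + \<Lambda> * v)"
  by (auto simp: mult_nonneg_nonneg)

text \<open>A step up to \<open>d\<close> is handled by monotonicity; a larger one has probability
  at most \<open>exp (1/2 - d)\<close>, by Markov's inequality for \<open>exp Z\<close>.\<close>

lemma gconv_wall_split:
  assumes "wall n u \<le> x" "0 \<le> x"
  shows "gconv (wall n) (u - d) \<le> x + exp (1/2 - d)"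
proof -
  have i: "integrable std_normal_distribution (\<lambda>z. exp (- d + 1 * (0 + z)))" by (rule gconv_exp)
  have e: "(\<integral>z. exp (- d + 1 * (0 + z)) \<partial>std_normal_distribution) = exp (1/2 - d)"
    using gconv_exp(2)[of "- d" 1 0] by (simp add: gconv_def)
  have "gconv (wall n) (u - d) \<le> (\<integral>z. x + exp (- d + 1 * (0 + z)) \<partial>std_normal_distribution)"
    unfolding gconv_def
  proof (rule integral_mono)
    fix z
    show "wall n (u - d + z) \<le> x + exp (- d + 1 * (0 + z))"
    proof (cases "z \<le> d")
      case True
      then have "wall n (u - d + z) \<le> wall n u" by (intro wall_mono) auto
      then show ?thesis using assms exp_ge_zero[of "- d + 1 * (0 + z)"] by linarith
    next
      case False
      then have "1 \<le> exp (- d + 1 * (0 + z))" by simp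
      then show ?thesis using assms wall_le_1[of n "u - d + z"] by linarith
    qed
  qed (use i in auto)
  also have "\<dots> = x + exp (1/2 - d)" using i gauss.prob_space unfolding e[symmetric] by simp
  finally show ?thesis .
qed

lemma exp_small:
  assumes "0 < (\<delta> :: real)" obtains d where "exp (1/2 - d) \<le> \<delta>"
  using that[of "1/2 - ln \<delta>"] assms by simp

text \<open>A bound \<open>x < 1\<close> improves to any number above \<open>x^2\<close> after one generation.\<close>
lemma wall_left_tight:
  assumes \<eta>: "0 < \<eta>"
  obtains s where "\<And>n. 1 \<le> n \<Longrightarrow> wall n (m_seq n - s) \<le> \<eta>"
proof -
  \<comment> \<open>The bounds attainable uniformly in \<open>n\<close>; the shift may depend on
    \<open>x\<close> but not on \<open>n\<close>.\<close>
  define Q where "Q x \<longleftrightarrow> 0 \<le> x \<and> (\<exists>s. \<forall>n\<ge>1. wall n (m_seq n - s) \<le> x)" for x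
  obtain b \<epsilon> where \<epsilon>: "0 < \<epsilon>" and b: "\<And>n. 1 \<le> n \<Longrightarrow> wall n (m_seq n + b) \<le> 1 - \<epsilon>"
    by (rule front_lower_tail) blast
  have "0 \<le> 1 - \<epsilon>" using order_trans[OF wall_nonneg b[of 1]] by simp
  then have Q1: "Q (1 - \<epsilon>)"
    unfolding Q_def using b by (intro conjI exI[of _ "- b"]) auto
  have step: "Q ((x + \<delta>)\<^sup>2)" if Q: "Q x" and \<delta>: "0 < \<delta>" for x \<delta>
  proof -
    obtain s where x: "0 \<le> x" and s: "\<And>n. 1 \<le> n \<Longrightarrow> wall n (m_seq n - s) \<le> x" using Q by (auto simp: Q_def)
    obtain d where d: "exp (1/2 - d) \<le> \<delta>" by (rule exp_small[OF \<delta>])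
    \<comment> \<open>The second entry serves \<open>n = 1\<close>, whose previous generation is the
      step function and outside the scope of \<open>Q\<close>.\<close>
    define s' where "s' = max (s + c0 + d) (m_seq 1 + d)"
    have "wall n (m_seq n - s') \<le> (x + \<delta>)\<^sup>2" if n: "1 \<le> n" for n
    proof -
      obtain k where k: "n = Suc k" using n by (cases n) auto
      have "gconv (wall k) (m_seq n - s') \<le> x + \<delta>"
      proof (cases "k = 0")
        case True
        have "gconv (wall 0) (m_seq n - s') \<le> exp (0 + 1 * (m_seq n - s') + 1\<^sup>2 / 2)"
          by (rule gconv_wall_le_exp[OF wall_0_le_exp]) simp
        also have "\<dots> \<le> exp (1/2 - d)" using k True by (simp add: s'_def)
        finally show ?thesis using d x True by simp
      next
        case False
        then have k1: "1 \<le> k" by simp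
        have "gconv (wall k) (m_seq n - s') \<le> gconv (wall k) (m_seq k - s - d)"
          using m_seq_Suc_le[OF k1] k by (intro gconv_wall_mono) (simp add: s'_def)
        also have "\<dots> \<le> x + exp (1/2 - d)" by (intro gconv_wall_split s k1 x)
        finally show ?thesis using d by simp
      qed
      then show ?thesis unfolding k wall.simps by (intro power_mono) auto
    qed
    then show ?thesis unfolding Q_def by auto
  qed
  define X where "X = Collect Q"
  have X: "1 - \<epsilon> \<in> X" "bdd_below X" "\<And>x. x \<in> X \<Longrightarrow> 0 \<le> x"
    using Q1 by (auto simp: X_def Q_def intro: bdd_belowI[of _ 0])
  let ?i = "Inf X"
  have i: "0 \<le> ?i" "?i \<le> 1 - \<epsilon>" using X by (auto intro!: cInf_greatest cInf_lower)
  \<comment> \<open>Squaring with arbitrarily small loss keeps bounds attainable, so the infimum is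
    at most its own square; being below 1, it is 0.\<close>
  have "?i = 0"
  proof (rule ccontr)
    assume "?i \<noteq> 0"
    then have i0: "0 < ?i" using i by simp
    have "?i * ?i < ?i * 1" using i0 i \<epsilon> by (intro mult_strict_left_mono) auto
    then have "?i < sqrt ?i" by (intro real_less_rsqrt) (simp add: power2_eq_square)
    \<comment> \<open>A third of the gap, so that
      \<open>x + h < ?i + 2 * h < sqrt ?i\<close>.\<close>
    define h where "h = (sqrt ?i - ?i) / 3"
    have h: "0 < h" using \<open>?i < sqrt ?i\<close> by (simp add: h_def)
    then have "Inf X < ?i + h" by simp
    then obtain x where x: "x \<in> X" "x < ?i + h" using cInf_less_iff[of X] X by blast
    have "(x + h)\<^sup>2 \<in> X" using step[of x h] x h by (simp add: X_def)
    then have "?i \<le> (x + h)\<^sup>2" using X by (intro cInf_lower)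
    also have "(x + h)\<^sup>2 < (sqrt ?i)\<^sup>2"
    proof (rule power_strict_mono)
      have "x + (q - i) / 3 < q" if "x < i + (q - i) / 3" "i < q" for q i :: real
        using that by (simp add: field_simps)
      from this[of ?i "sqrt ?i"] show "x + h < sqrt ?i" using x(2) \<open>?i < sqrt ?i\<close> by (simp add: h_def)
    qed (use h X(3)[OF x(1)] in auto)
    finally show False using i0 by simp
  qed
  then obtain x where "x \<in> X" "x < \<eta>" using \<eta> cInf_less_iff[of X \<eta>] X by auto
  then obtain s where "\<And>n. 1 \<le> n \<Longrightarrow> wall n (m_seq n - s) \<le> x" unfolding X_def Q_def by auto
  then show ?thesis using that[of s] \<open>x < \<eta>\<close> by (meson less_imp_le order_trans)
qed

text \<open>One Gaussian step costs the constant factor \<open>E\<close>. Far enough to the left,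
  tightness makes one of the two children contribute at most \<open>2 * \<eta> = 1 / E\<close>, so
  the same \<open>K\<close> survives each generation. Nearer in, \<open>K\<close> is large enough
  for the trivial bound 1.\<close>

lemma wall_left_exponential:
  assumes \<Lambda>: "0 < \<Lambda>"
  obtains K where "1 \<le> K" and "\<And>n s. 1 \<le> n \<Longrightarrow> wall n (m_seq n - s) \<le> K * exp (- \<Lambda> * s)"
proof -
  define E where "E = exp (\<Lambda> * c0 + \<Lambda>\<^sup>2 / 2)"
  have E: "0 < E" by (simp add: E_def)
  define \<eta> where "\<eta> = 1 / (2 * E)"
  have \<eta>: "0 < \<eta>" using E by (simp add: \<eta>_def)
  obtain s0 where s0: "\<And>n. 1 \<le> n \<Longrightarrow> wall n (m_seq n - s0) \<le> \<eta>" by (rule wall_left_tight[OF \<eta>]) blast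
  obtain d where d: "exp (1/2 - d) \<le> \<eta>" by (rule exp_small[OF \<eta>])
  define s1 where "s1 = s0 + c0 + d"
  define K where "K = max 1 (max (exp (\<Lambda> * s1)) (exp (\<Lambda> * m_seq 1 + \<Lambda>\<^sup>2 / 2)))"
  have K: "1 \<le> K" "exp (\<Lambda> * s1) \<le> K" "exp (\<Lambda> * m_seq 1 + \<Lambda>\<^sup>2 / 2) \<le> K" by (auto simp: K_def)
  have "wall (Suc n) (m_seq (Suc n) - s) \<le> K * exp (- \<Lambda> * s)" for n s
  proof (induction n arbitrary: s)
    case 0
    have "wall 1 (m_seq 1 - s) \<le> gconv (wall 0) (m_seq 1 - s)" unfolding One_nat_def by (rule wall_Suc_le)
    also have "\<dots> \<le> exp (0 + \<Lambda> * (m_seq 1 - s) + \<Lambda>\<^sup>2 / 2)"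
      by (rule gconv_wall_le_exp[OF wall_0_le_exp]) (use \<Lambda> in simp)
    also have "\<dots> = exp (\<Lambda> * m_seq 1 + \<Lambda>\<^sup>2 / 2) * exp (- \<Lambda> * s)" by (simp add: mult_exp_exp algebra_simps)
    also have "\<dots> \<le> K * exp (- \<Lambda> * s)" by (intro mult_right_mono K) auto
    finally show ?case by simp
  next
    case (Suc n)
    let ?n = "Suc n"
    show ?case
    proof (cases "s \<le> s1")
      case True
      have "wall (Suc ?n) (m_seq (Suc ?n) - s) \<le> 1" by (rule wall_le_1)
      also have "\<dots> \<le> exp (\<Lambda> * s1) * exp (- \<Lambda> * s)" using True \<Lambda> by (simp add: mult_exp_exp)
      also have "\<dots> \<le> K * exp (- \<Lambda> * s)" by (intro mult_right_mono K) auto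
      finally show ?thesis .
    next
      case False
      define q where "q = gconv (wall ?n) (m_seq ?n + c0 - s)"
      have q0: "0 \<le> q" by (simp add: q_def)
      have "q \<le> gconv (wall ?n) (m_seq ?n - s0 - d)"
        unfolding q_def using False by (intro gconv_wall_mono) (simp add: s1_def)
      also have "\<dots> \<le> \<eta> + exp (1/2 - d)" using \<eta> by (intro gconv_wall_split s0) auto
      finally have q1: "q \<le> 2 * \<eta>" using d by simp
      have "wall ?n v \<le> exp ((ln K - \<Lambda> * m_seq ?n) + \<Lambda> * v)" for v
      proof -
        have "wall ?n v \<le> K * exp (- \<Lambda> * (m_seq ?n - v))" using Suc.IH[of "m_seq ?n - v"] by simp
        also have "\<dots> = exp (ln K) * exp (- \<Lambda> * (m_seq ?n - v))" using K(1) by simp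
        also have "\<dots> = exp ((ln K - \<Lambda> * m_seq ?n) + \<Lambda> * v)"
          by (simp only: mult_exp_exp) (simp add: algebra_simps)
        finally show ?thesis .
      qed
      then have "q \<le> exp ((ln K - \<Lambda> * m_seq ?n) + \<Lambda> * (m_seq ?n + c0 - s) + \<Lambda>\<^sup>2 / 2)"
        unfolding q_def by (rule gconv_wall_le_exp)
      also have "\<dots> = exp (ln K) * (E * exp (- \<Lambda> * s))"
        unfolding E_def by (simp only: mult_exp_exp) (simp add: algebra_simps)
      also have "exp (ln K) = K" using K(1) by simp
      finally have q2: "q \<le> K * (E * exp (- \<Lambda> * s))" .
      have "wall (Suc ?n) (m_seq (Suc ?n) - s) \<le> wall (Suc ?n) (m_seq ?n + c0 - s)"
        using m_seq_Suc_le[of ?n] by (intro wall_mono) auto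
      also have "\<dots> = q * q" by (simp add: q_def power2_eq_square)
      also have "\<dots> \<le> (2 * \<eta>) * (K * (E * exp (- \<Lambda> * s)))"
        using q0 q1 q2 \<eta> by (intro mult_mono) auto
      also have "\<dots> = K * exp (- \<Lambda> * s)" using E by (simp add: \<eta>_def)
      finally show ?thesis .
    qed
  qed
  then have "wall n (m_seq n - s) \<le> K * exp (- \<Lambda> * s)" if "1 \<le> n" for n s
    using that by (cases n) auto
  with K(1) show ?thesis by (rule that)
qed

text \<open>A Gaussian step adds half the squared rate to the exponent, and squaring then doubles
  everything, so the rate becomes \<open>2 ^ k * \<mu>\<close>. Choosing
  \<open>\<mu> = s / 2 ^ k\<close> afterwards yields
  \<open>exp (2 ^ k * C - s\<^sup>2 / 2)\<close>.\<close>

lemma wall_upper_iterate: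
  assumes "\<And>s. wall m (b - s) \<le> exp (C - \<mu> * s)" "0 \<le> C"
  shows "wall (m + k) (b - s) \<le> exp (2 ^ k * C + \<mu>\<^sup>2 * 4 ^ k / 2 - 2 ^ k * \<mu> * s)"
proof -
  have "wall (m + k) (b - s) \<le> exp (2 ^ k * C + \<mu>\<^sup>2 * (4 ^ k - 2 ^ k) / 2 - 2 ^ k * \<mu> * s)" for s
  proof (induction k arbitrary: s)
    case (Suc k)
    let ?c = "2 ^ k * C + \<mu>\<^sup>2 * (4 ^ k - 2 ^ k) / 2" and ?L = "2 ^ k * \<mu>"
    have "wall (m + k) v \<le> exp ((?c - ?L * b) + ?L * v)" for v
      using Suc[of "b - v"] by (simp add: algebra_simps)
    then have "gconv (wall (m + k)) (b - s) \<le> exp ((?c - ?L * b) + ?L * (b - s) + ?L\<^sup>2 / 2)"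
      by (rule gconv_wall_le_exp)
    then have "wall (m + Suc k) (b - s) \<le> (exp ((?c - ?L * b) + ?L * (b - s) + ?L\<^sup>2 / 2))\<^sup>2"
      by (simp add: power_mono)
    also have "\<dots> = exp (2 * ((?c - ?L * b) + ?L * (b - s) + ?L\<^sup>2 / 2))" by (simp only: exp_double)
    also have "2 * ((?c - ?L * b) + ?L * (b - s) + ?L\<^sup>2 / 2)
        = 2 ^ Suc k * C + \<mu>\<^sup>2 * (4 ^ Suc k - 2 ^ Suc k) / 2 - 2 ^ Suc k * \<mu> * s"
    proof -
      have "(2 ^ k :: real)\<^sup>2 = 4 ^ k" by (simp add: power2_eq_square power_mult_distrib[symmetric])
      then have "?L\<^sup>2 = 4 ^ k * \<mu>\<^sup>2" by (simp add: power_mult_distrib)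
      then show ?thesis by (simp add: algebra_simps diff_divide_distrib)
    qed
    finally show ?case .
  qed (use assms in simp)
  moreover have "2 ^ k * C + \<mu>\<^sup>2 * (4 ^ k - 2 ^ k) / 2 - 2 ^ k * \<mu> * s
      \<le> 2 ^ k * C + \<mu>\<^sup>2 * 4 ^ k / 2 - 2 ^ k * \<mu> * s"
    by (intro diff_right_mono add_left_mono divide_right_mono mult_left_mono) auto
  ultimately show ?thesis by (meson exp_le_cancel_iff order_trans)
qed

text \<open>Completing the square by a tilt gives the exact dependence on \<open>x\<close>. The
  remaining normalization, (1 + \<alpha>)^(-1/2), is bounded below by
  \<open>exp (- \<alpha> / 2)\<close> through the tangent line of \<open>exp\<close>, which suffices
  here.\<close>

lemma gauss_integral_gaussian_ge:
  assumes \<alpha>: "0 \<le> \<alpha>"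
  shows "exp (- (\<alpha> / (1 + \<alpha>)) * x\<^sup>2 / 2 - \<alpha> / 2) \<le> (\<integral>z. exp (- \<alpha> * (x - z)\<^sup>2 / 2) \<partial>std_normal_distribution)"
proof -
  \<comment> \<open>The shift at which the product of the two Gaussians is centred; it cancels the
    terms linear in \<open>z\<close>.\<close>
  define t where "t = \<alpha> * x / (1 + \<alpha>)"
  have t: "\<alpha> * (x - t) = t" using \<alpha> by (simp add: t_def field_simps)
  let ?F = "\<lambda>z. exp (- \<alpha> * (x - z)\<^sup>2 / 2 - t * z + t\<^sup>2 / 2)"
  have e1: "exp (t * z - t\<^sup>2 / 2) * ?F z = exp (- \<alpha> * (x - z)\<^sup>2 / 2)" for z by (simp add: mult_exp_exp)
  have e2: "?F (z + t) = exp (- t * x / 2) * exp (- \<alpha> * z\<^sup>2 / 2)" for z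
  proof -
    have "- \<alpha> * (x - (z + t))\<^sup>2 / 2 - t * (z + t) + t\<^sup>2 / 2
      = - (\<alpha> * (x - t)) * (x - t) / 2 + (\<alpha> * (x - t)) * z - \<alpha> * z\<^sup>2 / 2 - t * z - t\<^sup>2 / 2"
      by (simp add: power2_eq_square algebra_simps add_divide_distrib diff_divide_distrib)
    also have "\<dots> = - t * x / 2 - \<alpha> * z\<^sup>2 / 2"
      unfolding t by (simp add: power2_eq_square algebra_simps add_divide_distrib diff_divide_distrib)
    finally show ?thesis by (simp add: mult_exp_exp)
  qed
  have "(\<integral>z. exp (- \<alpha> * (x - z)\<^sup>2 / 2) \<partial>std_normal_distribution)
      = (\<integral>z. exp (t * z - t\<^sup>2 / 2) * ?F z \<partial>std_normal_distribution)" unfolding e1 ..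
  also have "\<dots> = (\<integral>z. ?F (z + t) \<partial>std_normal_distribution)" by (rule gauss_tilt) simp
  also have "\<dots> = exp (- t * x / 2) * (\<integral>z. exp (- \<alpha> * z\<^sup>2 / 2) \<partial>std_normal_distribution)"
    unfolding e2 by simp
  finally have eq: "(\<integral>z. exp (- \<alpha> * (x - z)\<^sup>2 / 2) \<partial>std_normal_distribution)
    = exp (- t * x / 2) * (\<integral>z. exp (- \<alpha> * z\<^sup>2 / 2) \<partial>std_normal_distribution)" .
  have i: "integrable std_normal_distribution (\<lambda>z. exp (- \<alpha> * z\<^sup>2 / 2))"
    by (rule gauss.integrable_const_bound[where B=1]) (use \<alpha> in auto)
  have "exp (- \<alpha> / 2) = (\<integral>z. exp (- \<alpha> / 2) * (1 + \<alpha> / 2 - \<alpha> / 2 * z\<^sup>2) \<partial>std_normal_distribution)"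
    using gauss.prob_space gauss_integral_square by simp
  also have "\<dots> \<le> (\<integral>z. exp (- \<alpha> * z\<^sup>2 / 2) \<partial>std_normal_distribution)"
  proof (rule integral_mono[OF _ i])
    fix z
    have "exp (- \<alpha> / 2) * (1 + (\<alpha> / 2 - \<alpha> * z\<^sup>2 / 2)) \<le> exp (- \<alpha> / 2) * exp (\<alpha> / 2 - \<alpha> * z\<^sup>2 / 2)"
      by (intro mult_left_mono exp_ge_add_one_self) auto
    also have "\<dots> = exp (- \<alpha> * z\<^sup>2 / 2)" by (simp add: mult_exp_exp)
    finally show "exp (- \<alpha> / 2) * (1 + \<alpha> / 2 - \<alpha> / 2 * z\<^sup>2) \<le> exp (- \<alpha> * z\<^sup>2 / 2)" by (simp add: algebra_simps)
  qed simp
  finally have "exp (- t * x / 2) * exp (- \<alpha> / 2) \<le> exp (- t * x / 2) * (\<integral>z. exp (- \<alpha> * z\<^sup>2 / 2) \<partial>std_normal_distribution)"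
    by (intro mult_left_mono) auto
  moreover have "- (\<alpha> / (1 + \<alpha>)) * x\<^sup>2 / 2 - \<alpha> / 2 = - t * x / 2 + - \<alpha> / 2" by (simp add: t_def power2_eq_square)
  ultimately show ?thesis unfolding eq by (simp only: exp_add)
qed

text \<open>One generation turns a Gaussian lower bound of variance \<open>\<beta>\<close> into one of variance \<open>(1 + \<beta>) / 2\<close>; the
  start is \<open>\<beta> = 1/4\<close>.\<close>
lemma wall_lower_iterate:
  fixes b C :: real
  assumes "\<And>u. exp (- 2 * (b - u)\<^sup>2 - C) \<le> wall m u"
  shows "exp (- (b - u)\<^sup>2 / (2 * (1 - 3/4 * (1/2) ^ k)) - (2 ^ k * (C + 4) - 4)) \<le> wall (m + k) u"
proof (induction k arbitrary: u)
  case 0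
  have "- (b - u)\<^sup>2 / (2 * (1 - 3/4 * (1/2) ^ 0)) - (2 ^ 0 * (C + 4) - 4) = - 2 * (b - u)\<^sup>2 - C" by simp
  then show ?case using assms[of u] by (simp add: mult.commute)
next
  case (Suc k)
  define \<beta> :: real where "\<beta> = 1 - 3/4 * (1/2) ^ k"
  have "(1/2 :: real) ^ k \<le> 1" by (simp add: power_le_one)
  then have \<beta>: "1/4 \<le> \<beta>" by (simp add: \<beta>_def)
  \<comment> \<open>The constant solves c' = 2 c + 4: squaring doubles it, and the normalization
    costs \<open>?\<alpha>\<close> per generation, at most 4 since \<beta> is at least 1/4.\<close>
  let ?c = "2 ^ k * (C + 4) - 4"
  let ?\<alpha> = "1 / \<beta>"
  have \<alpha>: "0 \<le> ?\<alpha>" "?\<alpha> \<le> 4" using \<beta> by (auto simp: field_simps)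
  have "exp (- ?c) * exp (- (?\<alpha> / (1 + ?\<alpha>)) * (b - u)\<^sup>2 / 2 - ?\<alpha> / 2)
      \<le> exp (- ?c) * (\<integral>z. exp (- ?\<alpha> * ((b - u) - z)\<^sup>2 / 2) \<partial>std_normal_distribution)"
    by (intro mult_left_mono gauss_integral_gaussian_ge \<alpha>) auto
  also have "\<dots> = (\<integral>z. exp (- ?c) * exp (- ?\<alpha> * ((b - u) - z)\<^sup>2 / 2) \<partial>std_normal_distribution)" by simp
  also have "\<dots> \<le> gconv (wall (m + k)) u"
    unfolding gconv_def
  proof (rule integral_mono)
    show "integrable std_normal_distribution (\<lambda>z. exp (- ?c) * exp (- ?\<alpha> * ((b - u) - z)\<^sup>2 / 2))"
      by (intro integrable_mult_right gauss.integrable_const_bound[where B=1]) (use \<alpha> in auto)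
    fix z
    have "exp (- ?c) * exp (- ?\<alpha> * ((b - u) - z)\<^sup>2 / 2) = exp (- (b - (u + z))\<^sup>2 / (2 * \<beta>) - ?c)"
      by (simp add: mult_exp_exp diff_diff_eq)
    also have "\<dots> \<le> wall (m + k) (u + z)" unfolding \<beta>_def by (rule Suc.IH)
    finally show "exp (- ?c) * exp (- ?\<alpha> * ((b - u) - z)\<^sup>2 / 2) \<le> wall (m + k) (u + z)" .
  qed simp
  finally have "(exp (- ?c) * exp (- (?\<alpha> / (1 + ?\<alpha>)) * (b - u)\<^sup>2 / 2 - ?\<alpha> / 2))\<^sup>2 \<le> wall (m + Suc k) u"
    by (simp add: power_mono)
  also have "(exp (- ?c) * exp (- (?\<alpha> / (1 + ?\<alpha>)) * (b - u)\<^sup>2 / 2 - ?\<alpha> / 2))\<^sup>2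
      = exp (2 * (- ?c + (- (?\<alpha> / (1 + ?\<alpha>)) * (b - u)\<^sup>2 / 2 - ?\<alpha> / 2)))"
    by (simp only: mult_exp_exp exp_double)
  finally have *: "exp (2 * (- ?c + (- (?\<alpha> / (1 + ?\<alpha>)) * (b - u)\<^sup>2 / 2 - ?\<alpha> / 2))) \<le> wall (m + Suc k) u" .
  have 1: "?\<alpha> / (1 + ?\<alpha>) = 1 / (\<beta> + 1)" using \<beta> by (simp add: field_simps)
  have 2: "2 * (1 - 3/4 * (1/2) ^ Suc k) = \<beta> + 1" by (simp add: \<beta>_def)
  have "- (b - u)\<^sup>2 / (2 * (1 - 3/4 * (1/2) ^ Suc k)) = 2 * (- (?\<alpha> / (1 + ?\<alpha>)) * (b - u)\<^sup>2 / 2)"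
  proof -
    have "- x / c = 2 * (- (1 / c) * x / 2)" for x c :: real by simp
    then show ?thesis unfolding 1 2 .
  qed
  then have "- (b - u)\<^sup>2 / (2 * (1 - 3/4 * (1/2) ^ Suc k)) - (2 ^ Suc k * (C + 4) - 4)
      \<le> 2 * (- ?c + (- (?\<alpha> / (1 + ?\<alpha>)) * (b - u)\<^sup>2 / 2 - ?\<alpha> / 2))"
    using \<alpha> by (simp add: algebra_simps)
  then show ?case using * by (meson exp_le_cancel_iff order_trans)
qed

text \<open>Apply semiconcavity at a point where \<open>wall\<close> is at least 1/2. As
  \<open>wall\<close> is at most 1, the logarithmic slope there is at most 2. The variance is at
  least 1/2, so the exponent would be the square of the distance; doubling it absorbs the slope and
  the shift by \<open>a\<close>. This is the start variance 1/4 of the iteration.\<close>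

lemma wall_gaussian_lower:
  obtains C where "0 \<le> C" and "\<And>n u. 1 \<le> n \<Longrightarrow> exp (- 2 * (m_seq n - u)\<^sup>2 - C) \<le> wall n u"
proof -
  obtain a where a: "0 < a" and half: "\<And>n. 1 \<le> n \<Longrightarrow> 1/2 \<le> wall n (m_seq n + a)"
    by (rule front_upper_tail) blast
  define C where "C = ln 2 + 3 * a\<^sup>2 + 2 * a + 2"
  have C: "0 \<le> C" "ln 2 \<le> C" using a by (simp_all add: C_def)
  have "exp (- 2 * (m_seq n - u)\<^sup>2 - C) \<le> wall n u" if n: "1 \<le> n" for n u
  proof -
    define v where "v = m_seq n + a"
    define g where "g = wall' n v / wall n v"
    have h: "1/2 \<le> wall n v" unfolding v_def by (rule half[OF n])
    have "(1/2 :: real) ^ n \<le> (1/2) ^ 1" using n by (intro power_decreasing) auto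
    then have sd: "1 \<le> 2 * (1 - (1/2 :: real) ^ n)" by simp
    have semi: "wall n v * exp (g * s - s\<^sup>2 / (2 * (1 - (1/2) ^ n))) \<le> wall n (v + s)" for s
      unfolding g_def using n by (intro wall_semiconcave) auto
    have semi2: "1/2 * exp (g * s - s\<^sup>2) \<le> wall n (v + s)" for s
    proof -
      have "s\<^sup>2 / (2 * (1 - (1/2) ^ n)) \<le> s\<^sup>2 / 1" using sd by (intro divide_left_mono) auto
      then have "1/2 * exp (g * s - s\<^sup>2) \<le> wall n v * exp (g * s - s\<^sup>2 / (2 * (1 - (1/2) ^ n)))"
        using h by (intro mult_mono) auto
      then show ?thesis using semi[of s] by linarith
    qed
    have "1/2 * exp (g * 1 - 1\<^sup>2) \<le> 1" by (rule order_trans[OF semi2 wall_le_1])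
    then have "exp (g - 1) \<le> 2" by simp
    then have g: "g \<le> 2" using exp_ge_add_one_self[of "g - 1"] by linarith
    have l2: "exp (- ln 2) = (1/2 :: real)" by (simp add: exp_minus)
    show ?thesis
    proof (cases "u \<le> v")
      case True
      define x where "x = m_seq n - u"
      have s: "u - v = - (x + a)" by (simp add: x_def v_def)
      have xa: "0 \<le> x + a" using True s by linarith
      have "2 * (u - v) \<le> g * (u - v)" using g True by (intro mult_right_mono_neg) auto
      moreover have "(u - v)\<^sup>2 \<le> 3/2 * x\<^sup>2 + 3 * a\<^sup>2"
      proof -
        have "0 \<le> (x - 2 * a)\<^sup>2" by simp
        then show ?thesis unfolding s by (simp add: power2_eq_square algebra_simps)
      qed
      moreover have "2 * x \<le> x\<^sup>2 / 2 + 2"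
      proof -
        have "0 \<le> (x - 2)\<^sup>2" by simp
        then show ?thesis by (simp add: power2_eq_square algebra_simps)
      qed
      ultimately have "- 2 * x\<^sup>2 - C \<le> - ln 2 + (g * (u - v) - (u - v)\<^sup>2)"
      proof -
        assume h: "2 * (u - v) \<le> g * (u - v)" "(u - v)\<^sup>2 \<le> 3/2 * x\<^sup>2 + 3 * a\<^sup>2" "2 * x \<le> x\<^sup>2 / 2 + 2"
        have "- 2 * X - (L + 3 * A + 2 * a + 2) \<le> - L + (G - D)"
          if "2 * w \<le> G" "D \<le> 3/2 * X + 3 * A" "2 * x \<le> X / 2 + 2" "w = - (x + a)" for X L A G D w :: real
          using that by (simp add: field_simps)
        from this[OF h s] show ?thesis unfolding C_def .
      qed
      then have "exp (- 2 * x\<^sup>2 - C) \<le> exp (- ln 2) * exp (g * (u - v) - (u - v)\<^sup>2)"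
        unfolding mult_exp_exp by simp
      also have "\<dots> \<le> wall n (v + (u - v))" unfolding l2 by (rule semi2)
      finally show ?thesis by (simp add: x_def)
    next
      case False
      have "exp (- 2 * (m_seq n - u)\<^sup>2 - C) \<le> exp (- ln 2)"
        using C zero_le_power2[of "m_seq n - u"] by (intro iffD2[OF exp_le_cancel_iff]) linarith
      also have "\<dots> \<le> wall n v" unfolding l2 by (rule h)
      also have "\<dots> \<le> wall n u" using False by (intro wall_mono) auto
      finally show ?thesis .
    qed
  qed
  with C(1) show ?thesis by (rule that)
qed

section \<open>The splitting generation and the estimate of the logarithmic derivative\<close>

lemma l_seq_bounds:
  assumes "1 \<le> n"
  shows "(2 :: real) ^ l_seq n \<le> real n" "real n < 2 * 2 ^ l_seq n" "l_seq n < n" "real (l_seq n) \<le> log 2 (real n)"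
proof -
  have f: "0 \<le> \<lfloor>log 2 (real n)\<rfloor>" using assms by simp
  have l: "real (l_seq n) = real_of_int \<lfloor>log 2 (real n)\<rfloor>" using f by (simp add: l_seq_def)
  show le: "real (l_seq n) \<le> log 2 (real n)" unfolding l by simp
  have "(2 :: real) ^ l_seq n = 2 powr real (l_seq n)" by (simp add: powr_realpow)
  also have "\<dots> \<le> 2 powr log 2 (real n)" using le by (intro powr_mono) auto
  also have "\<dots> = real n" using assms by simp
  finally show 1: "(2 :: real) ^ l_seq n \<le> real n" .
  have "real n = 2 powr log 2 (real n)" using assms by simp
  also have "\<dots> < 2 powr (real (l_seq n) + 1)" unfolding l by (intro powr_less_mono) auto
  also have "\<dots> = 2 * 2 ^ l_seq n" by (simp add: powr_add powr_realpow)
  finally show "real n < 2 * 2 ^ l_seq n" .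
  have "real (l_seq n) < 2 ^ l_seq n" by (rule of_nat_less_two_power)
  then show "l_seq n < n" using 1 by linarith
qed

text \<open>Ensures that replacing the variance \<open>1 - (1/2) ^ n\<close> by 1 in semiconcavity
  costs only a constant for shifts of order \<open>n\<close>.\<close>

lemma square_le_two_power: "(real n)\<^sup>2 \<le> 2 * 2 ^ n"
proof (induction n rule: less_induct)
  case (less n)
  show ?case
  proof (cases "n \<le> 3")
    case True
    then have "n = 0 \<or> n = 1 \<or> n = 2 \<or> n = 3" by linarith
    then show ?thesis by (auto simp: power2_eq_square)
  next
    case False
    then obtain k where k: "n = Suc k" "3 \<le> k" by (cases n) auto
    have "(real n)\<^sup>2 = (real k)\<^sup>2 + 2 * real k + 1" using k by (simp add: power2_eq_square algebra_simps)
    also have "\<dots> \<le> 2 * (real k)\<^sup>2"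
    proof -
      have "3 \<le> real k" using k by simp
      moreover from this have "3 * real k \<le> real k * real k" by (intro mult_right_mono) auto
      ultimately show ?thesis unfolding power2_eq_square by linarith
    qed
    also have "\<dots> \<le> 2 * (2 * 2 ^ k)" using less[of k] k by simp
    finally show ?thesis using k by simp
  qed
qed

text \<open>Semiconcavity at 0 is tested against the shifts \<open>-n\<close> and \<open>m_seq (n - l_seq n)\<close>.\<close>
lemma wall_log_derivative_eventually:
  obtains C n0 where "\<And>n. n0 \<le> n \<Longrightarrow> \<bar>wall' n 0 / wall n 0 - m_seq (n - l_seq n)\<bar> \<le> C" "1 \<le> n0"
proof -
  obtain C0 where C0: "0 \<le> C0" and low: "\<And>n u. 1 \<le> n \<Longrightarrow> exp (- 2 * (m_seq n - u)\<^sup>2 - C0) \<le> wall n u"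
    by (rule wall_gaussian_lower) blast
  obtain K where K: "1 \<le> K" and up: "\<And>n s. 1 \<le> n \<Longrightarrow> wall n (m_seq n - s) \<le> K * exp (- 5 * s)"
    by (rule wall_left_exponential[of 5]) auto
  define E1 where "E1 = C0 + 16"
  define E2 where "E2 = ln K"
  have E: "0 \<le> E1" "0 \<le> E2" using C0 K by (simp_all add: E1_def E2_def)
  define E3 where "E3 = 2 * E1 + E2 + 16"
  have "\<forall>\<^sub>F n in sequentially. real n / 2 \<le> real n - log 2 (real n) - 3/2 * ln (real n)"
    by real_asymp
  then obtain n1 where n1: "\<And>n. n1 \<le> n \<Longrightarrow> real n / 2 \<le> real n - log 2 (real n) - 3/2 * ln (real n)"
    by (auto simp: eventually_sequentially)
  have "\<bar>wall' n 0 / wall n 0 - m_seq (n - l_seq n)\<bar> \<le> E3" if nn: "max 1 n1 \<le> n" for n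
  proof -
    have n: "1 \<le> n" "n1 \<le> n" using nn by auto
    let ?l = "l_seq n"
    note l = l_seq_bounds[OF n(1)]
    define m where "m = n - ?l"
    have m: "1 \<le> m" "m + ?l = n" "real m = real n - real ?l" "m \<le> n"
      using l(3) by (auto simp: m_def of_nat_diff)
    define b where "b = m_seq m"
    define A where "A = wall' n 0 / wall n 0"
    have b1: "real n / 2 \<le> b"
    proof -
      have "lag m \<le> 3/2 * ln (real n)"
        unfolding lag_def using c0_ge_1 m by (intro mult_mono) (auto simp: field_simps)
      moreover have "real m \<le> c0 * real m" using c0_ge_1 mult_right_mono[of 1 c0 "real m"] by simp
      ultimately show ?thesis using n1[OF n(2)] l(4) m unfolding b_def m_seq_lag by linarith
    qed
    have b2: "b \<le> 3/2 * real n"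
    proof -
      have "c0 * real m \<le> 3/2 * real n" using c0_less c0_pos m by (intro mult_mono) auto
      then show ?thesis using lag_nonneg[OF m(1)] by (simp add: b_def m_seq_lag)
    qed
    have rn: "1 \<le> real n" using n by simp
    have i: "- b\<^sup>2 / 2 - E1 * real n \<le> ln (wall n 0)"
    proof -
      \<comment> \<open>The variance after \<open>?l\<close> generations misses 1 by
        \<open>3/4 * p\<close>. As \<open>p * n \<le> 2\<close> and \<open>b\<close> is of order
        \<open>n\<close>, this changes the exponent by O(n), and so does the iterated constant
        because \<open>2 ^ ?l \<le> n\<close>.\<close>
      define p where "p = (1/2 :: real) ^ ?l"
      have p: "0 < p" "p \<le> 1" "p * real n \<le> 2" "p * 2 ^ ?l = 1"
        using l(2) by (simp_all add: p_def power_le_one power_divide field_simps)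
      define \<beta> where "\<beta> = 1 - 3/4 * p"
      have \<beta>: "1/4 \<le> \<beta>" using p by (simp add: \<beta>_def)
      have "1 \<le> (1 + 3 * p) * \<beta>"
      proof -
        have "0 \<le> 9/4 * p * (1 - p)" using p by (intro mult_nonneg_nonneg) auto
        then show ?thesis by (simp add: \<beta>_def algebra_simps)
      qed
      then have ib: "1 / \<beta> \<le> 1 + 3 * p" using \<beta> by (simp add: field_simps)
      have "exp (- (b - 0)\<^sup>2 / (2 * \<beta>) - (2 ^ ?l * (C0 + 4) - 4)) \<le> wall (m + ?l) 0"
        unfolding \<beta>_def p_def by (rule wall_lower_iterate) (use low[OF m(1)] in \<open>simp add: b_def\<close>)
      then have 1: "- b\<^sup>2 / (2 * \<beta>) - (2 ^ ?l * (C0 + 4) - 4) \<le> ln (wall n 0)"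
        using wall_pos[of n 0] n unfolding m(2) by (subst ln_ge_iff) auto
      have "b\<^sup>2 / (2 * \<beta>) = b\<^sup>2 / 2 * (1 / \<beta>)" by simp
      also have "\<dots> \<le> b\<^sup>2 / 2 * (1 + 3 * p)" using ib by (intro mult_left_mono) auto
      also have "\<dots> = b\<^sup>2 / 2 + 3/2 * (b\<^sup>2 * p)" by (simp add: algebra_simps)
      also have "b\<^sup>2 * p \<le> 9/4 * 2 * real n"
      proof -
        have "b\<^sup>2 \<le> (3/2 * real n)\<^sup>2" using b1 b2 rn by (intro power_mono) auto
        then have "b\<^sup>2 * p \<le> (3/2 * real n)\<^sup>2 * p" using p by (intro mult_right_mono) auto
        also have "\<dots> = 9/4 * real n * (p * real n)" by (simp add: power2_eq_square)
        also have "\<dots> \<le> 9/4 * real n * 2" using p by (intro mult_left_mono) auto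
        finally show ?thesis by simp
      qed
      finally have 2: "b\<^sup>2 / (2 * \<beta>) \<le> b\<^sup>2 / 2 + 27/4 * real n" by simp
      have "2 ^ ?l * (C0 + 4) \<le> real n * (C0 + 4)" using l(1) C0 by (intro mult_right_mono) auto
      then show ?thesis using 1 2 rn unfolding E1_def by (simp add: algebra_simps)
    qed
    have ii: "ln (wall n (- real n)) \<le> - (b + real n)\<^sup>2 / 2 + E2 * real n"
    proof -
      define s where "s = b + real n"
      \<comment> \<open>The tilt that optimizes the iterated exponential bound. Since
        \<open>s\<close> is at most \<open>5/2 * n\<close> and \<open>n < 2 * 2 ^ ?l\<close>, it is
        at most 5, the rate chosen for the left tail.\<close>
      define \<mu> where "\<mu> = s / 2 ^ ?l"
      have \<mu>: "0 \<le> \<mu>" "\<mu> \<le> 5"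
        using b1 b2 l(2) rn by (simp_all add: \<mu>_def s_def field_simps)
      have "wall m (b - r) \<le> exp (E2 - \<mu> * r)" for r
      proof (cases "0 \<le> r")
        case True
        have "wall m (b - r) \<le> K * exp (- 5 * r)" unfolding b_def by (rule up[OF m(1)])
        also have "\<dots> \<le> K * exp (- \<mu> * r)" using K \<mu> True by (intro mult_left_mono) (auto intro: mult_right_mono)
        also have "\<dots> = exp (E2 - \<mu> * r)" using K by (simp add: E2_def exp_diff exp_minus divide_inverse)
        finally show ?thesis .
      next
        case False
        then have "0 \<le> E2 - \<mu> * r" using E \<mu> mult_nonneg_nonpos[of \<mu> r] by simp
        then show ?thesis using wall_le_1[of m "b - r"] by (meson one_le_exp_iff order_trans)
      qed
      from wall_upper_iterate[OF this E(2), of ?l s]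
      have 1: "wall n (- real n) \<le> exp (2 ^ ?l * E2 + \<mu>\<^sup>2 * 4 ^ ?l / 2 - 2 ^ ?l * \<mu> * s)"
        unfolding m(2) s_def by simp
      have "(2 ^ ?l :: real)\<^sup>2 = 4 ^ ?l" by (simp add: power2_eq_square power_mult_distrib[symmetric])
      then have "\<mu>\<^sup>2 * 4 ^ ?l = s\<^sup>2" by (simp add: \<mu>_def power_divide)
      moreover have "2 ^ ?l * \<mu> * s = s\<^sup>2" by (simp add: \<mu>_def power2_eq_square)
      ultimately have "wall n (- real n) \<le> exp (2 ^ ?l * E2 + s\<^sup>2 / 2 - s\<^sup>2)"
        using 1 by (simp only:)
      then have "ln (wall n (- real n)) \<le> ln (exp (2 ^ ?l * E2 + s\<^sup>2 / 2 - s\<^sup>2))"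
        using wall_pos[of n "- real n"] n by (subst ln_le_cancel_iff) auto
      then have "ln (wall n (- real n)) \<le> 2 ^ ?l * E2 + s\<^sup>2 / 2 - s\<^sup>2" by (simp only: ln_exp)
      moreover have "2 ^ ?l * E2 \<le> real n * E2" using l(1) E by (intro mult_right_mono) auto
      ultimately show ?thesis unfolding s_def by (simp add: mult.commute)
    qed
    \<comment> \<open>Semiconcavity at 0 with the variance replaced by 1.\<close>
    have iii: "ln (wall n 0) + A * t - t\<^sup>2 / 2 - 8 \<le> ln (wall n t)" if t: "\<bar>t\<bar> \<le> 2 * real n" for t
    proof -
      define p where "p = (1/2 :: real) ^ n"
      have "p \<le> (1/2) ^ 1" unfolding p_def using n by (intro power_decreasing) auto
      then have p: "0 < p" "p \<le> 1/2" by (simp_all add: p_def)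
      have "1 \<le> (1 + 2 * p) * (1 - p)"
      proof -
        have "0 \<le> p * (1 - 2 * p)" using p by (intro mult_nonneg_nonneg) auto
        then show ?thesis by (simp add: algebra_simps)
      qed
      then have ip: "1 / (1 - p) \<le> 1 + 2 * p" using p by (simp add: field_simps)
      have "t\<^sup>2 / (2 * (1 - p)) = t\<^sup>2 / 2 * (1 / (1 - p))" by simp
      also have "\<dots> \<le> t\<^sup>2 / 2 * (1 + 2 * p)" using ip by (intro mult_left_mono) auto
      also have "\<dots> = t\<^sup>2 / 2 + t\<^sup>2 * p" by (simp add: algebra_simps)
      also have "t\<^sup>2 * p \<le> 8"
      proof -
        have "t\<^sup>2 \<le> (2 * real n)\<^sup>2" using t power_mono[of "\<bar>t\<bar>" "2 * real n" 2] by simp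
        also have "\<dots> = 4 * (real n)\<^sup>2" by (simp add: power_mult_distrib)
        also have "\<dots> \<le> 4 * (2 * 2 ^ n)" by (intro mult_left_mono square_le_two_power) auto
        finally have "t\<^sup>2 * p \<le> 4 * (2 * 2 ^ n) * p" using p by (intro mult_right_mono) auto
        also have "\<dots> = 8" by (simp add: p_def power_divide)
        finally show ?thesis .
      qed
      finally have tt: "t\<^sup>2 / (2 * (1 - p)) \<le> t\<^sup>2 / 2 + 8" by simp
      have "wall n 0 * exp (A * t - t\<^sup>2 / (2 * (1 - p))) \<le> wall n (0 + t)"
        unfolding A_def p_def using n by (intro wall_semiconcave) auto
      then have "ln (wall n 0 * exp (A * t - t\<^sup>2 / (2 * (1 - p)))) \<le> ln (wall n t)"
        using wall_pos[of n] n by (subst ln_le_cancel_iff) auto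
      then have "ln (wall n 0) + (A * t - t\<^sup>2 / (2 * (1 - p))) \<le> ln (wall n t)"
        using wall_pos[of n 0] n by (subst (asm) ln_mult) auto
      then show ?thesis using tt by linarith
    qed
    \<comment> \<open>The shift \<open>- n\<close>: the three squares combine to
      \<open>b * n\<close>, so the O(n) errors bound \<open>(b - A) * n\<close>.\<close>
    have "b - A \<le> E1 + E2 + 8"
    proof -
      have "ln (wall n 0) + A * (- real n) - (- real n)\<^sup>2 / 2 - 8 \<le> - (b + real n)\<^sup>2 / 2 + E2 * real n"
        using iii[of "- real n"] ii by simp
      then have "- b\<^sup>2 / 2 - E1 * real n - A * real n - (real n)\<^sup>2 / 2 - 8 \<le> - (b + real n)\<^sup>2 / 2 + E2 * real n"
        using i by simp
      then have "(b - A) * real n \<le> (E1 + E2) * real n + 8"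
        by (simp add: power2_eq_square algebra_simps add_divide_distrib diff_divide_distrib)
      also have "\<dots> \<le> (E1 + E2 + 8) * real n" using rn by (simp add: algebra_simps)
      finally show ?thesis using rn by simp
    qed
    \<comment> \<open>The shift \<open>b\<close>, with only the trivial bound 1 at the far end. As
      \<open>b\<close> is at least \<open>n / 2\<close>, dividing by it again leaves a
      constant.\<close>
    moreover have "A - b \<le> 2 * E1 + 16"
    proof -
      have "ln (wall n b) \<le> 0" using wall_pos[of n b] n by (simp add: ln_le_zero_iff)
      then have "- b\<^sup>2 / 2 - E1 * real n + A * b - b\<^sup>2 / 2 - 8 \<le> 0"
        using iii[of b] b1 b2 rn i by simp
      then have "(A - b) * b \<le> E1 * real n + 8" by (simp add: power2_eq_square algebra_simps)
      also have "\<dots> \<le> (E1 + 8) * real n" using rn by (simp add: algebra_simps)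
      also have "\<dots> \<le> (E1 + 8) * (2 * b)" using b1 E by (intro mult_left_mono) auto
      finally have "(A - b) * b \<le> (2 * E1 + 16) * b" by (simp add: algebra_simps)
      then show ?thesis using b1 rn by simp
    qed
    ultimately show ?thesis using E unfolding A_def b_def m_def E3_def by (simp add: abs_le_iff)
  qed
  then show ?thesis using that[of "max 1 n1" E3] by auto
qed

section \<open>The edge increments are independent\<close>

text \<open>Levy uniqueness for the law of \<open>X\<close> under the measure with density \<open>D / d\<close>.\<close>
lemma (in prob_space) weighted_normal_unique:
  fixes X D :: "'a \<Rightarrow> real" and d :: real
  assumes [measurable]: "X \<in> borel_measurable M" "D \<in> borel_measurable M"
    and D: "\<And>\<omega>. 0 \<le> D \<omega>" "\<And>\<omega>. D \<omega> \<le> 2"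
    and char: "\<And>s. (\<integral>\<omega>. D \<omega> *\<^sub>R iexp (s * X \<omega>) \<partial>M) = complex_of_real (d * exp (- s\<^sup>2 / 2))"
    and [measurable]: "B \<in> sets borel"
  shows "(\<integral>\<omega>. D \<omega> * indicator B (X \<omega>) \<partial>M) = d * measure std_normal_distribution B"
proof -
  have iD: "integrable M D" by (rule integrable_const_bound[where B=2]) (use D in auto)
  \<comment> \<open>Frequency 0 identifies \<open>d\<close> as the total mass of the weight.\<close>
  have "complex_of_real (\<integral>\<omega>. D \<omega> \<partial>M) = complex_of_real d"
    using char[of 0] iD by (simp add: scaleR_conv_of_real del: of_real_eq_iff)
  then have d: "(\<integral>\<omega>. D \<omega> \<partial>M) = d" by (simp only: of_real_eq_iff)
  then have d0: "0 \<le> d" using D by (metis integral_nonneg_AE AE_I2)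
  show ?thesis
  proof (cases "d = 0")
    case True
    then have "AE \<omega> in M. D \<omega> = 0"
      using integral_nonneg_eq_0_iff_AE[OF iD] d D by auto
    then have "AE \<omega> in M. D \<omega> * indicator B (X \<omega>) = 0" by eventually_elim simp
    then have "(\<integral>\<omega>. D \<omega> * indicator B (X \<omega>) \<partial>M) = (\<integral>\<omega>. 0 \<partial>M)" by (intro integral_cong_AE) auto
    then show ?thesis using True by simp
  next
    case False
    then have dp: "0 < d" using d0 by simp
    define M' where "M' = density M (\<lambda>\<omega>. ennreal (D \<omega> / d))"
    have Dd: "0 \<le> D \<omega> / d" for \<omega> using D dp by simp
    have sM': "sets M' = sets M" "space M' = space M" by (simp_all add: M'_def)
    have "emeasure M' (space M') = (\<integral>\<^sup>+\<omega>. ennreal (D \<omega> / d) \<partial>M)"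
      by (simp add: M'_def emeasure_density cong: nn_integral_cong)
    also have "\<dots> = ennreal (\<integral>\<omega>. D \<omega> / d \<partial>M)" using iD Dd by (intro nn_integral_eq_integral) auto
    also have "\<dots> = 1" using d dp by simp
    finally interpret M': prob_space M' by (intro prob_spaceI)
    have X': "X \<in> borel_measurable M'" by (simp add: M'_def)
    define \<nu> where "\<nu> = distr M' borel X"
    have \<nu>: "real_distribution \<nu>"
      unfolding \<nu>_def using X' by (intro M'.real_distribution_distr)
    have "char \<nu> = char std_normal_distribution"
    proof
      fix s
      have "char \<nu> s = (\<integral>\<omega>. iexp (s * X \<omega>) \<partial>M')"
        unfolding char_def \<nu>_def using X' by (subst integral_distr) auto
      also have "\<dots> = (\<integral>\<omega>. (D \<omega> / d) *\<^sub>R iexp (s * X \<omega>) \<partial>M)"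
        unfolding M'_def using Dd by (subst integral_density) auto
      also have "\<dots> = (\<integral>\<omega>. (1 / d) *\<^sub>R (D \<omega> *\<^sub>R iexp (s * X \<omega>)) \<partial>M)" by simp
      also have "\<dots> = (1 / d) *\<^sub>R complex_of_real (d * exp (- s\<^sup>2 / 2))" by (simp only: Bochner_Integration.integral_scaleR_right char)
      also have "\<dots> = complex_of_real (exp (- s\<^sup>2 / 2))" using dp by (simp add: scaleR_conv_of_real)
      finally show "char \<nu> s = char std_normal_distribution s" by (simp add: char_std_normal_distribution)
    qed
    then have "\<nu> = std_normal_distribution" by (intro Levy_uniqueness \<nu> real_distribution_gauss)
    then have "measure std_normal_distribution B = (\<integral>x. indicator B x \<partial>\<nu>)" by simp
    also have "\<dots> = (\<integral>\<omega>. indicator B (X \<omega>) \<partial>M')"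
      unfolding \<nu>_def using X' by (subst integral_distr) auto
    also have "\<dots> = (\<integral>\<omega>. (D \<omega> / d) *\<^sub>R indicator B (X \<omega>) \<partial>M)"
      unfolding M'_def using Dd by (subst integral_density) auto
    also have "\<dots> = (\<integral>\<omega>. D \<omega> * indicator B (X \<omega>) \<partial>M) / d" by simp
    finally show ?thesis using dp by (simp add: field_simps)
  qed
qed

text \<open>Coordinates move one at a time from the characteristic function to the product of indicators.
  Taking \<open>1 + cos\<close> and \<open>1 + sin\<close> of the remaining combination as weights avoids signed measures.\<close>
lemma (in prob_space) normal_family_partial:
  fixes X :: "'i \<Rightarrow> 'a \<Rightarrow> real"
  assumes F: "finite F" and X: "\<And>i. i \<in> F \<Longrightarrow> X i \<in> borel_measurable M"
    and char: "\<And>t. (\<integral>\<omega>. iexp (\<Sum>i\<in>F. t i * X i \<omega>) \<partial>M) = exp (- (\<Sum>i\<in>F. (t i)\<^sup>2) / 2)"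
    and B: "\<And>i. i \<in> F \<Longrightarrow> B i \<in> sets borel"
    and KJ: "K \<union> J \<subseteq> F" "K \<inter> J = {}"
  shows "(\<integral>\<omega>. (\<Prod>i\<in>K. indicator (B i) (X i \<omega>)) *\<^sub>R iexp (\<Sum>i\<in>J. t i * X i \<omega>) \<partial>M)
    = (\<Prod>i\<in>K. measure std_normal_distribution (B i)) * exp (- (\<Sum>i\<in>J. (t i)\<^sup>2) / 2)"
proof -
  have "finite K" using KJ F finite_subset by blast
  then show ?thesis using KJ
  proof (induction K arbitrary: J t rule: finite_induct)
    case empty
    have "(\<Sum>i\<in>F. (if i \<in> J then t i else 0) * X i \<omega>) = (\<Sum>i\<in>J. t i * X i \<omega>)" for \<omega>
      using empty F by (intro sum.mono_neutral_cong_right) auto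
    moreover have "(\<Sum>i\<in>F. (if i \<in> J then t i else 0)\<^sup>2) = (\<Sum>i\<in>J. (t i)\<^sup>2)"
      using empty F by (intro sum.mono_neutral_cong_right) auto
    ultimately show ?case using char[of "\<lambda>i. if i \<in> J then t i else 0"] by simp
  next
    case (insert k K)
    have kJ: "k \<notin> J" "k \<in> F" "J \<subseteq> F" "K \<subseteq> F" "finite J" using insert.prems F finite_subset by auto
    have [measurable]: "X k \<in> borel_measurable M" "B k \<in> sets borel" using X B kJ by auto
    define W where "W \<omega> = (\<Prod>i\<in>K. indicator (B i) (X i \<omega>) :: real)" for \<omega>
    define \<theta> where "\<theta> \<omega> = (\<Sum>i\<in>J. t i * X i \<omega>)" for \<omega>
    have [measurable]: "W \<in> borel_measurable M"
      unfolding W_def using X B kJ by (intro borel_measurable_prod measurable_compose[OF X]) (auto intro: borel_measurable_indicator)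
    have [measurable]: "\<theta> \<in> borel_measurable M"
      unfolding \<theta>_def using X kJ by (intro borel_measurable_sum borel_measurable_times) auto
    have W: "0 \<le> W \<omega>" "W \<omega> \<le> 1" for \<omega>
      unfolding W_def by (auto intro!: prod_nonneg prod_le_1)
    let ?c = "\<Prod>i\<in>K. measure std_normal_distribution (B i)"
    let ?e = "exp (- (\<Sum>i\<in>J. (t i)\<^sup>2) / 2)"
    \<comment> \<open>\<epsilon> will be 0, 1 and -1: Euler's formula writes the weights with
      \<open>cos\<close> and \<open>sin\<close> through these three cases.\<close>
    have base: "(\<integral>\<omega>. W \<omega> *\<^sub>R iexp (\<epsilon> * \<theta> \<omega> + s * X k \<omega>) \<partial>M)
        = complex_of_real (?c * exp (- (\<epsilon>\<^sup>2 * (\<Sum>i\<in>J. (t i)\<^sup>2)) / 2) * exp (- s\<^sup>2 / 2))" for \<epsilon> s :: real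
    proof -
      let ?t = "\<lambda>i. if i = k then s else \<epsilon> * t i"
      have 1: "(\<Sum>i\<in>insert k J. ?t i * X i \<omega>) = \<epsilon> * \<theta> \<omega> + s * X k \<omega>" for \<omega>
        using kJ by (simp add: \<theta>_def sum_distrib_left mult.assoc) (rule sum.cong, auto)
      have "(\<Sum>i\<in>J. (?t i)\<^sup>2) = (\<Sum>i\<in>J. \<epsilon>\<^sup>2 * (t i)\<^sup>2)"
        using kJ by (intro sum.cong) (auto simp: power_mult_distrib)
      then have 2: "(\<Sum>i\<in>insert k J. (?t i)\<^sup>2) = \<epsilon>\<^sup>2 * (\<Sum>i\<in>J. (t i)\<^sup>2) + s\<^sup>2"
        using kJ by (simp add: sum_distrib_left)
      have "K \<union> insert k J \<subseteq> F" "K \<inter> insert k J = {}" using insert by auto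
      from insert.IH[OF this, of ?t]
      have "(\<integral>\<omega>. W \<omega> *\<^sub>R iexp (\<epsilon> * \<theta> \<omega> + s * X k \<omega>) \<partial>M)
          = complex_of_real (?c * exp (- (\<epsilon>\<^sup>2 * (\<Sum>i\<in>J. (t i)\<^sup>2) + s\<^sup>2) / 2))"
        unfolding W_def[symmetric] 1 2 .
      also have "exp (- (\<epsilon>\<^sup>2 * (\<Sum>i\<in>J. (t i)\<^sup>2) + s\<^sup>2) / 2)
          = exp (- (\<epsilon>\<^sup>2 * (\<Sum>i\<in>J. (t i)\<^sup>2)) / 2) * exp (- s\<^sup>2 / 2)"
        by (simp add: mult_exp_exp add_divide_distrib)
      finally show ?thesis by (simp only: mult.assoc)
    qed
    have int: "integrable M (\<lambda>\<omega>. W \<omega> *\<^sub>R iexp (\<epsilon> * \<theta> \<omega> + s * X k \<omega>))" for \<epsilon> s :: real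
      by (rule integrable_const_bound[where B=1]) (use W in \<open>auto simp: norm_mult\<close>)
    have cW: "(\<integral>\<omega>. W \<omega> * indicator (B k) (X k \<omega>) \<partial>M) = ?c * measure std_normal_distribution (B k)"
    proof (rule weighted_normal_unique)
      show "(\<integral>\<omega>. W \<omega> *\<^sub>R iexp (s * X k \<omega>) \<partial>M) = complex_of_real (?c * exp (- s\<^sup>2 / 2))" for s
        using base[of 0 s] by simp
    qed (use W in \<open>auto intro: order_trans[of _ 1]\<close>)
    have cosW: "(\<integral>\<omega>. (W \<omega> * (1 + cos (\<theta> \<omega>))) * indicator (B k) (X k \<omega>) \<partial>M) = (?c + ?c * ?e) * measure std_normal_distribution (B k)"
    proof (rule weighted_normal_unique)
      fix s
      have "(W \<omega> * (1 + cos (\<theta> \<omega>))) *\<^sub>R iexp (s * X k \<omega>) = W \<omega> *\<^sub>R iexp (0 * \<theta> \<omega> + s * X k \<omega>)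
          + (1/2) *\<^sub>R (W \<omega> *\<^sub>R iexp (1 * \<theta> \<omega> + s * X k \<omega>) + W \<omega> *\<^sub>R iexp ((-1) * \<theta> \<omega> + s * X k \<omega>))" for \<omega>
        by (simp add: complex_eq_iff Re_exp Im_exp cos_add sin_add cos_diff sin_diff algebra_simps)
      then have "(\<integral>\<omega>. (W \<omega> * (1 + cos (\<theta> \<omega>))) *\<^sub>R iexp (s * X k \<omega>) \<partial>M)
        = (\<integral>\<omega>. W \<omega> *\<^sub>R iexp (0 * \<theta> \<omega> + s * X k \<omega>) \<partial>M)
          + (1/2) *\<^sub>R ((\<integral>\<omega>. W \<omega> *\<^sub>R iexp (1 * \<theta> \<omega> + s * X k \<omega>) \<partial>M) + (\<integral>\<omega>. W \<omega> *\<^sub>R iexp ((-1) * \<theta> \<omega> + s * X k \<omega>) \<partial>M))"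
        by (simp only: Bochner_Integration.integral_add Bochner_Integration.integral_scaleR_right int
            Bochner_Integration.integrable_add Bochner_Integration.integrable_scaleR_right)
      also have "\<dots> = complex_of_real ((?c + ?c * ?e) * exp (- s\<^sup>2 / 2))"
        unfolding base by (simp add: scaleR_conv_of_real algebra_simps)
      finally show "(\<integral>\<omega>. (W \<omega> * (1 + cos (\<theta> \<omega>))) *\<^sub>R iexp (s * X k \<omega>) \<partial>M) = complex_of_real ((?c + ?c * ?e) * exp (- s\<^sup>2 / 2))" .
    next
      fix \<omega>
      have c: "0 \<le> 1 + cos (\<theta> \<omega>)" "1 + cos (\<theta> \<omega>) \<le> 2" using cos_ge_minus_one[of "\<theta> \<omega>"] cos_le_one[of "\<theta> \<omega>"] by linarith+
      show "0 \<le> W \<omega> * (1 + cos (\<theta> \<omega>))" using W c by simp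
      show "W \<omega> * (1 + cos (\<theta> \<omega>)) \<le> 2" using mult_mono[OF W(2)[of \<omega>] c(2)] W c by simp
    qed measurable
    have sinW: "(\<integral>\<omega>. (W \<omega> * (1 + sin (\<theta> \<omega>))) * indicator (B k) (X k \<omega>) \<partial>M) = ?c * measure std_normal_distribution (B k)"
    proof (rule weighted_normal_unique)
      fix s
      have "(W \<omega> * (1 + sin (\<theta> \<omega>))) *\<^sub>R iexp (s * X k \<omega>) = W \<omega> *\<^sub>R iexp (0 * \<theta> \<omega> + s * X k \<omega>)
          + (- \<i> / 2) * (W \<omega> *\<^sub>R iexp (1 * \<theta> \<omega> + s * X k \<omega>) - W \<omega> *\<^sub>R iexp ((-1) * \<theta> \<omega> + s * X k \<omega>))" for \<omega>
        by (simp add: complex_eq_iff Re_exp Im_exp cos_add sin_add cos_diff sin_diff algebra_simps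
            add_divide_distrib diff_divide_distrib)
      then have "(\<integral>\<omega>. (W \<omega> * (1 + sin (\<theta> \<omega>))) *\<^sub>R iexp (s * X k \<omega>) \<partial>M)
        = (\<integral>\<omega>. W \<omega> *\<^sub>R iexp (0 * \<theta> \<omega> + s * X k \<omega>) \<partial>M)
          + (- \<i> / 2) * ((\<integral>\<omega>. W \<omega> *\<^sub>R iexp (1 * \<theta> \<omega> + s * X k \<omega>) \<partial>M) - (\<integral>\<omega>. W \<omega> *\<^sub>R iexp ((-1) * \<theta> \<omega> + s * X k \<omega>) \<partial>M))"
        by (simp only: Bochner_Integration.integral_add Bochner_Integration.integral_diff integral_mult_right_zero
            int Bochner_Integration.integrable_diff integrable_mult_right)
      also have "\<dots> = complex_of_real (?c * exp (- s\<^sup>2 / 2))"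
        unfolding base by simp
      finally show "(\<integral>\<omega>. (W \<omega> * (1 + sin (\<theta> \<omega>))) *\<^sub>R iexp (s * X k \<omega>) \<partial>M) = complex_of_real (?c * exp (- s\<^sup>2 / 2))" .
    next
      fix \<omega>
      have c: "0 \<le> 1 + sin (\<theta> \<omega>)" "1 + sin (\<theta> \<omega>) \<le> 2" using sin_ge_minus_one[of "\<theta> \<omega>"] sin_le_one[of "\<theta> \<omega>"] by linarith+
      show "0 \<le> W \<omega> * (1 + sin (\<theta> \<omega>))" using W c by simp
      show "W \<omega> * (1 + sin (\<theta> \<omega>)) \<le> 2" using mult_mono[OF W(2)[of \<omega>] c(2)] W c by simp
    qed measurable
    let ?m = "measure std_normal_distribution (B k)"
    let ?I = "\<lambda>\<omega>. indicator (B k) (X k \<omega>) :: real"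
    have i1: "integrable M (\<lambda>\<omega>. W \<omega> * ?I \<omega>)"
      by (rule integrable_const_bound[where B=1]) (use W in \<open>auto split: split_indicator\<close>)
    have i2: "integrable M (\<lambda>\<omega>. W \<omega> * cos (\<theta> \<omega>) * ?I \<omega>)" and i3: "integrable M (\<lambda>\<omega>. W \<omega> * sin (\<theta> \<omega>) * ?I \<omega>)"
      by (rule integrable_const_bound[where B=1];
          use W in \<open>auto split: split_indicator simp: abs_mult intro!: mult_le_one\<close>)+
    have "(\<integral>\<omega>. (W \<omega> * (1 + cos (\<theta> \<omega>))) * ?I \<omega> \<partial>M) = (\<integral>\<omega>. W \<omega> * ?I \<omega> \<partial>M) + (\<integral>\<omega>. W \<omega> * cos (\<theta> \<omega>) * ?I \<omega> \<partial>M)"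
      using i1 i2 by (simp add: distrib_left distrib_right)
    then have c: "(\<integral>\<omega>. W \<omega> * cos (\<theta> \<omega>) * ?I \<omega> \<partial>M) = ?c * ?e * ?m" using cosW cW by (simp add: distrib_right)
    have "(\<integral>\<omega>. (W \<omega> * (1 + sin (\<theta> \<omega>))) * ?I \<omega> \<partial>M) = (\<integral>\<omega>. W \<omega> * ?I \<omega> \<partial>M) + (\<integral>\<omega>. W \<omega> * sin (\<theta> \<omega>) * ?I \<omega> \<partial>M)"
      using i1 i3 by (simp add: distrib_left distrib_right)
    then have s: "(\<integral>\<omega>. W \<omega> * sin (\<theta> \<omega>) * ?I \<omega> \<partial>M) = 0" using sinW cW by simp
    have "(\<Prod>i\<in>insert k K. indicator (B i) (X i \<omega>)) *\<^sub>R iexp (\<Sum>i\<in>J. t i * X i \<omega>)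
        = complex_of_real (W \<omega> * cos (\<theta> \<omega>) * ?I \<omega>) + \<i> * complex_of_real (W \<omega> * sin (\<theta> \<omega>) * ?I \<omega>)" for \<omega>
    proof -
      have "(\<Prod>i\<in>insert k K. indicator (B i) (X i \<omega>) :: real) = W \<omega> * ?I \<omega>"
        using insert.hyps by (simp add: W_def mult.commute)
      then show ?thesis unfolding \<theta>_def[symmetric] by (simp add: complex_eq_iff Re_exp Im_exp)
    qed
    then have "(\<integral>\<omega>. (\<Prod>i\<in>insert k K. indicator (B i) (X i \<omega>)) *\<^sub>R iexp (\<Sum>i\<in>J. t i * X i \<omega>) \<partial>M)
        = (\<integral>\<omega>. complex_of_real (W \<omega> * cos (\<theta> \<omega>) * ?I \<omega>) + \<i> * complex_of_real (W \<omega> * sin (\<theta> \<omega>) * ?I \<omega>) \<partial>M)"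
      by (simp only:)
    also have "\<dots> = complex_of_real (\<integral>\<omega>. W \<omega> * cos (\<theta> \<omega>) * ?I \<omega> \<partial>M) + \<i> * complex_of_real (\<integral>\<omega>. W \<omega> * sin (\<theta> \<omega>) * ?I \<omega> \<partial>M)"
      using i2 i3 by (subst Bochner_Integration.integral_add) (auto simp del: of_real_mult)
    also have "\<dots> = complex_of_real (?c * ?e * ?m)" unfolding c s by simp
    finally show ?case using insert.hyps by (simp add: ac_simps)
  qed
qed

text \<open>With \<open>J\<close> empty the partial formula is the product rule for boxes: on single
  indices it gives the marginal laws, on all of \<open>F\<close> independence.\<close>

lemma (in prob_space) indep_normal_from_char:
  fixes X :: "'i \<Rightarrow> 'a \<Rightarrow> real"
  assumes F: "finite F" "F \<noteq> {}" and X: "\<And>i. i \<in> F \<Longrightarrow> X i \<in> borel_measurable M"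
    and char: "\<And>t. (\<integral>\<omega>. iexp (\<Sum>i\<in>F. t i * X i \<omega>) \<partial>M) = exp (- (\<Sum>i\<in>F. (t i)\<^sup>2) / 2)"
  shows "indep_vars (\<lambda>_. borel) X F" and "\<And>i. i \<in> F \<Longrightarrow> distr M borel (X i) = std_normal_distribution"
proof -
  have box: "prob (\<Inter>i\<in>K. X i -` B i \<inter> space M) = (\<Prod>i\<in>K. measure std_normal_distribution (B i))"
    if K: "K \<subseteq> F" "K \<noteq> {}" and B: "\<And>i. i \<in> F \<Longrightarrow> B i \<in> sets borel" for K B
  proof -
    have "finite K" using K F finite_subset by blast
    let ?S = "\<Inter>i\<in>K. X i -` B i \<inter> space M"
    have S: "?S \<in> sets M" using K B X \<open>finite K\<close> by (intro sets.finite_INT measurable_sets) auto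
    have "complex_of_real (prob ?S) = complex_of_real (\<integral>\<omega>. indicator ?S \<omega> \<partial>M)" using S by simp
    also have "((\<integral>\<omega>. indicator ?S \<omega> \<partial>M) :: real) = (\<integral>\<omega>. (\<Prod>i\<in>K. indicator (B i) (X i \<omega>)) \<partial>M)"
    proof (rule Bochner_Integration.integral_cong[OF refl])
      fix \<omega> assume "\<omega> \<in> space M"
      then show "indicator ?S \<omega> = (\<Prod>i\<in>K. indicator (B i) (X i \<omega>) :: real)"
        using K \<open>finite K\<close> by (auto simp: indicator_def prod_eq_1_iff intro!: prod_zero[symmetric] split: if_splits)
    qed
    also have "complex_of_real \<dots> = (\<integral>\<omega>. (\<Prod>i\<in>K. indicator (B i) (X i \<omega>)) *\<^sub>R iexp (\<Sum>i\<in>{}. 0 * X i \<omega>) \<partial>M)"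
      by (subst integral_complex_of_real[symmetric]) (simp add: scaleR_conv_of_real)
    also have "\<dots> = complex_of_real (\<Prod>i\<in>K. measure std_normal_distribution (B i))"
    proof -
      have "K \<union> {} \<subseteq> F" "K \<inter> {} = {}" using K by auto
      from normal_family_partial[where t="\<lambda>_. 0", OF F(1) X char B this] show ?thesis by simp
    qed
    finally show ?thesis by (simp only: of_real_eq_iff)
  qed
  have single: "prob (X i -` C \<inter> space M) = measure std_normal_distribution C" if "i \<in> F" "C \<in> sets borel" for i C
    using box[of "{i}" "\<lambda>_. C"] that by simp
  show "indep_vars (\<lambda>_. borel) X F"
  proof (subst indep_vars_finite[where E="\<lambda>_. sets borel"])
    show "\<forall>A\<in>F \<rightarrow> sets borel. prob (\<Inter>j\<in>F. X j -` A j \<inter> space M) = (\<Prod>j\<in>F. prob (X j -` A j \<inter> space M))"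
      using box[of F] F single by (auto simp: Pi_iff)
  qed (use F X in \<open>auto simp: Int_stable_def sets.sigma_sets_eq[of borel, unfolded space_borel]\<close>)
  show "distr M borel (X i) = std_normal_distribution" if i: "i \<in> F" for i
  proof (rule measure_eqI)
    fix C assume C: "C \<in> sets (distr M borel (X i))"
    then have C': "C \<in> sets borel" by simp
    have "emeasure (distr M borel (X i)) C = ennreal (prob (X i -` C \<inter> space M))"
      using C' X[OF i] by (simp add: emeasure_distr emeasure_eq_measure)
    also have "\<dots> = ennreal (measure std_normal_distribution C)" unfolding single[OF i C'] ..
    also have "\<dots> = emeasure std_normal_distribution C" by (rule gauss.emeasure_eq_measure[symmetric])
    finally show "emeasure (distr M borel (X i)) C = emeasure std_normal_distribution C" .
  qed simp
qed

section \<open>Moments and characteristic function of a Gaussian variable\<close>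

context prob_space begin

lemma normal_density_square_integrable:
  assumes D: "distributed M lborel X (\<lambda>x. ennreal (normal_density \<mu> \<sigma> x))" and \<sigma>: "0 < \<sigma>"
  shows "integrable M X" "integrable M (\<lambda>\<omega>. (X \<omega>)\<^sup>2)"
proof -
  have "integrable lborel (\<lambda>x. normal_density \<mu> \<sigma> x * x)" using integrable_normal_moment_nz_1[OF \<sigma>] .
  then show "integrable M X"
    using distributed_integrable[OF D, of "\<lambda>x. x"] by (simp add: normal_density_nonneg)
  have "integrable lborel (\<lambda>x. normal_density \<mu> \<sigma> x * (x - \<mu>) ^ 2)" by (rule integrable_normal_moment[OF \<sigma>])
  then have i: "integrable M (\<lambda>\<omega>. (X \<omega> - \<mu>)\<^sup>2)"
    using distributed_integrable[OF D, of "\<lambda>x. (x - \<mu>)\<^sup>2"] by (simp add: normal_density_nonneg)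
  have "integrable M (\<lambda>\<omega>. (X \<omega> - \<mu>)\<^sup>2 + 2 * \<mu> * X \<omega> - \<mu>\<^sup>2)"
    using i \<open>integrable M X\<close> by simp
  also have "(\<lambda>\<omega>. (X \<omega> - \<mu>)\<^sup>2 + 2 * \<mu> * X \<omega> - \<mu>\<^sup>2) = (\<lambda>\<omega>. (X \<omega>)\<^sup>2)"
    by (simp add: power2_eq_square algebra_simps fun_eq_iff)
  finally show "integrable M (\<lambda>\<omega>. (X \<omega>)\<^sup>2)" .
qed

lemma gaussian_rv_square_integrable:
  assumes "gaussian_rv M X"
  shows "integrable M X" "integrable M (\<lambda>\<omega>. (X \<omega>)\<^sup>2)"
proof -
  have [measurable]: "X \<in> borel_measurable M" using assms by (simp add: gaussian_rv_def)
  consider \<mu> \<sigma> where "0 < \<sigma>" "distributed M lborel X (normal_density \<mu> \<sigma>)" | \<mu> where "AE \<omega> in M. X \<omega> = \<mu>"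
    using assms by (auto simp: gaussian_rv_def)
  then have "integrable M X \<and> integrable M (\<lambda>\<omega>. (X \<omega>)\<^sup>2)"
  proof cases
    case 1
    then show ?thesis using normal_density_square_integrable[of X \<mu> \<sigma>] by auto
  next
    case 2
    have "integrable M X" by (rule integrable_const_bound[where B="\<bar>\<mu>\<bar>"]) (use 2 in auto)
    moreover have "integrable M (\<lambda>\<omega>. (X \<omega>)\<^sup>2)"
      by (rule integrable_const_bound[where B="\<mu>\<^sup>2"]) (use 2 in auto)
    ultimately show ?thesis ..
  qed
  then show "integrable M X" "integrable M (\<lambda>\<omega>. (X \<omega>)\<^sup>2)" by auto
qed

lemma gaussian_rv_char:
  assumes "gaussian_rv M X" and mean: "expectation X = 0"
  shows "(\<integral>\<omega>. iexp (X \<omega>) \<partial>M) = complex_of_real (exp (- expectation (\<lambda>\<omega>. (X \<omega>)\<^sup>2) / 2))"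
proof -
  have [measurable]: "X \<in> borel_measurable M" using assms by (simp add: gaussian_rv_def)
  consider \<mu> \<sigma> where "0 < \<sigma>" "distributed M lborel X (normal_density \<mu> \<sigma>)" | \<mu> where "AE \<omega> in M. X \<omega> = \<mu>"
    using assms by (auto simp: gaussian_rv_def)
  then show ?thesis
  proof cases
    case 1
    have \<mu>: "\<mu> = 0" using normal_distributed_expectation[OF 1] mean by simp
    have var: "expectation (\<lambda>\<omega>. (X \<omega>)\<^sup>2) = \<sigma>\<^sup>2"
      using normal_distributed_variance[OF 1] mean by simp
    have D: "distributed M lborel (\<lambda>\<omega>. X \<omega> / \<sigma>) std_normal_density"
      using 1 normal_standard_normal_convert[of \<sigma> X 0] \<mu> by simp
    have "(\<integral>\<omega>. iexp (X \<omega>) \<partial>M) = (\<integral>\<omega>. iexp (\<sigma> * (X \<omega> / \<sigma>)) \<partial>M)" using 1 by simp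
    also have "\<dots> = (\<integral>x. iexp (\<sigma> * x) \<partial>distr M lborel (\<lambda>\<omega>. X \<omega> / \<sigma>))"
      by (subst integral_distr) auto
    also have "distr M lborel (\<lambda>\<omega>. X \<omega> / \<sigma>) = std_normal_distribution"
      using distributed_distr_eq_density[OF D] by simp
    also have "(\<integral>x. iexp (\<sigma> * x) \<partial>std_normal_distribution) = char std_normal_distribution \<sigma>"
      by (simp add: char_def)
    finally show ?thesis by (simp add: var char_std_normal_distribution)
  next
    case 2
    have "expectation X = expectation (\<lambda>_. \<mu>)" using 2 by (intro integral_cong_AE) auto
    then have "\<mu> = 0" using mean prob_space by simp
    then have ae: "AE \<omega> in M. X \<omega> = 0" using 2 by simp
    have "(\<integral>\<omega>. iexp (X \<omega>) \<partial>M) = (\<integral>\<omega>. 1 \<partial>M)"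
      using ae by (intro integral_cong_AE) auto
    moreover have "expectation (\<lambda>\<omega>. (X \<omega>)\<^sup>2) = expectation (\<lambda>_. 0)"
      using ae by (intro integral_cong_AE) auto
    ultimately show ?thesis using prob_space by simp
  qed
qed

end

section \<open>Covariances of the edge increments\<close>

abbreviation lcp :: "vertex \<Rightarrow> vertex \<Rightarrow> nat" where
  "lcp v w \<equiv> length (longest_common_prefix v w)"

lemma lcp_commute: "lcp v w = lcp w v"
  by (induction v w rule: longest_common_prefix.induct) auto

lemma lcp_take: "lcp v (take k w) = min k (lcp v w)"
proof (induction v w arbitrary: k rule: longest_common_prefix.induct)
  case (1 x xs y ys)
  then show ?case by (cases k) auto
qed auto

lemma lcp_le: "lcp v w \<le> length v"
  by (induction v w rule: longest_common_prefix.induct) auto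

lemma lcp_full: "lcp v w = length v \<Longrightarrow> lcp v w = length w \<Longrightarrow> v = w"
  by (induction v w rule: longest_common_prefix.induct) (auto split: if_splits)

lemma lcp_self: "lcp v v = length v"
  by (induction v) auto

text \<open>The left side is the covariance of the increments over the edges ending in
  \<open>v\<close> and \<open>w\<close>. Dropping the last letter changes the common prefix only if
  the prefix is the whole word; the four terms cancel unless this happens for both words, that is,
  unless they are equal.\<close>

lemma lcp_increment:
  assumes "v \<noteq> []" "w \<noteq> []"
  shows "real (lcp v w) - real (lcp v (butlast w)) - real (lcp (butlast v) w) + real (lcp (butlast v) (butlast w))
    = of_bool (v = w)"
proof -
  let ?l = "lcp v w" and ?p = "length v - 1" and ?q = "length w - 1"
  have 1: "lcp v (butlast w) = min ?q ?l" by (simp add: butlast_conv_take lcp_take)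
  have 2: "lcp (butlast v) w = min ?p ?l"
    using lcp_take[of w ?p v] by (simp add: butlast_conv_take lcp_commute[of _ w])
  have 3: "lcp (butlast v) (butlast w) = min ?q (min ?p ?l)"
    using lcp_take[of "butlast v" ?q w] by (simp add: butlast_conv_take[of w] 2)
  have l: "?l \<le> Suc ?p" "?l \<le> Suc ?q" using lcp_le[of v w] lcp_le[of w v] assms by (auto simp: lcp_commute)
  show ?thesis
  proof (cases "?l = Suc ?p \<and> ?l = Suc ?q")
    case True
    then have "v = w" using lcp_full[of v w] assms by auto
    then show ?thesis unfolding 1 2 3 using True by auto
  next
    case False
    moreover have "v \<noteq> w" using False assms by (auto simp: lcp_self)
    ultimately show ?thesis unfolding 1 2 3 using l by (auto simp: min_def)
  qed
qed

context
  fixes M :: "'a measure" and h :: "vertex \<Rightarrow> 'a \<Rightarrow> real"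
  assumes tf: "tree_field M h"
begin

interpretation prob_space M
  using tf by (simp add: tree_field_def gaussian_process_def)

text \<open>At the root \<open>butlast [] = []\<close> makes this 0 rather than a standard normal
  variable, hence the exclusion of \<open>[]\<close> below.\<close>

definition increment :: "vertex \<Rightarrow> 'a \<Rightarrow> real" where
  "increment v \<omega> = h v \<omega> - h (butlast v) \<omega>"

lemma field_combination: "finite F \<Longrightarrow> gaussian_rv M (\<lambda>\<omega>. \<Sum>v\<in>F. c v * h v \<omega>)"
  using tf by (simp add: tree_field_def gaussian_process_def)

lemma field_gaussian: "gaussian_rv M (h v)"
  using field_combination[of "{v}" "\<lambda>_. 1"] by simp

lemma field_measurable [measurable]: "h v \<in> borel_measurable M"
  using field_gaussian by (simp add: gaussian_rv_def)

lemma field_integrable: "integrable M (h v)"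
  by (rule gaussian_rv_square_integrable[OF field_gaussian])

lemma field_product_integrable: "integrable M (\<lambda>\<omega>. h v \<omega> * h w \<omega>)"
proof (rule Bochner_Integration.integrable_bound)
  show "integrable M (\<lambda>\<omega>. (h v \<omega>)\<^sup>2 + (h w \<omega>)\<^sup>2)"
    by (intro Bochner_Integration.integrable_add gaussian_rv_square_integrable field_gaussian)
  show "AE \<omega> in M. norm (h v \<omega> * h w \<omega>) \<le> norm ((h v \<omega>)\<^sup>2 + (h w \<omega>)\<^sup>2)"
  proof (rule AE_I2)
    fix \<omega>
    have "0 \<le> (\<bar>h v \<omega>\<bar> - \<bar>h w \<omega>\<bar>)\<^sup>2" by simp
    then have "2 * (\<bar>h v \<omega>\<bar> * \<bar>h w \<omega>\<bar>) \<le> (h v \<omega>)\<^sup>2 + (h w \<omega>)\<^sup>2"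
      unfolding power2_diff power2_abs by (simp add: mult.assoc)
    moreover have "0 \<le> \<bar>h v \<omega>\<bar> * \<bar>h w \<omega>\<bar>" by simp
    ultimately have "\<bar>h v \<omega>\<bar> * \<bar>h w \<omega>\<bar> \<le> (h v \<omega>)\<^sup>2 + (h w \<omega>)\<^sup>2" by linarith
    then show "norm (h v \<omega> * h w \<omega>) \<le> norm ((h v \<omega>)\<^sup>2 + (h w \<omega>)\<^sup>2)" by (simp add: abs_mult)
  qed
qed simp

lemma field_mean: "expectation (h v) = 0"
  using tf by (simp add: tree_field_def)

lemma field_covariance: "expectation (\<lambda>\<omega>. h v \<omega> * h w \<omega>) = real (lcp v w)"
  using tf by (simp add: tree_field_def)

text \<open>Variance 0 fixes the root value only almost surely, so the representation of the field
  by path sums is an almost sure identity.\<close>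

lemma field_root: "AE \<omega> in M. h [] \<omega> = 0"
proof -
  have "expectation (\<lambda>\<omega>. h [] \<omega> * h [] \<omega>) = 0" by (simp add: field_covariance)
  then have "AE \<omega> in M. h [] \<omega> * h [] \<omega> = 0"
    using integral_nonneg_eq_0_iff_AE[OF field_product_integrable, of "[]" "[]"] by simp
  then show ?thesis by eventually_elim simp
qed

lemma increment_measurable [measurable]: "increment v \<in> borel_measurable M"
  unfolding increment_def by measurable

text \<open>Gaussianity is given for combinations of field values. The coefficient at
  \<open>u\<close> collects its own edge and, with a minus sign, the edges to its children.\<close>

lemma increment_combination:
  assumes F: "finite F"
  shows "gaussian_rv M (\<lambda>\<omega>. \<Sum>v\<in>F. t v * increment v \<omega>)"
proof -
  let ?G = "F \<union> butlast ` F"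
  let ?c = "\<lambda>u. (if u \<in> F then t u else 0) - (\<Sum>v\<in>{v \<in> F. butlast v = u}. t v)"
  have "(\<Sum>v\<in>F. t v * increment v \<omega>) = (\<Sum>u\<in>?G. ?c u * h u \<omega>)" for \<omega>
  proof -
    have "(\<Sum>u\<in>?G. ?c u * h u \<omega>) = (\<Sum>u\<in>?G. (if u \<in> F then t u else 0) * h u \<omega>)
        - (\<Sum>u\<in>?G. (\<Sum>v\<in>{v \<in> F. butlast v = u}. t v * h (butlast v) \<omega>))"
      by (simp add: left_diff_distrib sum_subtractf sum_distrib_right)
    also have "(\<Sum>u\<in>?G. (if u \<in> F then t u else 0) * h u \<omega>) = (\<Sum>u\<in>F. t u * h u \<omega>)"
      using F by (intro sum.mono_neutral_cong_right) auto
    also have "(\<Sum>u\<in>?G. (\<Sum>v\<in>{v \<in> F. butlast v = u}. t v * h (butlast v) \<omega>)) = (\<Sum>v\<in>F. t v * h (butlast v) \<omega>)"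
      using F by (intro sum.group) auto
    finally show ?thesis by (simp add: increment_def right_diff_distrib sum_subtractf)
  qed
  then show ?thesis using field_combination[of ?G ?c] F by simp
qed

lemma increment_covariance:
  assumes "v \<noteq> []" "w \<noteq> []"
  shows "integrable M (\<lambda>\<omega>. increment v \<omega> * increment w \<omega>)"
    and "expectation (\<lambda>\<omega>. increment v \<omega> * increment w \<omega>) = of_bool (v = w)"
proof -
  have e: "increment v \<omega> * increment w \<omega> = h v \<omega> * h w \<omega> - h v \<omega> * h (butlast w) \<omega>
      - h (butlast v) \<omega> * h w \<omega> + h (butlast v) \<omega> * h (butlast w) \<omega>" for \<omega>
    by (simp add: increment_def algebra_simps)
  show "integrable M (\<lambda>\<omega>. increment v \<omega> * increment w \<omega>)"
    unfolding e by (intro Bochner_Integration.integrable_add Bochner_Integration.integrable_diff field_product_integrable)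
  show "expectation (\<lambda>\<omega>. increment v \<omega> * increment w \<omega>) = of_bool (v = w)"
    unfolding e using field_product_integrable lcp_increment[OF assms] by (simp add: field_covariance)
qed

lemma increments_iid:
  assumes F: "finite F" "F \<noteq> {}" "[] \<notin> F"
  shows "indep_vars (\<lambda>_. borel) increment F"
    and "\<And>v. v \<in> F \<Longrightarrow> distr M borel (increment v) = std_normal_distribution"
proof -
  have "(\<integral>\<omega>. iexp (\<Sum>v\<in>F. t v * increment v \<omega>) \<partial>M) = exp (- (\<Sum>v\<in>F. (t v)\<^sup>2) / 2)" for t
  proof -
    have ii: "integrable M (increment v)" for v
      unfolding increment_def by (intro Bochner_Integration.integrable_diff field_integrable)
    have "expectation (increment v) = 0" for v
      unfolding increment_def using field_integrable by (simp add: field_mean)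
    then have "expectation (\<lambda>\<omega>. \<Sum>v\<in>F. t v * increment v \<omega>) = 0"
      using ii by (subst Bochner_Integration.integral_sum) auto
    moreover have "expectation (\<lambda>\<omega>. (\<Sum>v\<in>F. t v * increment v \<omega>)\<^sup>2) = (\<Sum>v\<in>F. (t v)\<^sup>2)"
    proof -
      have "(\<Sum>v\<in>F. t v * increment v \<omega>)\<^sup>2
          = (\<Sum>v\<in>F. \<Sum>w\<in>F. (t v * t w) * (increment v \<omega> * increment w \<omega>))" for \<omega>
        by (simp add: power2_eq_square sum_product ac_simps)
      then have "expectation (\<lambda>\<omega>. (\<Sum>v\<in>F. t v * increment v \<omega>)\<^sup>2)
          = expectation (\<lambda>\<omega>. \<Sum>v\<in>F. \<Sum>w\<in>F. (t v * t w) * (increment v \<omega> * increment w \<omega>))"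
        by (simp only:)
      also have "\<dots> = (\<Sum>v\<in>F. \<Sum>w\<in>F. (t v * t w) * of_bool (v = w))"
      proof (subst Bochner_Integration.integral_sum)
        have iv: "integrable M (\<lambda>\<omega>. (t v * t w) * (increment v \<omega> * increment w \<omega>))" if "v \<in> F" "w \<in> F" for v w
          using that F by (intro integrable_mult_right increment_covariance) auto
        then show "\<And>v. v \<in> F \<Longrightarrow> integrable M (\<lambda>\<omega>. \<Sum>w\<in>F. (t v * t w) * (increment v \<omega> * increment w \<omega>))"
          by (intro Bochner_Integration.integrable_sum) auto
        show "(\<Sum>v\<in>F. expectation (\<lambda>\<omega>. \<Sum>w\<in>F. (t v * t w) * (increment v \<omega> * increment w \<omega>)))
            = (\<Sum>v\<in>F. \<Sum>w\<in>F. (t v * t w) * of_bool (v = w))"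
        proof (rule sum.cong[OF refl])
          fix v assume v: "v \<in> F"
          have "expectation (\<lambda>\<omega>. \<Sum>w\<in>F. (t v * t w) * (increment v \<omega> * increment w \<omega>))
              = (\<Sum>w\<in>F. expectation (\<lambda>\<omega>. (t v * t w) * (increment v \<omega> * increment w \<omega>)))"
            by (rule Bochner_Integration.integral_sum) (use iv v in auto)
          also have "\<dots> = (\<Sum>w\<in>F. (t v * t w) * of_bool (v = w))"
            unfolding integral_mult_right_zero
            by (rule sum.cong[OF refl]) (use increment_covariance(2) v F in metis)
          finally show "expectation (\<lambda>\<omega>. \<Sum>w\<in>F. (t v * t w) * (increment v \<omega> * increment w \<omega>))
              = (\<Sum>w\<in>F. (t v * t w) * of_bool (v = w))" .
        qed
      qed
      also have "\<dots> = (\<Sum>v\<in>F. (t v)\<^sup>2)"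
        using F by (intro sum.cong refl) (simp add: of_bool_def sum.delta power2_eq_square if_distrib cong: if_cong)
      finally show ?thesis .
    qed
    ultimately show ?thesis using gaussian_rv_char[OF increment_combination[OF F(1), of t]] by simp
  qed
  note * = indep_normal_from_char[OF F(1,2) increment_measurable this]
  show "indep_vars (\<lambda>_. borel) increment F" by (rule *)
  show "\<And>v. v \<in> F \<Longrightarrow> distr M borel (increment v) = std_normal_distribution" by (rule *)
qed

end

section \<open>The mean of the conditioned field\<close>

text \<open>An edge weight is indexed by the lower endpoint of the edge; the path leads from \<open>w\<close> down to \<open>w @ x\<close>.\<close>
fun path_sum :: "(vertex \<Rightarrow> real) \<Rightarrow> vertex \<Rightarrow> vertex \<Rightarrow> real" where
  "path_sum \<phi> w [] = 0"
| "path_sum \<phi> w (a # x) = \<phi> (w @ [a]) + path_sum \<phi> (w @ [a]) x"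

text \<open>The weight at \<open>w\<close> belongs to the edge above \<open>w\<close> and is left
  out, so that this edge can be integrated separately from the subtree.\<close>

definition below :: "vertex \<Rightarrow> nat \<Rightarrow> vertex set" where
  "below w n = {w @ v | v. v \<noteq> [] \<and> length v \<le> n}"

definition survives :: "nat \<Rightarrow> (vertex \<Rightarrow> real) \<Rightarrow> vertex \<Rightarrow> real \<Rightarrow> bool" where
  "survives n \<phi> w u \<longleftrightarrow> (\<forall>y\<in>leaves n. 0 \<le> u + path_sum \<phi> w y)"

lemma finite_leaves [simp]: "finite (leaves n)"
  using finite_lists_length_eq[of "UNIV :: bool set" n] by (simp add: leaves_def)

lemma finite_tree [simp]: "finite (tree n)"
  using finite_lists_length_le[of "UNIV :: bool set" n] by (simp add: tree_def)

lemma finite_below [simp]: "finite (below w n)"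
proof -
  have "below w n \<subseteq> (@) w ` tree n" by (auto simp: below_def tree_def)
  then show ?thesis by (rule finite_subset) simp
qed

lemma below_step: "w @ [a] \<in> below w (Suc n)"
  by (auto simp: below_def)

lemma below_subset: "below (w @ [a]) n \<subseteq> below w (Suc n)"
  by (auto simp: below_def)

lemma not_below_self: "w \<notin> below w n"
  by (auto simp: below_def)

lemma below_disjoint:
  "a \<noteq> b \<Longrightarrow> insert (w @ [a]) (below (w @ [a]) n) \<inter> insert (w @ [b]) (below (w @ [b]) n) = {}"
  by (auto simp: below_def)

lemma path_sum_cong:
  "(\<And>v. v \<in> below w n \<Longrightarrow> \<phi> v = \<psi> v) \<Longrightarrow> length x \<le> n \<Longrightarrow> path_sum \<phi> w x = path_sum \<psi> w x"
proof (induction x arbitrary: w n)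
  case (Cons a x)
  then obtain m where n: "n = Suc m" by (cases n) auto
  have "path_sum \<phi> (w @ [a]) x = path_sum \<psi> (w @ [a]) x"
    using Cons.prems below_subset[of w a m] by (intro Cons.IH[of _ m]) (auto simp: n)
  then show ?case using Cons.prems(1)[of "w @ [a]"] below_step[of w a m] by (simp add: n)
qed auto

lemma survives_cong:
  "(\<And>v. v \<in> below w n \<Longrightarrow> \<phi> v = \<psi> v) \<Longrightarrow> survives n \<phi> w u \<longleftrightarrow> survives n \<psi> w u"
  unfolding survives_def using path_sum_cong[of w n \<phi> \<psi>] by (auto simp: leaves_def)

lemma survives_0: "survives 0 \<phi> w u \<longleftrightarrow> 0 \<le> u"
  by (auto simp: survives_def leaves_def)

lemma survives_Suc: "survives (Suc n) \<phi> w u \<longleftrightarrow> (\<forall>a. survives n \<phi> (w @ [a]) (u + \<phi> (w @ [a])))"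
proof -
  have "leaves (Suc n) = (\<Union>a. (#) a ` leaves n)"
    by (auto simp: leaves_def length_Suc_conv)
  then show ?thesis by (simp add: survives_def add.assoc)
qed

lemma path_sum_measurable:
  assumes "\<And>v. v \<in> below w n \<Longrightarrow> (\<lambda>\<omega>. f \<omega> v) \<in> borel_measurable M" "length x \<le> n"
  shows "(\<lambda>\<omega>. path_sum (f \<omega>) w x) \<in> borel_measurable M"
  using assms
proof (induction x arbitrary: w n)
  case (Cons a x)
  then obtain m where n: "n = Suc m" by (cases n) auto
  have "(\<lambda>\<omega>. path_sum (f \<omega>) (w @ [a]) x) \<in> borel_measurable M"
    using Cons.prems below_subset[of w a m] by (intro Cons.IH[of _ m]) (auto simp: n)
  moreover have "(\<lambda>\<omega>. f \<omega> (w @ [a])) \<in> borel_measurable M"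
    using Cons.prems(1) below_step[of w a m] by (simp add: n)
  ultimately show ?case by simp
qed auto

lemma survives_measurable:
  assumes "\<And>v. v \<in> below w n \<Longrightarrow> (\<lambda>\<omega>. f \<omega> v) \<in> borel_measurable M" "u \<in> borel_measurable M"
  shows "Measurable.pred M (\<lambda>\<omega>. survives n (f \<omega>) w (u \<omega>))"
  unfolding survives_def
proof (rule pred_intros_finite)
  fix y assume "y \<in> leaves n"
  then have [measurable]: "(\<lambda>\<omega>. path_sum (f \<omega>) w y) \<in> borel_measurable M"
    using assms by (intro path_sum_measurable[of w n]) (auto simp: leaves_def)
  note assms(2)[measurable]
  show "Measurable.pred M (\<lambda>\<omega>. 0 \<le> u \<omega> + path_sum (f \<omega>) w y)" by measurable
qed simp

section \<open>Expectations over a subtree\<close>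

context prob_space begin

lemma standard_normal_integrable:
  fixes X :: "'a \<Rightarrow> real"
  assumes "X \<in> borel_measurable M" "distr M borel X = std_normal_distribution"
  shows "integrable M X"
  using gauss_integrable_id assms integrable_distr_eq[of X M borel "\<lambda>x. x"] by simp

text \<open>Fubini for one edge and the independent weights of the subtree below it. Passing the
  subtree as a restricted family makes it a random element of a product space.\<close>

lemma edge_expectation:
  fixes X :: "vertex \<Rightarrow> 'a \<Rightarrow> real" and F :: "real \<times> (vertex \<Rightarrow> real) \<Rightarrow> real"
  assumes ind: "indep_vars (\<lambda>_. borel) X J" and z: "z \<in> J" "distr M borel (X z) = std_normal_distribution"
    and S: "S \<subseteq> J" "z \<notin> S"
    and F: "F \<in> borel_measurable (borel \<Otimes>\<^sub>M (\<Pi>\<^sub>M v\<in>S. borel))"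
    and int: "integrable M (\<lambda>\<omega>. F (X z \<omega>, \<lambda>v\<in>S. X v \<omega>))"
  shows "expectation (\<lambda>\<omega>. F (X z \<omega>, \<lambda>v\<in>S. X v \<omega>))
    = (\<integral>t. expectation (\<lambda>\<omega>. F (t, \<lambda>v\<in>S. X v \<omega>)) \<partial>std_normal_distribution)"
proof -
  let ?P = "\<Pi>\<^sub>M v\<in>S. (borel :: real measure)"
  let ?Y = "\<lambda>\<omega>. \<lambda>v\<in>S. X v \<omega>"
  \<comment> \<open>Independence is applied to restrictions to disjoint index sets, so the single
    edge is wrapped as a family over \<open>{z}\<close> and unwrapped at the end.\<close>
  let ?Q = "\<Pi>\<^sub>M v\<in>{z}. (borel :: real measure)"
  let ?R = "\<lambda>\<omega>. \<lambda>v\<in>{z}. X v \<omega>"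
  define F' where "F' p = F (fst p z, snd p)" for p :: "(vertex \<Rightarrow> real) \<times> (vertex \<Rightarrow> real)"
  have "indep_var ?Q ?R ?P ?Y"
    using z S by (intro indep_var_restrict[OF ind]) auto
  then have rv: "?R \<in> measurable M ?Q" "?Y \<in> measurable M ?P"
    and D: "distr M ?Q ?R \<Otimes>\<^sub>M distr M ?P ?Y = distr M (?Q \<Otimes>\<^sub>M ?P) (\<lambda>\<omega>. (?R \<omega>, ?Y \<omega>))"
    by (auto simp: indep_var_distribution_eq)
  have Xz: "X z \<in> borel_measurable M" using ind z by (simp add: indep_vars_def)
  interpret R: prob_space "distr M ?Q ?R" by (rule prob_space_distr[OF rv(1)])
  interpret Y: prob_space "distr M ?P ?Y" by (rule prob_space_distr[OF rv(2)])
  interpret RY: pair_prob_space "distr M ?Q ?R" "distr M ?P ?Y" ..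
  have F'm: "F' \<in> borel_measurable (?Q \<Otimes>\<^sub>M ?P)"
    unfolding F'_def by (rule measurable_compose[OF _ F]) measurable
  have pm: "(\<lambda>\<omega>. (?R \<omega>, ?Y \<omega>)) \<in> measurable M (?Q \<Otimes>\<^sub>M ?P)" using rv by simp
  have "integrable (distr M (?Q \<Otimes>\<^sub>M ?P) (\<lambda>\<omega>. (?R \<omega>, ?Y \<omega>))) F'"
    using int by (subst integrable_distr_eq[OF pm F'm]) (simp add: F'_def)
  then have iF: "integrable (distr M ?Q ?R \<Otimes>\<^sub>M distr M ?P ?Y) F'" unfolding D .
  define K where "K t = (\<integral>\<psi>. F (t, \<psi>) \<partial>distr M ?P ?Y)" for t
  have Km: "K \<in> borel_measurable borel"
  proof -
    have "case_prod (\<lambda>t \<psi>. F (t, \<psi>)) \<in> borel_measurable (borel \<Otimes>\<^sub>M distr M ?P ?Y)"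
      using F by (simp add: measurable_cong_sets[OF sets_pair_measure_cong[OF refl sets_distr] refl])
    then show ?thesis unfolding K_def by (rule Y.borel_measurable_lebesgue_integral)
  qed
  have K: "K t = expectation (\<lambda>\<omega>. F (t, ?Y \<omega>))" for t
  proof -
    have "(\<lambda>\<psi>. F (t, \<psi>)) \<in> borel_measurable ?P"
      by (rule measurable_compose[OF _ F]) measurable
    then show ?thesis unfolding K_def by (rule integral_distr[OF rv(2)])
  qed
  have "expectation (\<lambda>\<omega>. F (X z \<omega>, ?Y \<omega>)) = expectation (\<lambda>\<omega>. F' (?R \<omega>, ?Y \<omega>))" by (simp add: F'_def)
  also have "\<dots> = (\<integral>p. F' p \<partial>distr M (?Q \<Otimes>\<^sub>M ?P) (\<lambda>\<omega>. (?R \<omega>, ?Y \<omega>)))"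
    by (rule integral_distr[OF pm F'm, symmetric])
  also have "\<dots> = (\<integral>p. F' p \<partial>(distr M ?Q ?R \<Otimes>\<^sub>M distr M ?P ?Y))" unfolding D ..
  also have "\<dots> = (\<integral>\<rho>. (\<integral>\<psi>. F' (\<rho>, \<psi>) \<partial>distr M ?P ?Y) \<partial>distr M ?Q ?R)"
    by (rule RY.integral_fst'[OF iF, symmetric])
  also have "\<dots> = (\<integral>\<rho>. K (\<rho> z) \<partial>distr M ?Q ?R)" by (simp add: F'_def K_def)
  also have "\<dots> = expectation (\<lambda>\<omega>. K (X z \<omega>))"
    by (subst integral_distr[OF rv(1)]) (auto intro!: measurable_compose[OF _ Km])
  also have "\<dots> = (\<integral>t. K t \<partial>distr M borel (X z))"
    by (rule integral_distr[OF Xz Km, symmetric])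
  finally show ?thesis unfolding K z(2) .
qed

text \<open>The subtrees of the two children are independent. Only one contains the path; it
  contributes its edge, giving \<open>gconv1\<close>, and the rest of the path of length k, giving 1
  - 2^(-k) times the same \<open>gconv1\<close> by integration by parts. The other child contributes
  \<open>gconv (wall n) u\<close>, and the sum 2 - 2^(-k) is twice the new coefficient, matching the
  2 in \<open>wall'\<close>.\<close>

lemma tree_expectation:
  fixes X :: "vertex \<Rightarrow> 'a \<Rightarrow> real"
  assumes ind: "indep_vars (\<lambda>_. borel) X J"
    and N: "\<And>v. v \<in> J \<Longrightarrow> distr M borel (X v) = std_normal_distribution"
  shows "below w n \<subseteq> J \<Longrightarrow> expectation (\<lambda>\<omega>. of_bool (survives n (\<lambda>v. X v \<omega>) w u)) = wall n u"
    and "below w n \<subseteq> J \<Longrightarrow> length x \<le> n \<Longrightarrow>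
      expectation (\<lambda>\<omega>. of_bool (survives n (\<lambda>v. X v \<omega>) w u) * path_sum (\<lambda>v. X v \<omega>) w x)
        = (1 - (1/2) ^ length x) * wall' n u"
proof (induction n arbitrary: w u x)
  case 0
  {
    case 1
    show ?case using prob_space by (simp add: survives_0)
  next
    case 2
    then show ?case by simp
  }
next
  case (Suc n)
  have Xm: "X v \<in> borel_measurable M" if "v \<in> J" for v
    using ind that by (simp add: indep_vars_def)
  have Xi: "integrable M (X v)" if "v \<in> J" for v
    using standard_normal_integrable Xm N that by blast
  have psi: "integrable M (\<lambda>\<omega>. path_sum (\<lambda>v. X v \<omega>) w x)" if "below w k \<subseteq> J" "length x \<le> k" for w x k
    using that
  proof (induction x arbitrary: w k)
    case (Cons a x)
    then obtain m where k: "k = Suc m" by (cases k) auto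
    have "integrable M (\<lambda>\<omega>. path_sum (\<lambda>v. X v \<omega>) (w @ [a]) x)"
      using Cons.prems below_subset[of w a m] by (intro Cons.IH[of _ m]) (auto simp: k)
    moreover have "integrable M (X (w @ [a]))" using Cons.prems below_step[of w a m] by (intro Xi) (auto simp: k)
    ultimately show ?case by simp
  qed simp
  have main: "expectation (\<lambda>\<omega>. of_bool (survives (Suc n) (\<lambda>v. X v \<omega>) w u)) = wall (Suc n) u \<and>
      (length x \<le> Suc n \<longrightarrow> expectation (\<lambda>\<omega>. of_bool (survives (Suc n) (\<lambda>v. X v \<omega>) w u) * path_sum (\<lambda>v. X v \<omega>) w x)
        = (1 - (1/2) ^ length x) * wall' (Suc n) u)"
    if wJ: "below w (Suc n) \<subseteq> J" for w u x
  proof -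
    let ?X = "\<lambda>\<omega> v. X v \<omega>"
    define I where "I a \<omega> = (of_bool (survives n (?X \<omega>) (w @ [a]) (u + X (w @ [a]) \<omega>)) :: real)" for a \<omega>
    define G where "G a = insert (w @ [a]) (below (w @ [a]) n)" for a
    have aJ: "w @ [a] \<in> J" "below (w @ [a]) n \<subseteq> J" "G a \<subseteq> J" for a
      using wJ below_step[of w a n] below_subset[of w a n] by (auto simp: G_def)
    have Ib: "0 \<le> I a \<omega>" "I a \<omega> \<le> 1" for a \<omega> by (auto simp: I_def)
    have Im: "I a \<in> borel_measurable M" for a
      unfolding I_def
      by (intro measurable_compose[OF survives_measurable]) (auto intro!: borel_measurable_add Xm aJ(1) subsetD[OF aJ(2)])
    have iI: "integrable M (I c)" for c
      using Im[of c] Ib[of c] by (intro integrable_const_bound[where B=1]) auto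
    have EI: "expectation (I a) = gconv (wall n) u" for a
    proof -
      define F where "F p = (of_bool (survives n (snd p) (w @ [a]) (u + fst p)) :: real)" for p :: "real \<times> (vertex \<Rightarrow> real)"
      let ?S = "below (w @ [a]) n"
      have Fm: "F \<in> borel_measurable (borel \<Otimes>\<^sub>M (\<Pi>\<^sub>M v\<in>?S. borel))"
        unfolding F_def by (intro measurable_compose[OF survives_measurable]) measurable
      have r: "F (t, \<lambda>v\<in>?S. X v \<omega>) = of_bool (survives n (?X \<omega>) (w @ [a]) (u + t))" for t \<omega>
        unfolding F_def using survives_cong[of "w @ [a]" n "\<lambda>v\<in>?S. X v \<omega>" "?X \<omega>"] by simp
      have "expectation (\<lambda>\<omega>. F (X (w @ [a]) \<omega>, \<lambda>v\<in>?S. X v \<omega>))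
          = (\<integral>t. expectation (\<lambda>\<omega>. F (t, \<lambda>v\<in>?S. X v \<omega>)) \<partial>std_normal_distribution)"
      proof (rule edge_expectation[OF ind aJ(1) N[OF aJ(1)] aJ(2) not_below_self Fm])
        show "integrable M (\<lambda>\<omega>. F (X (w @ [a]) \<omega>, \<lambda>v\<in>?S. X v \<omega>))"
          unfolding r using iI[of a] by (simp add: I_def[abs_def])
      qed
      then show ?thesis unfolding r Suc.IH(1)[OF aJ(2)] by (simp add: I_def[abs_def] gconv_def)
    qed
    have prod: "expectation (\<lambda>\<omega>. f a (\<lambda>v\<in>G a. X v \<omega>) * f b (\<lambda>v\<in>G b. X v \<omega>))
        = expectation (\<lambda>\<omega>. f a (\<lambda>v\<in>G a. X v \<omega>)) * expectation (\<lambda>\<omega>. f b (\<lambda>v\<in>G b. X v \<omega>))"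
      if "a \<noteq> b" "\<And>c. f c \<in> borel_measurable (\<Pi>\<^sub>M v\<in>G c. borel)"
        "\<And>c. integrable M (\<lambda>\<omega>. f c (\<lambda>v\<in>G c. X v \<omega>))" for a b and f :: "bool \<Rightarrow> (vertex \<Rightarrow> real) \<Rightarrow> real"
    proof (rule indep_var_lebesgue_integral)
      have "indep_var (\<Pi>\<^sub>M v\<in>G a. borel) (\<lambda>\<omega>. restrict (\<lambda>i. X i \<omega>) (G a)) (\<Pi>\<^sub>M v\<in>G b. borel) (\<lambda>\<omega>. restrict (\<lambda>i. X i \<omega>) (G b))"
        using below_disjoint[OF that(1)] aJ by (intro indep_var_restrict[OF ind]) (auto simp: G_def)
      from indep_var_compose[OF this that(2) that(2)]
      show "indep_var borel (\<lambda>\<omega>. f a (\<lambda>v\<in>G a. X v \<omega>)) borel (\<lambda>\<omega>. f b (\<lambda>v\<in>G b. X v \<omega>))" by (simp add: comp_def)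
    qed (use that(3) in auto)
    have surv: "of_bool (survives (Suc n) (?X \<omega>) w u) = I a \<omega> * I (\<not> a) \<omega>" for a \<omega>
      by (cases a) (auto simp: survives_Suc I_def all_bool_eq)
    have rI: "of_bool (survives n (\<lambda>v\<in>G a. X v \<omega>) (w @ [a]) (u + (\<lambda>v\<in>G a. X v \<omega>) (w @ [a]))) = I a \<omega>" for a \<omega>
      unfolding I_def using survives_cong[of "w @ [a]" n "\<lambda>v\<in>G a. X v \<omega>" "?X \<omega>"] by (simp add: G_def)
    have mI: "(\<lambda>\<psi>. of_bool (survives n \<psi> (w @ [c]) (u + \<psi> (w @ [c]))) :: real) \<in> borel_measurable (\<Pi>\<^sub>M v\<in>G c. borel)" for c
      by (intro measurable_compose[OF survives_measurable]) (auto simp: G_def)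
    have "expectation (\<lambda>\<omega>. I True \<omega> * I False \<omega>) = expectation (I True) * expectation (I False)"
      using prod[of True False "\<lambda>c \<psi>. of_bool (survives n \<psi> (w @ [c]) (u + \<psi> (w @ [c])))"] mI iI
      unfolding rI by simp
    then have first: "expectation (\<lambda>\<omega>. of_bool (survives (Suc n) (?X \<omega>) w u)) = wall (Suc n) u"
      unfolding surv[of _ True] EI by (simp add: power2_eq_square)
    moreover have "expectation (\<lambda>\<omega>. of_bool (survives (Suc n) (?X \<omega>) w u) * path_sum (?X \<omega>) w x)
        = (1 - (1/2) ^ length x) * wall' (Suc n) u" if x: "length x \<le> Suc n"
    proof (cases x)
      case (Cons a y)
      then have y: "length y \<le> n" using x by simp
      define H where "H \<omega> = I a \<omega> * (X (w @ [a]) \<omega> + path_sum (?X \<omega>) (w @ [a]) y)" for \<omega>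
      have iP: "integrable M (\<lambda>\<omega>. X (w @ [a]) \<omega> + path_sum (?X \<omega>) (w @ [a]) y)"
        by (intro Bochner_Integration.integrable_add Xi aJ psi[OF aJ(2) y])
      have iH: "integrable M H"
        unfolding H_def
      proof (rule Bochner_Integration.integrable_bound[OF iP])
        show "(\<lambda>\<omega>. I a \<omega> * (X (w @ [a]) \<omega> + path_sum (?X \<omega>) (w @ [a]) y)) \<in> borel_measurable M"
          using Im iP by (intro borel_measurable_times) auto
        show "AE \<omega> in M. norm (I a \<omega> * (X (w @ [a]) \<omega> + path_sum (?X \<omega>) (w @ [a]) y))
            \<le> norm (X (w @ [a]) \<omega> + path_sum (?X \<omega>) (w @ [a]) y)"
          using Ib[of a] by (intro AE_I2) (auto simp: abs_mult intro!: mult_left_le_one_le)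
      qed
      have EH: "expectation H = (2 - (1/2) ^ length y) * gconv1 (wall n) u"
      proof -
        define F where "F p = (of_bool (survives n (snd p) (w @ [a]) (u + fst p)) * (fst p + path_sum (snd p) (w @ [a]) y) :: real)"
          for p :: "real \<times> (vertex \<Rightarrow> real)"
        let ?S = "below (w @ [a]) n"
        have Fm: "F \<in> borel_measurable (borel \<Otimes>\<^sub>M (\<Pi>\<^sub>M v\<in>?S. borel))"
        proof -
          have [measurable]: "(\<lambda>p. of_bool (survives n (snd p) (w @ [a]) (u + fst p)) :: real) \<in> borel_measurable (borel \<Otimes>\<^sub>M (\<Pi>\<^sub>M v\<in>?S. borel))"
            by (intro measurable_compose[OF survives_measurable]) measurable
          have [measurable]: "(\<lambda>p. path_sum (snd p) (w @ [a]) y) \<in> borel_measurable (borel \<Otimes>\<^sub>M (\<Pi>\<^sub>M v\<in>?S. (borel :: real measure)))"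
            by (rule path_sum_measurable[OF _ y]) measurable
          show ?thesis unfolding F_def by measurable
        qed
        have r: "F (t, \<lambda>v\<in>?S. X v \<omega>) = of_bool (survives n (?X \<omega>) (w @ [a]) (u + t)) * (t + path_sum (?X \<omega>) (w @ [a]) y)" for t \<omega>
          unfolding F_def using survives_cong[of "w @ [a]" n "\<lambda>v\<in>?S. X v \<omega>" "?X \<omega>"]
            path_sum_cong[OF _ y, of "w @ [a]" "\<lambda>v\<in>?S. X v \<omega>" "?X \<omega>"] by simp
        have "expectation (\<lambda>\<omega>. F (X (w @ [a]) \<omega>, \<lambda>v\<in>?S. X v \<omega>))
            = (\<integral>t. expectation (\<lambda>\<omega>. F (t, \<lambda>v\<in>?S. X v \<omega>)) \<partial>std_normal_distribution)"
        proof (rule edge_expectation[OF ind aJ(1) N[OF aJ(1)] aJ(2) not_below_self Fm])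
          show "integrable M (\<lambda>\<omega>. F (X (w @ [a]) \<omega>, \<lambda>v\<in>?S. X v \<omega>))"
            unfolding r using iH by (simp add: H_def[abs_def] I_def[abs_def])
        qed
        then have EF: "expectation H = (\<integral>t. expectation (\<lambda>\<omega>. F (t, \<lambda>v\<in>?S. X v \<omega>)) \<partial>std_normal_distribution)"
          unfolding r by (simp add: H_def[abs_def] I_def[abs_def])
        have inner: "expectation (\<lambda>\<omega>. F (t, \<lambda>v\<in>?S. X v \<omega>)) = t * wall n (u + t) + (1 - (1/2) ^ length y) * wall' n (u + t)" for t
        proof -
          have [measurable]: "Measurable.pred M (\<lambda>\<omega>. survives n (?X \<omega>) (w @ [a]) (u + t))"
            using aJ(2) by (intro survives_measurable[where u="\<lambda>_. u + t"] Xm) auto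
          have m: "(\<lambda>\<omega>. of_bool (survives n (?X \<omega>) (w @ [a]) (u + t)) :: real) \<in> borel_measurable M"
            by measurable
          have i1: "integrable M (\<lambda>\<omega>. of_bool (survives n (?X \<omega>) (w @ [a]) (u + t)) :: real)"
            using m by (intro integrable_const_bound[where B=1]) auto
          have i2: "integrable M (\<lambda>\<omega>. of_bool (survives n (?X \<omega>) (w @ [a]) (u + t)) * path_sum (?X \<omega>) (w @ [a]) y)"
          proof (rule Bochner_Integration.integrable_bound[OF psi[OF aJ(2) y]])
            show "(\<lambda>\<omega>. of_bool (survives n (?X \<omega>) (w @ [a]) (u + t)) * path_sum (?X \<omega>) (w @ [a]) y) \<in> borel_measurable M"
              using m psi[OF aJ(2) y] by (intro borel_measurable_times) auto
          qed (auto simp: abs_mult)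
          have "expectation (\<lambda>\<omega>. F (t, \<lambda>v\<in>?S. X v \<omega>))
              = expectation (\<lambda>\<omega>. t * of_bool (survives n (?X \<omega>) (w @ [a]) (u + t))
                + of_bool (survives n (?X \<omega>) (w @ [a]) (u + t)) * path_sum (?X \<omega>) (w @ [a]) y)"
            unfolding r by (simp add: algebra_simps)
          also have "\<dots> = t * wall n (u + t) + (1 - (1/2) ^ length y) * wall' n (u + t)"
            using i1 i2 Suc.IH(1)[OF aJ(2)] Suc.IH(2)[OF aJ(2) y]
            by (subst Bochner_Integration.integral_add) auto
          finally show ?thesis .
        qed
        have "expectation H = gconv1 (wall n) u + (1 - (1/2) ^ length y) * gconv (wall' n) u"
          unfolding EF inner gconv_def gconv1_def by (subst Bochner_Integration.integral_add) auto
        \<comment> \<open>At \<open>n = 0\<close> the path \<open>y\<close> is empty, so the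
          coefficient vanishes and integration by parts is not called upon.\<close>
        moreover have "(1 - (1/2) ^ length y) * gconv (wall' n) u = (1 - (1/2) ^ length y) * gconv1 (wall n) u"
          using y gconv_wall'[of n u] by (cases "n = 0") auto
        ultimately show ?thesis by (simp add: algebra_simps)
      qed
      \<comment> \<open>One family indexed by the child, so that the product rule applies whichever
        child carries the path.\<close>
      define f where "f c \<psi> = of_bool (survives n \<psi> (w @ [c]) (u + \<psi> (w @ [c]))) *
          (if c = a then \<psi> (w @ [a]) + path_sum \<psi> (w @ [a]) y else 1)" for c and \<psi> :: "vertex \<Rightarrow> real"
      have fa: "f a (\<lambda>v\<in>G a. X v \<omega>) = H \<omega>" for \<omega>
        unfolding f_def rI H_def using path_sum_cong[OF _ y, of "w @ [a]" "\<lambda>v\<in>G a. X v \<omega>" "?X \<omega>"]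
        by (simp add: G_def)
      have fb: "f (\<not> a) (\<lambda>v\<in>G (\<not> a). X v \<omega>) = I (\<not> a) \<omega>" for \<omega>
        unfolding f_def rI by simp
      have fm: "f c \<in> borel_measurable (\<Pi>\<^sub>M v\<in>G c. borel)" for c
      proof (cases "c = a")
        case True
        have "(\<lambda>\<psi>. path_sum \<psi> (w @ [a]) y) \<in> borel_measurable (\<Pi>\<^sub>M v\<in>G a. (borel :: real measure))"
          by (rule path_sum_measurable[OF _ y]) (auto simp: G_def)
        moreover have "(\<lambda>\<psi>. \<psi> (w @ [a])) \<in> borel_measurable (\<Pi>\<^sub>M v\<in>G a. (borel :: real measure))"
          by (auto simp: G_def)
        ultimately show ?thesis unfolding f_def using True mI[of a] by (auto intro!: borel_measurable_times borel_measurable_add)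
      next
        case False
        then show ?thesis unfolding f_def using mI[of c] by simp
      qed
      have fi: "integrable M (\<lambda>\<omega>. f c (\<lambda>v\<in>G c. X v \<omega>))" for c
        using fa fb iH iI[of "\<not> a"] by (cases "c = a") auto
      have "expectation (\<lambda>\<omega>. of_bool (survives (Suc n) (?X \<omega>) w u) * path_sum (?X \<omega>) w x)
          = expectation (\<lambda>\<omega>. f a (\<lambda>v\<in>G a. X v \<omega>) * f (\<not> a) (\<lambda>v\<in>G (\<not> a). X v \<omega>))"
        unfolding fa fb surv[of _ a] Cons H_def by (simp add: ac_simps)
      also have "\<dots> = expectation H * expectation (I (\<not> a))"
        using prod[of a "\<not> a" f] fm fi unfolding fa fb by simp
      also have "\<dots> = (1 - (1/2) ^ length x) * wall' (Suc n) u"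
        unfolding EH EI Cons by (simp add: algebra_simps)
      finally show ?thesis .
    qed simp
    ultimately show ?thesis by blast
  qed
  {
    case 1
    then show ?case using main by blast
  next
    case 2
    then show ?case using main by blast
  }
qed

end

lemma (in finite_measure) integral_uniform_measure:
  fixes f :: "'a \<Rightarrow> real"
  assumes A [measurable]: "A \<in> sets M" and pos: "measure M A \<noteq> 0" and f: "f \<in> borel_measurable M"
  shows "(\<integral>x. f x \<partial>uniform_measure M A) = (\<integral>x. indicator A x * f x \<partial>M) / measure M A"
proof -
  have "indicator A x / emeasure M A = ennreal (indicator A x / measure M A)" for x
    using pos divide_ennreal[of 1 "measure M A"]
    by (auto simp: emeasure_eq_measure indicator_def zero_less_measure_iff)
  then have "uniform_measure M A = density M (\<lambda>x. ennreal (indicator A x / measure M A))"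
    by (simp add: uniform_measure_def)
  then have "(\<integral>x. f x \<partial>uniform_measure M A) = (\<integral>x. (indicator A x / measure M A) *\<^sub>R f x \<partial>M)"
    using f by (simp add: integral_density)
  then show ?thesis by simp
qed

lemma sum_increments: "tree_field M h \<Longrightarrow> path_sum (\<lambda>v. increment h v \<omega>) w x = h (w @ x) \<omega> - h w \<omega>"
proof (induction x arbitrary: w)
  case (Cons a x)
  then show ?case using Cons.IH[of "w @ [a]"] by (simp add: increment_def[of M])
qed simp

text \<open>A change of variables brings the conditioned law back to \<open>M\<close>, where
  numerator and denominator are the two expectations for the whole tree started at height 0.\<close>

lemma field_law_plus_mean:
  assumes tf: "tree_field M h" and n: "1 \<le> n" and x: "x \<in> tree n"
  shows "(\<integral>\<phi>. \<phi> x \<partial>field_law_plus M h n) = (1 - (1/2) ^ length x) * (wall' n 0 / wall n 0)"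
proof -
  interpret prob_space M using tf by (simp add: tree_field_def gaussian_process_def)
  let ?N = "\<Pi>\<^sub>M x\<in>tree n. (borel :: real measure)"
  let ?g = "\<lambda>\<omega>. \<lambda>x\<in>tree n. h x \<omega>"
  let ?X = "\<lambda>\<omega> v. increment h v \<omega>"
  note [measurable] = field_measurable[OF tf]
  have g [measurable]: "?g \<in> measurable M ?N" by measurable
  interpret D: prob_space "field_law M h n" unfolding field_law_def by (rule prob_space_distr[OF g])
  have sets_law: "sets (field_law M h n) = sets ?N" by (simp add: field_law_def)
  have lt: "leaves n \<subseteq> tree n" by (auto simp: leaves_def tree_def)
  have \<Omega>: "Omega_plus n \<in> sets ?N"
    unfolding Omega_plus_def using lt by (intro sets.sets_Collect_finite_All) auto
  have xm: "(\<lambda>\<phi>. \<phi> x) \<in> borel_measurable ?N" using x by measurable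
  have B: "below [] n \<noteq> {}" "[] \<notin> below [] n" using n by (auto simp: below_def intro!: exI[of _ "[True]"])
  note te = tree_expectation[OF increments_iid[OF tf finite_below B] order_refl]
  have path: "AE \<omega> in M. \<forall>y. h y \<omega> = path_sum (?X \<omega>) [] y"
    using field_root[OF tf] by eventually_elim (simp add: sum_increments[OF tf])
  have ind: "AE \<omega> in M. indicator (Omega_plus n) (?g \<omega>) = (of_bool (survives n (?X \<omega>) [] 0) :: real)"
    using path
  proof eventually_elim
    case (elim \<omega>)
    have "?g \<omega> \<in> Omega_plus n \<longleftrightarrow> (\<forall>y\<in>leaves n. 0 \<le> h y \<omega>)"
      using lt by (auto simp: Omega_plus_def space_PiM PiE_iff)
    then show ?case using elim by (simp add: indicator_def survives_def)
  qed
  have im: "(\<lambda>\<phi>. indicator (Omega_plus n) \<phi> :: real) \<in> borel_measurable ?N"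
    using \<Omega> by simp
  have sm: "Measurable.pred M (\<lambda>\<omega>. survives n (?X \<omega>) [] 0)"
    using increment_measurable[OF tf] by (intro survives_measurable[where u="\<lambda>_. 0"]) auto
  have pm: "(\<lambda>\<omega>. path_sum (?X \<omega>) [] x) \<in> borel_measurable M"
    using increment_measurable[OF tf] x by (intro path_sum_measurable[of _ n]) (auto simp: tree_def)
  have igm: "(\<lambda>\<omega>. indicator (Omega_plus n) (?g \<omega>) :: real) \<in> borel_measurable M"
    by (rule measurable_compose[OF g im])
  have "measure (field_law M h n) (Omega_plus n) = (\<integral>\<phi>. indicator (Omega_plus n) \<phi> \<partial>field_law M h n)"
    using \<Omega> sets.sets_into_space[OF \<Omega>] by (simp add: field_law_def Int_absorb2)
  also have "\<dots> = expectation (\<lambda>\<omega>. indicator (Omega_plus n) (?g \<omega>))"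
    unfolding field_law_def by (rule integral_distr[OF g im])
  also have "\<dots> = expectation (\<lambda>\<omega>. of_bool (survives n (?X \<omega>) [] 0))"
    using ind igm sm by (intro integral_cong_AE) auto
  also have "\<dots> = wall n 0" by (rule te)
  finally have m: "measure (field_law M h n) (Omega_plus n) = wall n 0" .
  have "(\<integral>\<phi>. \<phi> x \<partial>field_law_plus M h n)
      = (\<integral>\<phi>. indicator (Omega_plus n) \<phi> * \<phi> x \<partial>field_law M h n) / wall n 0"
    unfolding field_law_plus_def using wall_pos[of n 0] n \<Omega> xm
    by (subst D.integral_uniform_measure) (auto simp: m sets_law measurable_cong_sets[OF sets_law refl])
  also have "(\<integral>\<phi>. indicator (Omega_plus n) \<phi> * \<phi> x \<partial>field_law M h n)
      = expectation (\<lambda>\<omega>. indicator (Omega_plus n) (?g \<omega>) * h x \<omega>)"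
    unfolding field_law_def using x by (subst integral_distr[OF g]) (auto intro!: borel_measurable_times im xm)
  also have "\<dots> = expectation (\<lambda>\<omega>. of_bool (survives n (?X \<omega>) [] 0) * path_sum (?X \<omega>) [] x)"
    using ind path sm pm igm by (intro integral_cong_AE) (auto intro!: borel_measurable_times field_measurable[OF tf])
  also have "\<dots> = (1 - (1/2) ^ length x) * wall' n 0"
    using x by (intro te) (auto simp: tree_def)
  finally show ?thesis by simp
qed

section \<open>Assembling the estimates\<close>

lemma m_seq_abs_le: "1 \<le> k \<Longrightarrow> \<bar>m_seq k\<bar> \<le> 3/2 * real k"
proof -
  assume k: "1 \<le> k"
  have "c0 * real k \<le> 3/2 * real k" using c0_less by (intro mult_right_mono) auto
  moreover have "inverse c0 * ln (real k) \<le> 1 * real k"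
    using k c0_ge_1 ln_le_minus_one[of "real k"] by (intro mult_mono) (auto simp: field_simps)
  moreover have "0 \<le> inverse c0 * ln (real k)" using k c0_ge_1 by simp
  moreover have "0 \<le> c0 * real k" using c0_ge_1 by simp
  ultimately show ?thesis unfolding m_seq_def by linarith
qed

text \<open>\<open>q\<close> stands for 2^(-k) at depth k and \<open>s\<close> for shallow vertices.
  There both expressions carry the factor \<open>1 - q\<close>; at deep vertices the error also
  contains \<open>q * A\<close>.\<close>

lemma conditional_mean_bound:
  fixes A b q C :: real
  assumes q: "0 \<le> q" "q \<le> 1" and A: "\<bar>A - b\<bar> \<le> C" and s: "\<not> s \<Longrightarrow> q * \<bar>A\<bar> \<le> D" and D: "0 \<le> D"
  shows "\<bar>(1 - q) * A - b * (1 - q * of_bool s)\<bar> \<le> C + D"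
proof (cases s)
  case True
  have "\<bar>(1 - q) * A - b * (1 - q)\<bar> = (1 - q) * \<bar>A - b\<bar>"
    using q abs_mult[of "1 - q" "A - b"] by (simp add: algebra_simps)
  also have "\<dots> \<le> 1 * \<bar>A - b\<bar>" using q by (intro mult_right_mono) auto
  finally show ?thesis using True A D by simp
next
  case False
  have "\<bar>(1 - q) * A - b\<bar> \<le> \<bar>A - b\<bar> + \<bar>q * A\<bar>" by (simp add: left_diff_distrib)
  then show ?thesis using False A s q by (simp add: abs_mult)
qed

theorem corollary1p4:
  fixes M :: "'a measure" and h :: "vertex \<Rightarrow> 'a \<Rightarrow> real"
  assumes "tree_field M h"
  shows "\<exists>C :: real. \<forall>n\<ge>1. \<forall>x\<in>tree n.
    \<bar>(\<integral>\<phi>. \<phi> x \<partial>field_law_plus M h n)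
       - m_seq (n - l_seq n) * (1 - (1 / 2) ^ length x * of_bool (length x < l_seq n))\<bar> \<le> C"
proof -
  define A where "A n = wall' n 0 / wall n 0" for n
  define b where "b n = m_seq (n - l_seq n)" for n
  obtain C0 n0 where C0: "\<And>n. n0 \<le> n \<Longrightarrow> \<bar>A n - b n\<bar> \<le> C0"
    unfolding A_def b_def by (rule wall_log_derivative_eventually) blast
  \<comment> \<open>The sum absorbs the finitely many small \<open>n\<close>. The bound then holds
    for every \<open>n\<close>, including 0, which also yields \<open>0 \<le> C\<close>.\<close>
  define C where "C = \<bar>C0\<bar> + (\<Sum>n<n0. \<bar>A n - b n\<bar>)"
  have C: "\<bar>A n - b n\<bar> \<le> C" for n
  proof (cases "n < n0")
    case True
    then have "\<bar>A n - b n\<bar> \<le> (\<Sum>n<n0. \<bar>A n - b n\<bar>)" by (intro member_le_sum) auto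
    then show ?thesis by (simp add: C_def)
  next
    case False
    have "0 \<le> (\<Sum>n<n0. \<bar>A n - b n\<bar>)" by (intro sum_nonneg) auto
    then show ?thesis using C0[of n] False unfolding C_def by linarith
  qed
  have "0 \<le> C" using C[of 0] by linarith
  show ?thesis
  proof (intro exI allI impI ballI)
    fix n x assume n: "1 \<le> n" and x: "x \<in> tree n"
    let ?q = "(1/2 :: real) ^ length x"
    have l: "real n < 2 * 2 ^ l_seq n" "l_seq n < n" using l_seq_bounds[OF n] by auto
    have bn: "\<bar>b n\<bar> \<le> 3/2 * real n"
      using m_seq_abs_le[of "n - l_seq n"] l(2) unfolding b_def by linarith
    \<comment> \<open>From depth \<open>l_seq n\<close> on the factor is at most
      \<open>2 / n\<close>, while \<open>A n\<close> is at most \<open>3/2 * n + C\<close> in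
      absolute value.\<close>
    have deep: "?q * \<bar>A n\<bar> \<le> 3 + 2 * C" if "\<not> length x < l_seq n"
    proof -
      have "?q \<le> (1/2) ^ l_seq n" using that by (intro power_decreasing) auto
      also have "\<dots> \<le> 2 / real n" using l(1) n by (simp add: power_one_over field_simps)
      finally have "?q * \<bar>A n\<bar> \<le> 2 / real n * (3/2 * real n + C)"
        using bn C[of n] by (intro mult_mono) auto
      also have "\<dots> = 3 + 2 * C / real n" using n by (simp add: field_simps)
      also have "\<dots> \<le> 3 + 2 * C" using n \<open>0 \<le> C\<close> by (simp add: divide_le_eq mult_left_le_one_le mult_le_cancel_left1)
      finally show ?thesis .
    qed
    have "\<bar>(1 - ?q) * A n - b n * (1 - ?q * of_bool (length x < l_seq n))\<bar> \<le> C + (3 + 2 * C)"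
      using C deep \<open>0 \<le> C\<close> by (intro conditional_mean_bound) (auto simp: power_le_one)
    then show "\<bar>(\<integral>\<phi>. \<phi> x \<partial>field_law_plus M h n)
       - m_seq (n - l_seq n) * (1 - (1 / 2) ^ length x * of_bool (length x < l_seq n))\<bar> \<le> C + (3 + 2 * C)"
      unfolding field_law_plus_mean[OF assms n x] A_def b_def .
  qed
qed

end
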